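(* Let $X=(X_n)_{n\ge 1}$ be a real-valued centered stationary Gaussian sequence with unit variance, defined on a probability space $(\Omega,\mathscr{F},\mathbb{P})$, with correlation function $\rho:\mathbb{N}\to\mathbb{R}$, $\rho(|k-\ell|)=\mathbb{E}[X_kX_\ell]$ for all $k,\ell\ge 1$. Suppose that $f\in\mathbb{D}^{1,2}(\mathbb{R},\gamma)$ has Hermite rank $d\ge 1$, with Hermite expansion $f=\sum_{m=d}^{\infty}c_mH_m$, $c_d\neq 0$. Suppose moreover that $\rho\in\ell^d(\mathbb{N})$, i.e. $\sum_{k\in\mathbb{N}}|\rho(k)|^d<+\infty$, and that $$\sigma^2:=\sum_{m=d}^{\infty}m!\,c_m^2\sum_{k\in\mathbb{Z}}\rho(|k|)^m$$ is positive. Set $S_n(f):=\frac{1}{\sqrt{n}}\sum_{k=1}^n f(X_k)$. Then $$d_{\mathrm{TV}}\left(\frac{S_n(f)}{\sqrt{\mathrm{var}(S_n(f))}},\,\mathcal{N}(0,1)\right)\xrightarrow[n\to+\infty]{}0.$$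
   Context: $\gamma(dx)=(2\pi)^{-1/2}e^{-x^2/2}\,dx$ is the standard Gaussian measure on $\mathbb{R}$, and $\mathcal{N}(0,\sigma^2)$ is the law of a centered normal variable with variance $\sigma^2$. Here $\mathbb{N}=\{0,1,2,\ldots\}$. The Hermite polynomials $(H_m)_{m\ge 0}$, orthogonal with respect to $\gamma$, are $H_0\equiv 1$ and $H_m(x)=(-1)^m e^{x^2/2}\frac{d^m}{dx^m}e^{-x^2/2}$ for $m\ge 1$. A function $f\in L^2(\mathbb{R},\gamma)$ has Hermite rank $d\ge 0$ if it can be decomposed (in $L^2(\mathbb{R},\gamma)$) as $f=\sum_{m=d}^{+\infty}c_mH_m$ with $c_d\neq 0$. The Malliavin--Sobolev space $\mathbb{D}^{1,2}(\mathbb{R},\gamma)$ is the completion of the family of polynomial functions $q:\mathbb{R}\to\mathbb{R}$ with respect to the norm $\|q\|_{1,2}=\left(\int_{\mathbb{R}}\left(|q(x)|^2+|q'(x)|^2\right)\gamma(dx)\right)^{1/2}$, viewed as a subspace of $L^2(\mathbb{R},\gamma)$. The total variation distance between the distributions of two real random variables $X$ and $Y$ is $d_{\mathrm{TV}}(X,Y):=\sup_{A\in\mathcal{B}(\mathbb{R})}|\mathbb{P}(X\in A)-\mathbb{P}(Y\in A)|$, where $\mathcal{B}(\mathbb{R})$ is the Borel sigma-field of $\mathbb{R}$; when a law is written in place of a random variable, it stands for any random variable with that law. *)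

theory Defs
  imports "HOL-Probability.Probability" "HOL-Computational_Algebra.Polynomial"
begin

text \<open>The normal law with mean \<open>\<mu>\<close> and variance \<open>v\<close>. For \<open>v = 0\<close> it is the Dirac mass at
  \<open>\<mu>\<close>; this case is needed because a linear combination of jointly Gaussian variables may be
  degenerate. The second argument of \<^const>\<open>normal_density\<close> is the standard deviation.\<close>

definition normal_law :: "real \<Rightarrow> real \<Rightarrow> real measure" where
  "normal_law \<mu> v =
     (if v = 0 then return borel \<mu> else density lborel (\<lambda>x. ennreal (normal_density \<mu> (sqrt v) x)))"

definition std_gaussian :: "real measure" where
  "std_gaussian = density lborel (\<lambda>x. ennreal (std_normal_density x))"

lemma normal_law_0_1: "normal_law 0 1 = std_gaussian"
  by (simp add: normal_law_def std_gaussian_def)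

definition hermite :: "nat \<Rightarrow> real \<Rightarrow> real" where
  "hermite m x = (-1) ^ m * exp (x\<^sup>2 / 2) * (deriv ^^ m) (\<lambda>y. exp (- y\<^sup>2 / 2)) x"

text \<open>Elements of \<open>L\<^sup>2(\<real>, \<gamma>)\<close> are represented by Borel functions.\<close>

definition L2_gaussian :: "(real \<Rightarrow> real) set" where
  "L2_gaussian = {f \<in> borel_measurable borel. integrable std_gaussian (\<lambda>x. (f x)\<^sup>2)}"

definition L2_norm_gaussian :: "(real \<Rightarrow> real) \<Rightarrow> real" where
  "L2_norm_gaussian f = sqrt (\<integral>x. (f x)\<^sup>2 \<partial>std_gaussian)"

text \<open>\<open>f = (\<Sum>m\<ge>d. c m * H m)\<close> in \<open>L\<^sup>2(\<real>, \<gamma>)\<close>; such an \<open>f\<close> has Hermite rank \<open>d\<close> if moreover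
  \<open>c d \<noteq> 0\<close>. The values of \<open>c\<close> below \<open>d\<close> are irrelevant.\<close>

definition has_hermite_expansion_from ::
  "(real \<Rightarrow> real) \<Rightarrow> nat \<Rightarrow> (nat \<Rightarrow> real) \<Rightarrow> bool" where
  "has_hermite_expansion_from f d c \<longleftrightarrow>
     f \<in> L2_gaussian \<and>
     (\<lambda>N. L2_norm_gaussian (\<lambda>x. f x - (\<Sum>m=d..N. c m * hermite m x))) \<longlonglongrightarrow> 0"

definition norm_1_2 :: "real poly \<Rightarrow> real" where
  "norm_1_2 q = sqrt (\<integral>x. (poly q x)\<^sup>2 + (poly (pderiv q) x)\<^sup>2 \<partial>std_gaussian)"

text \<open>The completion of the polynomials, realised inside \<open>L\<^sup>2(\<real>, \<gamma>)\<close>: a \<^const>\<open>norm_1_2\<close>-Cauchy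
  sequence of polynomials is identified with its \<open>L\<^sup>2\<close> limit.\<close>

definition malliavin_sobolev :: "(real \<Rightarrow> real) set" where
  "malliavin_sobolev =
     {f \<in> L2_gaussian. \<exists>q :: nat \<Rightarrow> real poly.
        (\<forall>e>0. \<exists>N. \<forall>m\<ge>N. \<forall>n\<ge>N. norm_1_2 (q m - q n) < e) \<and>
        (\<lambda>n. L2_norm_gaussian (\<lambda>x. f x - poly (q n) x)) \<longlonglongrightarrow> 0}"

text \<open>Sequences are indexed by \<open>k \<ge> 1\<close>; the value at index \<open>0\<close> is never used.\<close>

definition gaussian_sequence :: "'a measure \<Rightarrow> (nat \<Rightarrow> 'a \<Rightarrow> real) \<Rightarrow> bool" where
  "gaussian_sequence M X \<longleftrightarrow>
     (\<forall>k\<ge>1. X k \<in> borel_measurable M) \<and>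
     (\<forall>n (a :: nat \<Rightarrow> real). \<exists>\<mu> v. 0 \<le> v \<and>
        distr M borel (\<lambda>\<omega>. \<Sum>k=1..n. a k * X k \<omega>) = normal_law \<mu> v)"

definition stationary_sequence :: "'a measure \<Rightarrow> (nat \<Rightarrow> 'a \<Rightarrow> real) \<Rightarrow> bool" where
  "stationary_sequence M X \<longleftrightarrow>
     (\<forall>h n. distr M (\<Pi>\<^sub>M k\<in>{1..n}. borel) (\<lambda>\<omega>. \<lambda>k\<in>{1..n}. X (k + h) \<omega>) =
            distr M (\<Pi>\<^sub>M k\<in>{1..n}. borel) (\<lambda>\<omega>. \<lambda>k\<in>{1..n}. X k \<omega>))"

definition tv_dist :: "real measure \<Rightarrow> real measure \<Rightarrow> real" where
  "tv_dist P Q = (SUP A\<in>sets borel. \<bar>measure P A - measure Q A\<bar>)"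

definition partial_sum ::
  "(real \<Rightarrow> real) \<Rightarrow> (nat \<Rightarrow> 'a \<Rightarrow> real) \<Rightarrow> nat \<Rightarrow> 'a \<Rightarrow> real" where
  "partial_sum f X n \<omega> = 1 / sqrt (real n) * (\<Sum>k=1..n. f (X k \<omega>))"

text \<open>When \<open>d \<ge> 1\<close>, \<open>\<bar>\<rho>\<bar> \<le> 1\<close>, \<open>\<Sum>\<bar>\<rho> k\<bar> ^ d < \<infinity>\<close> and \<open>\<Sum> m! (c m)\<^sup>2 < \<infinity>\<close>, both sums converge
  absolutely.\<close>

definition limit_variance :: "nat \<Rightarrow> (nat \<Rightarrow> real) \<Rightarrow> (nat \<Rightarrow> real) \<Rightarrow> real" where
  "limit_variance d c \<rho> =
     (\<Sum>\<^sub>\<infinity>m\<in>{d..}. fact m * (c m)\<^sup>2 * (\<Sum>\<^sub>\<infinity>k\<in>(UNIV :: int set). \<rho> (nat \<bar>k\<bar>) ^ m))"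

end

theory Submission
  imports Defs "HOL-Real_Asymp.Real_Asymp"
begin

text \<open>
  Write \<open>S n\<close> for the partial sum of \<open>f\<close> divided by \<open>sqrt n\<close>, \<open>S N n\<close> for the same sum with \<open>f\<close> replaced
  by \<open>f N = (\<Sum>m=d..N. c m * H m)\<close>, and \<open>R k l\<close> for the covariance of \<open>X k\<close> and \<open>X l\<close>. The proof is
  Stein's method, with Gaussian integration by parts carried out on the polynomials \<open>f N\<close> only.

  Since \<open>H m = x * H (m - 1) - H' (m - 1)\<close>, integrating by parts gives, for \<open>\<phi>\<close> of class \<open>C\<^sup>1\<close>
  with \<open>\<phi>\<close> and \<open>\<phi>'\<close> bounded,
  \<open>E (S N n * \<phi> (S N n)) = E (\<phi>' (S N n) * \<Gamma> N n)\<close>, where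
  \<open>\<Gamma> N n = (1 / n) * (\<Sum>k l. R k l * h N (X k) * g N (X l))\<close>, \<open>g N = (f N)'\<close> and
  \<open>h N = (\<Sum>m=d..N. c m * H (m - 1))\<close>. Let \<open>\<psi>\<close> be a continuous test function
  with values in \<open>[0, 1]\<close> and \<open>\<gamma> \<psi>\<close> its standard Gaussian mean. Stein's equation for \<open>\<psi>\<close> has a solution
  whose derivative is bounded by 2, and inserting it yields
  \<open>\<bar>E \<psi> (S N n / s) - \<gamma> \<psi>\<bar> \<le> 2 / s\<^sup>2 * E \<bar>s\<^sup>2 - \<Gamma> N n\<bar>\<close> for every \<open>s > 0\<close> (lemma \<open>stein_bound\<close>). Two facts
  about \<open>\<Gamma>\<close> make the right-hand side small for \<open>s\<^sup>2 = var (S n)\<close>.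

  First, \<open>\<Gamma> N n\<close> is close in \<open>L\<^sup>1\<close> to \<open>\<Gamma> K n\<close> for \<open>N \<ge> K\<close>, uniformly in \<open>n\<close> and \<open>N\<close>, once \<open>K\<close> is
  large (\<open>stein_kernel_tail\<close>). The bilinear form \<open>(1 / n) * (\<Sum>k l. R k l * g (X k) * h (X l))\<close> is
  positive semidefinite, because \<open>R\<close> is a covariance matrix, so off-diagonal values are controlled
  by diagonal ones; and a diagonal value with \<open>g = (\<Sum>m. a m * H (m - 1))\<close> has expectation
  \<open>(\<Sum>m. (a m)\<^sup>2 * (m - 1)! * (1 / n) * (\<Sum>k l. R k l ^ m))\<close>. The factor \<open>R k l\<close> of the form has raised the
  exponent \<open>m - 1\<close> to \<open>m \<ge> d\<close>, so summability of \<open>\<bar>\<rho>\<bar> ^ d\<close> bounds the inner averages. With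
  \<open>a m = m * c m\<close> the sum becomes \<open>(\<Sum>m. m * m! * (c m)\<^sup>2)\<close>, whose finiteness is what membership of \<open>f\<close>
  in the Malliavin--Sobolev space provides (\<open>summable_malliavin_hermite\<close>).

  Secondly, for fixed \<open>K\<close> and growing \<open>n\<close> the variable \<open>\<Gamma> K n\<close> concentrates around its mean
  (\<open>gamma_form_concentration\<close>), which is the variance of \<open>S K n\<close> and hence close to \<open>var (S n)\<close>.
  It is a finite combination of the forms with \<open>g = H p\<close>, \<open>h = H q\<close>, whose variance is \<open>1 / n\<^sup>2\<close> times a sum over four indices of covariances of products of Hermite
  polynomials. These covariances are bounded by products of \<open>\<bar>R\<bar>\<close> over the edges of multigraphs on
  the four indices which connect the first pair to the second (\<open>hermite_cov_bound\<close>). Together with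
  the two factors \<open>R\<close> coming from the forms, every vertex has degree at least \<open>d\<close>, and then the sum is
  of smaller order than \<open>n\<^sup>2\<close> (\<open>diagram_sum_tendsto_0\<close>). The prefactor \<open>2 / var (S n)\<close> stays bounded because
  \<open>var (S n)\<close> tends to the limit variance, which is positive (\<open>variance_tendsto\<close>).

  For fixed \<open>n\<close>, letting \<open>N\<close> tend to infinity replaces \<open>S N n\<close> by \<open>S n\<close> in the Stein bound when the
  test function is Lipschitz. Lipschitz functions suffice for the total variation distance, by
  inner regularity, because the bound does not involve the Lipschitz constant
  (\<open>tv_dist_le_of_Lipschitz_test\<close>).

  The covariance matrix of \<open>X\<close> may be singular, so integration by parts in several variables is not
  done with a density. Instead all variables are regressed on \<open>X k\<close>: the family \<open>X l\<close> has the same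
  joint law as \<open>X l - X k * R k l + \<xi> * R k l\<close> with an independent standard normal \<open>\<xi>\<close>
  (\<open>joint_law_regression\<close>), and one integrates by parts in \<open>\<xi>\<close> alone.
\<close>

section \<open>The standard Gaussian measure\<close>

lemma sets_std_gaussian [simp, measurable_cong]: "sets std_gaussian = sets borel"
  by (simp add: std_gaussian_def)

lemma space_std_gaussian [simp]: "space std_gaussian = UNIV"
  by (simp add: std_gaussian_def)

lemma real_distribution_std_gaussian: "real_distribution std_gaussian"
  unfolding std_gaussian_def by (rule real_dist_normal_dist)

interpretation gaussian: real_distribution std_gaussian
  by (rule real_distribution_std_gaussian)

lemma measure_std_gaussian_UNIV [simp]: "measure std_gaussian UNIV = 1"
  using gaussian.prob_space by simp

lemma integrable_std_gaussian_iff: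
  assumes "f \<in> borel_measurable borel"
  shows "integrable std_gaussian f \<longleftrightarrow> integrable lborel (\<lambda>x. std_normal_density x * f x)"
  unfolding std_gaussian_def using assms
  by (subst integrable_density) (auto simp: normal_density_nonneg)

lemma integral_std_gaussian:
  assumes "f \<in> borel_measurable borel"
  shows "integral\<^sup>L std_gaussian f = integral\<^sup>L lborel (\<lambda>x. std_normal_density x * f x)"
  unfolding std_gaussian_def using assms
  by (subst integral_density) (auto simp: normal_density_nonneg)

lemma has_real_derivative_std_normal_density:
  "(std_normal_density has_real_derivative - x * std_normal_density x) (at x)"
  unfolding normal_density_def by (auto intro!: derivative_eq_intros simp: field_simps)

lemma continuous_std_normal_density: "continuous_on A std_normal_density"
  unfolding normal_density_def by (auto intro!: continuous_intros)

text \<open>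
  An integrable function may fail to converge at infinity, but it has no other limit than 0, since
  a nonzero one would bound \<open>\<bar>D\<bar>\<close> from below on a half-line. This spares a growth assumption in the
  next lemma.
\<close>

lemma limit_of_integrable_is_0:
  fixes D :: "real \<Rightarrow> real"
  assumes D: "integrable lborel D" and lim: "(D \<longlongrightarrow> I) at_top"
  shows "I = 0"
proof (rule ccontr)
  assume "I \<noteq> 0"
  then have "\<bar>I\<bar> / 2 < \<bar>I\<bar>" by simp
  with tendsto_rabs[OF lim] have "eventually (\<lambda>x. \<bar>I\<bar> / 2 < \<bar>D x\<bar>) at_top"
    by (rule order_tendstoD)
  then obtain R where R: "\<And>x. x \<ge> R \<Longrightarrow> \<bar>I\<bar> / 2 < \<bar>D x\<bar>"
    by (auto simp: eventually_at_top_linorder)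
  have "integrable lborel (\<lambda>x. (2 / \<bar>I\<bar>) * D x)" using D by simp
  then have "integrable lborel (indicator {R..} :: real \<Rightarrow> real)"
    by (rule Bochner_Integration.integrable_bound)
       (use R \<open>I \<noteq> 0\<close> in \<open>auto simp: indicator_def abs_mult field_simps intro!: AE_I2 less_imp_le\<close>)
  then have "emeasure lborel {R..} < \<infinity>"
    by (simp add: integrable_indicator_iff)
  moreover have "emeasure lborel {R..} = \<infinity>"
  proof (rule ccontr)
    assume "emeasure lborel {R..} \<noteq> \<infinity>"
    then obtain c where c: "emeasure lborel {R..} = ennreal c" "c \<ge> 0"
      by (cases "emeasure lborel {R..}") auto
    have "emeasure lborel {R..R + (c + 1)} \<le> emeasure lborel {R..}"
      by (intro emeasure_mono) auto
    with c show False by simp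
  qed
  ultimately show False by simp
qed

text \<open>
  The integral of the derivative of \<open>g * std_normal_density\<close> over \<open>[-y, y]\<close> is a boundary term
  \<open>D y\<close>. It converges because the derivative is integrable, and \<open>D\<close> is itself integrable, so that
  the limit is 0.
\<close>

lemma std_gaussian_integration_by_parts:
  fixes g g' :: "real \<Rightarrow> real"
  assumes deriv: "\<And>x. (g has_real_derivative g' x) (at x)"
    and cont: "continuous_on UNIV g'"
    and int_g: "integrable std_gaussian (\<lambda>x. x * g x)"
    and int_g': "integrable std_gaussian g'"
  shows "(\<integral>x. x * g x \<partial>std_gaussian) = (\<integral>x. g' x \<partial>std_gaussian)"
proof -
  let ?w = "std_normal_density"
  define H where "H = (\<lambda>x. g x * ?w x)"
  define H' where "H' = (\<lambda>x. ?w x * g' x - ?w x * (x * g x))"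
  define D where "D = (\<lambda>R. H R - H (- R))"
  have contg: "continuous_on A g" for A
    using deriv by (meson DERIV_isCont continuous_at_imp_continuous_on)
  have [measurable]: "g \<in> borel_measurable borel" "g' \<in> borel_measurable borel"
    using contg[of UNIV] cont by (auto intro: borel_measurable_continuous_onI)
  have i1: "integrable lborel (\<lambda>x. ?w x * (x * g x))" and i2: "integrable lborel (\<lambda>x. ?w x * g' x)"
    using int_g int_g' by (auto simp: integrable_std_gaussian_iff)
  have iH': "integrable lborel H'" unfolding H'_def using i1 i2 by simp
  have dH: "(H has_real_derivative H' x) (at x)" for x
    unfolding H_def H'_def
    by (rule derivative_eq_intros deriv has_real_derivative_std_normal_density refl)+
       (simp add: algebra_simps)
  have cH': "isCont H' x" for x
  proof -
    have "continuous_on UNIV H'" unfolding H'_def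
      by (intro continuous_intros contg cont continuous_std_normal_density)
    then show ?thesis by (simp add: continuous_on_eq_continuous_at)
  qed
  have iH: "integrable lborel H"
  proof -
    have "compact (g ` {-1..1})"
      using contg by (intro compact_continuous_image) auto
    then obtain C where C: "\<And>x. x \<in> {-1..1} \<Longrightarrow> \<bar>g x\<bar> \<le> C"
      by (meson compact_imp_bounded bounded_real imageI)
    have "integrable lborel (\<lambda>x. C * ?w x + \<bar>?w x * (x * g x)\<bar>)"
      using i1 by (intro Bochner_Integration.integrable_add integrable_abs integrable_mult_right) auto
    then show ?thesis
    proof (rule Bochner_Integration.integrable_bound)
      show "AE x in lborel. norm (H x) \<le> norm (C * ?w x + \<bar>?w x * (x * g x)\<bar>)"
      proof (rule AE_I2)
        fix x
        have w: "?w x \<ge> 0" by simp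
        have C0: "C \<ge> 0" using C[of 0] by auto
        show "norm (H x) \<le> norm (C * ?w x + \<bar>?w x * (x * g x)\<bar>)"
        proof (cases "x \<in> {-1..1}")
          case True
          then have "\<bar>g x\<bar> * ?w x \<le> C * ?w x" using C w by (intro mult_right_mono) auto
          then show ?thesis using w C0 by (simp add: H_def abs_mult add_increasing2)
        next
          case False
          then have "1 \<le> \<bar>x\<bar>" by auto
          then have "1 * \<bar>g x\<bar> \<le> \<bar>x\<bar> * \<bar>g x\<bar>" by (intro mult_right_mono) auto
          then have "\<bar>g x\<bar> * ?w x \<le> \<bar>x\<bar> * \<bar>g x\<bar> * ?w x" using w by (intro mult_right_mono) auto
          then show ?thesis using w C0 by (simp add: H_def abs_mult mult_ac add_increasing)
        qed
      qed
    qed (simp add: H_def)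
  qed
  have iD: "integrable lborel D"
  proof -
    have "integrable lborel (\<lambda>x. H (0 + (-1) * x))"
      using iH by (subst lborel_integrable_real_affine_iff) auto
    then show ?thesis unfolding D_def using iH by simp
  qed
  have "(D \<longlongrightarrow> integral\<^sup>L lborel H') at_top"
  proof (rule tendsto_at_topI_sequentially)
    fix Y :: "nat \<Rightarrow> real" assume Y: "filterlim Y at_top sequentially"
    have "(\<lambda>n. \<integral>x. indicator {-Y n .. Y n} x *\<^sub>R H' x \<partial>lborel) \<longlonglongrightarrow> integral\<^sup>L lborel H'"
    proof (rule integral_dominated_convergence[where w="\<lambda>x. norm (H' x)"])
      show "AE x in lborel. (\<lambda>n. indicator {- Y n..Y n} x *\<^sub>R H' x) \<longlonglongrightarrow> H' x"
      proof (rule AE_I2)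
        fix x
        have "eventually (\<lambda>n. \<bar>x\<bar> \<le> Y n) sequentially"
          using Y by (auto simp: filterlim_at_top)
        then have "eventually (\<lambda>n. indicator {- Y n..Y n} x *\<^sub>R H' x = H' x) sequentially"
          by eventually_elim (auto simp: indicator_def)
        then show "(\<lambda>n. indicator {- Y n..Y n} x *\<^sub>R H' x) \<longlonglongrightarrow> H' x"
          by (rule tendsto_eventually)
      qed
    qed (use iH' in \<open>auto simp: indicator_def\<close>)
    moreover have "eventually (\<lambda>n. (\<integral>x. indicator {-Y n .. Y n} x *\<^sub>R H' x \<partial>lborel) = D (Y n)) sequentially"
    proof -
      have "eventually (\<lambda>n. 0 \<le> Y n) sequentially" using Y by (auto simp: filterlim_at_top)
      then show ?thesis
      proof eventually_elim
        case (elim n)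
        show ?case unfolding D_def
          using integral_FTC_Icc_real[of "- Y n" "Y n" H H', OF _ dH cH'] elim
          by (simp add: mult.commute)
      qed
    qed
    ultimately show "(\<lambda>n. D (Y n)) \<longlonglongrightarrow> integral\<^sup>L lborel H'"
      using Lim_transform_eventually by fastforce
  qed
  then have "integral\<^sup>L lborel H' = 0"
    by (rule limit_of_integrable_is_0[OF iD])
  then have "(\<integral>x. ?w x * g' x \<partial>lborel) = (\<integral>x. ?w x * (x * g x) \<partial>lborel)"
    unfolding H'_def using i1 i2 by simp
  then show ?thesis by (simp add: integral_std_gaussian)
qed

section \<open>Stein's equation and total variation\<close>

text \<open>
  The function \<open>std_normal_density y / x \<mp> \<Phi> y\<close> decreases on \<open>y \<ge> x\<close>, because
  \<open>y / x \<ge> 1 \<ge> \<bar>k y\<bar>\<close> there, and tends to 0; so it is nonnegative at \<open>y = x\<close>. This is the Mills ratio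
  estimate behind the bounds on Stein solutions, without integrals.
\<close>

lemma stein_tail_bound:
  fixes \<Phi> k :: "real \<Rightarrow> real"
  assumes deriv: "\<And>y. (\<Phi> has_real_derivative k y * std_normal_density y) (at y)"
    and k: "\<And>y. \<bar>k y\<bar> \<le> 1"
    and lim: "(\<Phi> \<longlongrightarrow> 0) at_top"
    and x: "x > 0"
  shows "x * \<bar>\<Phi> x\<bar> \<le> std_normal_density x"
proof -
  let ?w = std_normal_density
  have w0: "(?w \<longlongrightarrow> 0) at_top"
    unfolding normal_density_def by real_asymp
  have main: "s * \<Phi> x \<le> ?w x / x" if s: "\<bar>s\<bar> = 1" for s
  proof -
    define E where "E = (\<lambda>y. ?w y / x - s * \<Phi> y)"
    have dE: "(E has_real_derivative (- y * ?w y / x - s * (k y * ?w y))) (at y)" for y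
      unfolding E_def using x
      by (auto intro!: derivative_eq_intros deriv has_real_derivative_std_normal_density)
    have neg: "- y * ?w y / x - s * (k y * ?w y) \<le> 0" if "y \<ge> x" for y
    proof -
      have "\<bar>s * k y\<bar> \<le> 1" using s k[of y] by (simp add: abs_mult)
      then have "- (s * k y) \<le> 1" by linarith
      moreover have "1 \<le> y / x" using that x by simp
      ultimately have "- (s * k y) * ?w y \<le> y / x * ?w y"
        by (intro mult_right_mono) auto
      then show ?thesis by (simp add: field_simps)
    qed
    have "E y \<le> E x" if "y \<ge> x" for y
      using that by (intro DERIV_nonpos_imp_nonincreasing[of x y E]) (use dE neg in blast)+
    then have "eventually (\<lambda>y. E y \<le> E x) at_top"
      by (auto simp: eventually_at_top_linorder)
    moreover have "(E \<longlongrightarrow> 0 / x - s * 0) at_top"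
      unfolding E_def using x by (intro tendsto_intros w0 lim) auto
    ultimately have "0 / x - s * 0 \<le> E x"
      by (intro tendsto_upperbound[where f=E and F=at_top]) auto
    then show ?thesis by (simp add: E_def)
  qed
  have "\<bar>\<Phi> x\<bar> \<le> ?w x / x" using main[of 1] main[of "-1"] by (simp add: abs_le_iff)
  then show ?thesis using x by (simp add: field_simps)
qed

text \<open>
  The solution is \<open>\<phi> = \<Phi> / std_normal_density\<close>, where \<open>\<Phi>\<close> integrates \<open>h\<close> minus its Gaussian mean against the
  Gaussian measure up to \<open>x\<close>. As \<open>\<Phi>\<close> vanishes at both ends, the tail bound applies on either side and gives
  \<open>\<bar>x * \<phi> x\<bar> \<le> 1\<close>, hence \<open>\<bar>\<phi>'\<bar> \<le> 2\<close>. Continuity of \<open>h\<close> makes \<open>\<phi>\<close> continuously differentiable, which is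
  needed for the chain rule later on.
\<close>

lemma stein_equation_solution:
  fixes h :: "real \<Rightarrow> real"
  assumes h: "continuous_on UNIV h" "\<And>x. 0 \<le> h x" "\<And>x. h x \<le> 1"
  obtains \<phi> \<phi>' where "\<And>x. (\<phi> has_real_derivative \<phi>' x) (at x)" "continuous_on UNIV \<phi>'"
    "\<And>x. \<bar>\<phi>' x\<bar> \<le> 2" "bounded (range \<phi>)"
    "\<And>x. \<phi>' x - x * \<phi> x = h x - (\<integral>y. h y \<partial>std_gaussian)"
proof -
  let ?w = std_normal_density
  have [measurable]: "h \<in> borel_measurable borel"
    using h(1) by (rule borel_measurable_continuous_onI)
  have int_h: "integrable std_gaussian h"
    by (rule gaussian.integrable_const_bound[where B=1]) (use h in auto)
  define m where "m = (\<integral>y. h y \<partial>std_gaussian)"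
  have "0 \<le> m" unfolding m_def using h by (intro integral_nonneg_AE) auto
  moreover have "m \<le> (\<integral>y. 1 \<partial>std_gaussian)"
    unfolding m_def using int_h h by (intro integral_mono) auto
  then have "m \<le> 1" by (simp)
  ultimately have m: "0 \<le> m" "m \<le> 1" by auto
  define k where "k = (\<lambda>x. h x - m)"
  have k1: "\<bar>k x\<bar> \<le> 1" for x using h(2,3)[of x] m by (auto simp: k_def abs_le_iff)
  have ck: "continuous_on UNIV k" unfolding k_def using h(1) by (intro continuous_intros)
  have [measurable]: "k \<in> borel_measurable borel" unfolding k_def by measurable
  have ik: "integrable std_gaussian k" "integral\<^sup>L std_gaussian k = 0"
    unfolding k_def using int_h by (auto simp: m_def)
  define \<Phi> where "\<Phi> = (\<lambda>y. \<integral>x. indicator {..y} x *\<^sub>R k x \<partial>std_gaussian)"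
  have top: "(\<Phi> \<longlongrightarrow> 0) at_top"
    using tendsto_integral_at_top[OF sets_std_gaussian ik(1)] ik(2) unfolding \<Phi>_def by simp
  have bot: "(\<Phi> \<longlongrightarrow> 0) at_bot"
  proof (rule Lim_null_comparison)
    show "(cdf std_gaussian \<longlongrightarrow> 0) at_bot" by (rule gaussian.cdf_lim_at_bot)
    show "\<forall>\<^sub>F x in at_bot. norm (\<Phi> x) \<le> cdf std_gaussian x"
    proof (intro always_eventually allI)
      fix y
      have "norm (\<Phi> y) \<le> (\<integral>x. indicator {..y} x \<partial>std_gaussian)"
        unfolding \<Phi>_def
      proof (rule Bochner_Integration.integral_norm_bound_integral)
        show "integrable std_gaussian (\<lambda>x. indicat_real {..y} x *\<^sub>R k x)"
          using integrable_real_mult_indicator[OF _ ik(1), of "{..y}"] by (simp add: mult.commute)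
        show "integrable std_gaussian (indicat_real {..y})"
          by (rule gaussian.integrable_const_bound[where B=1]) (auto simp: indicator_def)
      qed (use k1 in \<open>auto simp: indicator_def\<close>)
      then show "norm (\<Phi> y) \<le> cdf std_gaussian y" by (simp add: cdf_def)
    qed
  qed
  have ckw: "isCont (\<lambda>x. k x * ?w x) x" for x
  proof -
    have "continuous_on UNIV (\<lambda>x. k x * ?w x)"
      by (intro continuous_intros ck continuous_std_normal_density)
    then show ?thesis by (simp add: continuous_on_eq_continuous_at)
  qed
  have "\<exists>F. \<forall>x. -\<infinity> < ereal x \<longrightarrow> ereal x < \<infinity> \<longrightarrow> (F has_vector_derivative k x * ?w x) (at x)"
    using ckw by (intro einterval_antiderivative) auto
  then obtain F where F: "\<And>x. (F has_real_derivative k x * ?w x) (at x)"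
    by (auto simp: has_real_derivative_iff_has_vector_derivative)
  have step: "\<Phi> y - \<Phi> x = F y - F x" if "x \<le> y" for x y
  proof -
    have "\<Phi> y - \<Phi> x = (\<integral>z. indicator {..y} z *\<^sub>R k z - indicator {..x} z *\<^sub>R k z \<partial>std_gaussian)"
      unfolding \<Phi>_def using ik(1)
      by (subst Bochner_Integration.integral_diff)
         (auto intro!: integrable_real_mult_indicator simp: mult.commute)
    also have "\<dots> = (\<integral>z. indicator {x<..y} z * k z \<partial>std_gaussian)"
      using that by (intro Bochner_Integration.integral_cong) (auto simp: indicator_def)
    also have "\<dots> = (\<integral>z. ?w z * (indicator {x<..y} z * k z) \<partial>lborel)"
      by (rule integral_std_gaussian) measurable
    also have "\<dots> = (\<integral>z. k z * ?w z * indicator {x..y} z \<partial>lborel)"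
      by (intro integral_cong_AE) (use AE_lborel_singleton[of x] in \<open>auto simp: indicator_def elim!: eventually_mono\<close>)
    also have "\<dots> = F y - F x"
      by (rule integral_FTC_Icc_real[OF that F ckw])
    finally show ?thesis .
  qed
  define c where "c = \<Phi> 0 - F 0"
  have "\<Phi> = (\<lambda>y. F y + c)"
  proof
    fix y show "\<Phi> y = F y + c"
      using step[of 0 y] step[of y 0] by (cases "0 \<le> y") (auto simp: c_def)
  qed
  then have d\<Phi>: "(\<Phi> has_real_derivative k y * ?w y) (at y)" for y
    using DERIV_add[OF F[of y] DERIV_const[of c]] by simp
  have tail: "\<bar>x\<bar> * \<bar>\<Phi> x\<bar> \<le> ?w x" for x
  proof (cases "x > 0")
    case True
    then show ?thesis using stein_tail_bound[OF d\<Phi> k1 top True] by simp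
  next
    case False
    show ?thesis
    proof (cases "x = 0")
      case False
      with \<open>\<not> 0 < x\<close> have x: "- x > 0" by simp
      have "(- x) * \<bar>- \<Phi> (- (- x))\<bar> \<le> ?w (- x)"
      proof (rule stein_tail_bound[where \<Phi>="\<lambda>y. - \<Phi> (- y)" and k="\<lambda>y. k (- y)", OF _ _ _ x])
        show "((\<lambda>y. - \<Phi> (- y)) has_real_derivative k (- y) * ?w y) (at y)" for y
          using DERIV_minus[OF DERIV_chain2[OF d\<Phi>[of "- y"] DERIV_minus[OF DERIV_ident]]]
          by (simp add: normal_density_def)
        show "((\<lambda>y. - \<Phi> (- y)) \<longlongrightarrow> 0) at_top"
          using tendsto_minus[OF filterlim_compose[OF bot filterlim_uminus_at_bot_at_top]] by simp
      qed (rule k1)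
      then show ?thesis using x by (simp add: normal_density_def)
    qed simp
  qed
  define \<phi> where "\<phi> = (\<lambda>x. \<Phi> x / ?w x)"
  define \<phi>' where "\<phi>' = (\<lambda>x. x * \<phi> x + k x)"
  have wpos: "?w x > 0" for x by (simp add: normal_density_pos)
  have d\<phi>: "(\<phi> has_real_derivative \<phi>' x) (at x)" for x
    unfolding \<phi>_def \<phi>'_def
    using wpos[of x]
    by (auto intro!: derivative_eq_intros d\<Phi> has_real_derivative_std_normal_density simp: field_simps)
  have c\<phi>: "continuous_on A \<phi>" for A
    using d\<phi> by (meson DERIV_isCont continuous_at_imp_continuous_on)
  have t\<phi>: "\<bar>x * \<phi> x\<bar> \<le> 1" for x
    using tail[of x] wpos[of x] by (simp add: \<phi>_def abs_mult field_simps)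
  show ?thesis
  proof
    show "continuous_on UNIV \<phi>'" unfolding \<phi>'_def by (intro continuous_intros c\<phi> ck)
    show "\<bar>\<phi>' x\<bar> \<le> 2" for x using t\<phi>[of x] k1[of x] unfolding \<phi>'_def by linarith
    show "\<phi>' x - x * \<phi> x = h x - (\<integral>y. h y \<partial>std_gaussian)" for x
      by (simp add: \<phi>'_def k_def m_def)
    have "compact (\<phi> ` {-1..1})"
      using c\<phi> by (intro compact_continuous_image) auto
    then obtain C where C: "\<And>x. x \<in> {-1..1} \<Longrightarrow> \<bar>\<phi> x\<bar> \<le> C"
      by (meson compact_imp_bounded bounded_real imageI)
    have "\<bar>\<phi> x\<bar> \<le> max C 1" for x
    proof (cases "x \<in> {-1..1}")
      case False
      then have "1 * \<bar>\<phi> x\<bar> \<le> \<bar>x\<bar> * \<bar>\<phi> x\<bar>" by (intro mult_right_mono) auto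
      with t\<phi>[of x] show ?thesis by (simp add: abs_mult)
    qed (use C in \<open>auto simp: le_max_iff_disj\<close>)
    then show "bounded (range \<phi>)" by (auto simp: bounded_real)
  qed (rule d\<phi>)
qed

text \<open>
  The indicator of a compact set \<open>K\<close> is the limit of the functions \<open>max 0 (1 - n * infdist x K)\<close>, which are
  \<open>n\<close>-Lipschitz, so the bound, being independent of \<open>L\<close>, passes to compact sets and from there to
  Borel sets by inner regularity of both measures.
\<close>

lemma tv_dist_le_of_Lipschitz_test:
  assumes P: "real_distribution P" and Q: "real_distribution Q"
    and test: "\<And>L h. 0 \<le> L \<Longrightarrow> L-lipschitz_on UNIV h \<Longrightarrow> (\<And>x. 0 \<le> h x) \<Longrightarrow> (\<And>x. h x \<le> 1) \<Longrightarrow>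
       \<bar>(\<integral>x. h x \<partial>P) - (\<integral>x. h x \<partial>Q)\<bar> \<le> \<delta>"
  shows "tv_dist P Q \<le> \<delta>"
proof -
  interpret P: real_distribution P by (rule P)
  interpret Q: real_distribution Q by (rule Q)
  have compact_bound: "\<bar>measure P K - measure Q K\<bar> \<le> \<delta>" if K: "compact K" "K \<noteq> {}" for K
  proof -
    have cl: "closed K" using K by (simp add: compact_imp_closed)
    define h where "h = (\<lambda>(n::nat) x. max 0 (1 - real n * infdist x K))"
    have lim: "(\<lambda>n. h n x) \<longlonglongrightarrow> indicator K x" for x
    proof (cases "x \<in> K")
      case True
      then show ?thesis by (simp add: h_def)
    next
      case False
      then have "infdist x K > 0" using cl K(2) infdist_pos_not_in_closed by blast
      then obtain N where N: "1 < real N * infdist x K" using reals_Archimedean3 by blast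
      have "h n x = 0" if "n \<ge> N" for n
      proof -
        have "real N * infdist x K \<le> real n * infdist x K"
          using that by (intro mult_right_mono) (auto simp: infdist_nonneg)
        with N show ?thesis by (simp add: h_def)
      qed
      then have "eventually (\<lambda>n. h n x = 0) sequentially" by (auto simp: eventually_sequentially)
      then show ?thesis using False by (simp add: tendsto_eventually)
    qed
    have h01: "0 \<le> h n x" "h n x \<le> 1" for n x by (auto simp: h_def infdist_nonneg)
    have lip: "(real n)-lipschitz_on UNIV (h n)" for n
    proof (rule lipschitz_onI)
      fix x y
      have "\<bar>real n * infdist x K - real n * infdist y K\<bar> \<le> real n * dist x y"
        unfolding right_diff_distrib[symmetric] abs_mult
        by (auto intro!: mult_left_mono infdist_triangle_abs)
      then show "dist (h n x) (h n y) \<le> real n * dist x y"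
        unfolding h_def dist_real_def by linarith
    qed simp
    have [measurable]: "h n \<in> borel_measurable borel" for n
      by (intro borel_measurable_continuous_onI lipschitz_on_continuous_on[OF lip])
    have [measurable]: "K \<in> sets borel" using cl by simp
    have conv: "(\<lambda>n. \<integral>x. h n x \<partial>R) \<longlonglongrightarrow> measure R K" if R: "real_distribution R" for R
    proof -
      interpret R: real_distribution R by (rule R)
      have "(\<lambda>n. \<integral>x. h n x \<partial>R) \<longlonglongrightarrow> (\<integral>x. indicator K x \<partial>R)"
        by (rule integral_dominated_convergence[where w="\<lambda>_. 1"]) (use lim h01 in auto)
      then show ?thesis by simp
    qed
    have "(\<lambda>n. \<bar>(\<integral>x. h n x \<partial>P) - (\<integral>x. h n x \<partial>Q)\<bar>) \<longlonglongrightarrow> \<bar>measure P K - measure Q K\<bar>"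
      by (intro tendsto_intros conv P Q)
    then show ?thesis
      by (rule LIMSEQ_le_const2) (auto intro!: test[OF _ lip] h01)
  qed
  have \<delta>0: "0 \<le> \<delta>" using compact_bound[of "{0}"] by (simp add: order_trans[OF abs_ge_zero])
  have inner: "measure R A \<le> measure R' A + \<delta>"
    if A: "A \<in> sets borel" and R: "real_distribution R" and R': "real_distribution R'"
      and RR': "\<And>K. compact K \<Longrightarrow> K \<noteq> {} \<Longrightarrow> \<bar>measure R K - measure R' K\<bar> \<le> \<delta>" for A R R'
  proof (rule field_le_epsilon)
    fix e :: real assume e: "e > 0"
    interpret R: real_distribution R by (rule R)
    interpret R': real_distribution R' by (rule R')
    have eq: "emeasure R A = (SUP K \<in> {K. K \<subseteq> A \<and> compact K}. emeasure R K)"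
      using A by (intro inner_regular) auto
    have "\<exists>K\<in>{K. K \<subseteq> A \<and> compact K}. emeasure R A < emeasure R K + ennreal e"
    proof (rule ccontr)
      assume "\<not> ?thesis"
      then have *: "emeasure R K + ennreal e \<le> emeasure R A" if "K \<subseteq> A" "compact K" for K
        using that by (auto simp: not_less)
      have 1: "measure R K \<le> measure R A - e" if "K \<subseteq> A" "compact K" for K
        using *[OF that] e unfolding R.emeasure_eq_measure
        by (simp add: ennreal_plus[symmetric] del: ennreal_plus)
      from this[of "{}"] have "0 \<le> measure R A - e" by simp
      have "(SUP K \<in> {K. K \<subseteq> A \<and> compact K}. emeasure R K) \<le> ennreal (measure R A - e)"
        by (intro SUP_least) (use 1 in \<open>auto simp: R.emeasure_eq_measure intro!: ennreal_leI\<close>)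
      then have "emeasure R A \<le> ennreal (measure R A - e)"
        using eq by simp
      then show False using e \<open>0 \<le> measure R A - e\<close> by (simp add: R.emeasure_eq_measure)
    qed
    then obtain K where K: "K \<subseteq> A" "compact K" "emeasure R A < emeasure R K + ennreal e" by auto
    then have *: "measure R A \<le> measure R K + e"
      using e by (simp add: R.emeasure_eq_measure ennreal_plus[symmetric] ennreal_less_iff del: ennreal_plus)
    have "measure R K \<le> measure R' K + \<delta>"
      using RR'[of K] K \<delta>0 by (cases "K = {}") auto
    also have "measure R' K \<le> measure R' A" using K A by (intro R'.finite_measure_mono) auto
    finally show "measure R A \<le> measure R' A + \<delta> + e" using * by simp
  qed
  have "\<bar>measure P A - measure Q A\<bar> \<le> \<delta>" if "A \<in> sets borel" for A
    using inner[OF that P Q] inner[OF that Q P] compact_bound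
    by (simp add: abs_le_iff abs_minus_commute)
  then show ?thesis unfolding tv_dist_def by (intro cSUP_least) auto
qed

section \<open>Joint laws and trigonometric moments\<close>

text \<open>
  Turns a weight \<open>W\<close> into a probability measure, so that the uniqueness theorem for characteristic
  functions applies to weighted laws. The sine is written as a shifted cosine because only
  integrals of cosines with an arbitrary phase are available below.
\<close>

lemma tilted_law:
  fixes W Y :: "'a \<Rightarrow> real"
  assumes M: "prob_space M" and [measurable]: "W \<in> borel_measurable M" "Y \<in> borel_measurable M"
    and W: "\<And>x. 0 \<le> W x" "\<And>x. W x \<le> B" and c: "c = (\<integral>x. W x \<partial>M)" "c > 0"
  obtains P where "real_distribution P"
    "\<And>t. char P t = Complex ((\<integral>x. W x * cos (0 + t * Y x) \<partial>M) / c) ((\<integral>x. W x * cos (- pi / 2 + t * Y x) \<partial>M) / c)"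
    "\<And>A. A \<in> sets borel \<Longrightarrow> measure P A = (\<integral>x. W x * indicator A (Y x) \<partial>M) / c"
proof -
  interpret prob_space M by (rule M)
  have B: "\<bar>W x\<bar> \<le> B" for x using W[of x] by simp
  have int: "integrable M (\<lambda>x. W x * g x)" if [measurable]: "g \<in> borel_measurable M" and "\<And>x. \<bar>g x\<bar> \<le> 1" for g
  proof (rule integrable_const_bound[where B=B])
    show "AE x in M. norm (W x * g x) \<le> B"
      using mult_mono[OF B that(2)] B by (intro AE_I2) (auto simp: abs_mult intro: order_trans[OF abs_ge_zero])
  qed measurable
  have intW: "integrable M W" using int[of "\<lambda>_. 1"] by simp
  define D where "D = density M (\<lambda>x. ennreal (W x / c))"
  have mD [measurable_cong, simp]: "sets D = sets M" "space D = space M" by (auto simp: D_def)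
  have "emeasure D (space D) = (\<integral>\<^sup>+x. ennreal (W x / c) \<partial>M)"
    unfolding D_def by (subst emeasure_density) (auto intro!: nn_integral_cong)
  also have "\<dots> = ennreal (\<integral>x. W x / c \<partial>M)"
    using intW W c by (intro nn_integral_eq_integral) auto
  also have "\<dots> = 1" using c by simp
  finally interpret D: prob_space D by (rule prob_spaceI)
  define P where "P = distr D borel Y"
  interpret P: real_distribution P unfolding P_def by (rule D.real_distribution_distr) simp
  have "char P t = Complex ((\<integral>x. W x * cos (0 + t * Y x) \<partial>M) / c) ((\<integral>x. W x * cos (- pi / 2 + t * Y x) \<partial>M) / c)" for t
  proof -
    have "char P t = (\<integral>x. iexp (t * Y x) \<partial>D)"
      unfolding char_def P_def by (subst integral_distr) auto
    also have "\<dots> = (\<integral>x. (W x / c) *\<^sub>R iexp (t * Y x) \<partial>M)"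
      unfolding D_def by (subst integral_density) (use W c in auto)
    finally have eq: "char P t = (\<integral>x. (W x / c) *\<^sub>R iexp (t * Y x) \<partial>M)" .
    have i: "integrable M (\<lambda>x. (W x / c) *\<^sub>R iexp (t * Y x))"
    proof (rule integrable_const_bound[where B="B/c"])
      show "AE x in M. norm ((W x / c) *\<^sub>R iexp (t * Y x)) \<le> B / c"
        using W c by (auto intro!: divide_right_mono)
    qed measurable
    show ?thesis
    proof (rule complex_eqI)
      show "Re (char P t) = Re (Complex ((\<integral>x. W x * cos (0 + t * Y x) \<partial>M) / c) ((\<integral>x. W x * cos (- pi / 2 + t * Y x) \<partial>M) / c))"
        unfolding eq by (subst integral_Re[OF i, symmetric]) (simp add: Re_exp)
      have "sin y = cos (- pi / 2 + y)" for y :: real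
        by (simp add: cos_diff)
      then show "Im (char P t) = Im (Complex ((\<integral>x. W x * cos (0 + t * Y x) \<partial>M) / c) ((\<integral>x. W x * cos (- pi / 2 + t * Y x) \<partial>M) / c))"
        unfolding eq by (subst integral_Im[OF i, symmetric]) (simp add: Im_exp)
    qed
  qed
  moreover have "measure P A = (\<integral>x. W x * indicator A (Y x) \<partial>M) / c" if [measurable]: "A \<in> sets borel" for A
  proof -
    have "measure P A = (\<integral>x. indicator A x \<partial>P)" by (simp add: P_def)
    also have "\<dots> = (\<integral>x. indicator A (Y x) \<partial>D)" unfolding P_def by (subst integral_distr) auto
    also have "\<dots> = (\<integral>x. (W x / c) *\<^sub>R indicator A (Y x) \<partial>M)"
      unfolding D_def by (subst integral_density) (use W c in auto)
    also have "\<dots> = (\<integral>x. W x * indicator A (Y x) / c \<partial>M)" by simp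
    finally show ?thesis by (simp only: integral_divide_zero)
  qed
  ultimately show ?thesis by (intro that[of P]) (auto intro: P.real_distribution_axioms)
qed

lemma weighted_law_unique:
  fixes W Y :: "'a \<Rightarrow> real" and W' Y' :: "'b \<Rightarrow> real"
  assumes M: "prob_space M" and [measurable]: "W \<in> borel_measurable M" "Y \<in> borel_measurable M"
    and N: "prob_space N" and [measurable]: "W' \<in> borel_measurable N" "Y' \<in> borel_measurable N"
    and W: "\<And>x. 0 \<le> W x" "\<And>x. W x \<le> B" and W': "\<And>x. 0 \<le> W' x" "\<And>x. W' x \<le> B"
    and eq: "\<And>\<alpha> t. (\<integral>x. W x * cos (\<alpha> + t * Y x) \<partial>M) = (\<integral>x. W' x * cos (\<alpha> + t * Y' x) \<partial>N)"
    and A: "A \<in> sets borel"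
  shows "(\<integral>x. W x * indicator A (Y x) \<partial>M) = (\<integral>x. W' x * indicator A (Y' x) \<partial>N)"
proof -
  interpret M: prob_space M by (rule M)
  interpret N: prob_space N by (rule N)
  define c where "c = (\<integral>x. W x \<partial>M)"
  have c': "c = (\<integral>x. W' x \<partial>N)" using eq[of 0 0] by (simp add: c_def)
  have i: "integrable M W" "integrable N W'"
    using W W' by (auto intro!: M.integrable_const_bound[where B=B] N.integrable_const_bound[where B=B])
  have "c \<ge> 0" unfolding c_def using W by (intro integral_nonneg_AE) auto
  then consider "c = 0" | "c > 0" by linarith
  then show ?thesis
  proof cases
    case 1
    have "AE x in M. W x = 0"
      using 1 integral_nonneg_eq_0_iff_AE[OF i(1)] W by (simp add: c_def)
    then have "(\<integral>x. W x * indicator A (Y x) \<partial>M) = 0"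
      by (intro integral_eq_zero_AE) auto
    moreover have "AE x in N. W' x = 0"
      using 1 integral_nonneg_eq_0_iff_AE[OF i(2)] W' by (simp add: c')
    then have "(\<integral>x. W' x * indicator A (Y' x) \<partial>N) = 0"
      by (intro integral_eq_zero_AE) auto
    ultimately show ?thesis by simp
  next
    case 2
    obtain P where P: "real_distribution P"
      "\<And>t. char P t = Complex ((\<integral>x. W x * cos (0 + t * Y x) \<partial>M) / c) ((\<integral>x. W x * cos (- pi / 2 + t * Y x) \<partial>M) / c)"
      "\<And>A. A \<in> sets borel \<Longrightarrow> measure P A = (\<integral>x. W x * indicator A (Y x) \<partial>M) / c"
      by (rule tilted_law[OF M assms(2,3) W c_def 2]) (rule that; blast)
    obtain Q where Q: "real_distribution Q"
      "\<And>t. char Q t = Complex ((\<integral>x. W' x * cos (0 + t * Y' x) \<partial>N) / c) ((\<integral>x. W' x * cos (- pi / 2 + t * Y' x) \<partial>N) / c)"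
      "\<And>A. A \<in> sets borel \<Longrightarrow> measure Q A = (\<integral>x. W' x * indicator A (Y' x) \<partial>N) / c"
      by (rule tilted_law[OF N assms(5,6) W' c' 2]) (rule that; blast)
    have "char P = char Q" 
    proof
      fix t show "char P t = char Q t" unfolding P(2) Q(2) eq by (rule refl)
    qed
    then have "P = Q" by (rule Levy_uniqueness[OF P(1) Q(1)])
    then show ?thesis using P(3)[OF A] Q(3)[OF A] 2 by simp
  qed
qed

text \<open>
  The weight \<open>1 + cos (\<theta> + S)\<close> is nonnegative and expresses a trigonometric factor as a tilt of the
  measure; by the product formula, integrals against it reduce to integrals of single cosines.
\<close>

lemma integral_tilted_cos:
  fixes W S Y :: "'a \<Rightarrow> real"
  assumes M: "prob_space M"
    and [measurable]: "W \<in> borel_measurable M" "S \<in> borel_measurable M" "Y \<in> borel_measurable M"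
    and W: "\<And>x. 0 \<le> W x" "\<And>x. W x \<le> 1"
  shows "(\<integral>x. W x * (1 + cos (\<theta> + S x)) * cos (\<alpha> + s * Y x) \<partial>M) =
    (\<integral>x. W x * cos (\<alpha> + s * Y x) \<partial>M) + ((\<integral>x. W x * cos ((\<theta> + \<alpha>) + (s * Y x + S x)) \<partial>M) / 2 +
      (\<integral>x. W x * cos ((\<theta> - \<alpha>) + (- s * Y x + S x)) \<partial>M) / 2)"
proof -
  interpret prob_space M by (rule M)
  have int: "integrable M (\<lambda>x. W x * cos (g x))" if [measurable]: "g \<in> borel_measurable M" for g
    by (rule integrable_const_bound[where B=1]) (use W in \<open>auto simp: abs_mult intro!: mult_le_one\<close>)
  have trig: "w * (1 + cos (\<theta> + z)) * cos (\<alpha> + s * y) = w * cos (\<alpha> + s * y) +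
      ((w * cos ((\<theta> + \<alpha>) + (s * y + z))) / 2 + (w * cos ((\<theta> - \<alpha>) + (- s * y + z))) / 2)" for w z y
  proof -
    have "cos (\<theta> + z) * cos (\<alpha> + s * y) = (cos ((\<theta> + z) - (\<alpha> + s * y)) + cos ((\<theta> + z) + (\<alpha> + s * y))) / 2"
      by (rule cos_times_cos)
    also have "(\<theta> + z) - (\<alpha> + s * y) = (\<theta> - \<alpha>) + (- s * y + z)" by simp
    also have "(\<theta> + z) + (\<alpha> + s * y) = (\<theta> + \<alpha>) + (s * y + z)" by simp
    finally have 1: "cos (\<theta> + z) * cos (\<alpha> + s * y) =
      (cos ((\<theta> - \<alpha>) + (- s * y + z)) + cos ((\<theta> + \<alpha>) + (s * y + z))) / 2" .
    have "w * (1 + cos (\<theta> + z)) * cos (\<alpha> + s * y) = w * cos (\<alpha> + s * y) + w * (cos (\<theta> + z) * cos (\<alpha> + s * y))"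
      by (simp add: algebra_simps)
    then show ?thesis unfolding 1 by (simp add: field_simps)
  qed
  have halves: "(\<integral>x. a x + (b x / 2 + c x / 2) \<partial>M) = (\<integral>x. a x \<partial>M) + ((\<integral>x. b x \<partial>M) / 2 + (\<integral>x. c x \<partial>M) / 2)"
    if "integrable M a" "integrable M b" "integrable M c" for a b c :: "'a \<Rightarrow> real"
    using that by simp
  show ?thesis unfolding trig by (rule halves) (rule int; measurable)+
qed

lemma tilted_weight_bounds:
  fixes w z :: real
  assumes "0 \<le> w" "w \<le> 1"
  shows "0 \<le> w * (1 + cos z)" "w * (1 + cos z) \<le> 2"
proof -
  have c: "0 \<le> 1 + cos z" "1 + cos z \<le> 2" using cos_ge_minus_one[of z] cos_le_one[of z] by linarith+
  show "0 \<le> w * (1 + cos z)" by (rule mult_nonneg_nonneg[OF assms(1) c(1)])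
  show "w * (1 + cos z) \<le> 2" using mult_mono[OF assms(2) c(2) _ c(1)] by simp
qed

text \<open>
  A Cramer--Wold device, obtained from the one-dimensional uniqueness theorem one coordinate at a
  time. The claim in the proof interpolates between the hypothesis and the assertion: the
  coordinates in \<open>J\<close> enter through indicators and the others through a cosine. To move \<open>x\<close> into \<open>J\<close>, the
  indicators and the cosine of the remaining coordinates are regarded as a weight, and the laws of
  \<open>U x\<close> and \<open>V x\<close> under these weights are compared.
\<close>

lemma joint_law_eqI:
  fixes U :: "'i \<Rightarrow> 'a \<Rightarrow> real" and V :: "'i \<Rightarrow> 'b \<Rightarrow> real"
  assumes M: "prob_space M" and N: "prob_space N" and fin: "finite I"
    and mU: "\<And>j. j \<in> I \<Longrightarrow> U j \<in> borel_measurable M"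
    and mV: "\<And>j. j \<in> I \<Longrightarrow> V j \<in> borel_measurable N"
    and eq: "\<And>\<theta> t. (\<integral>\<omega>. cos (\<theta> + (\<Sum>j\<in>I. t j * U j \<omega>)) \<partial>M) = (\<integral>\<omega>. cos (\<theta> + (\<Sum>j\<in>I. t j * V j \<omega>)) \<partial>N)"
  shows "distr M (\<Pi>\<^sub>M j\<in>I. borel) (\<lambda>\<omega>. \<lambda>j\<in>I. U j \<omega>) = distr N (\<Pi>\<^sub>M j\<in>I. borel) (\<lambda>\<omega>. \<lambda>j\<in>I. V j \<omega>)"
proof -
  interpret M: prob_space M by (rule M)
  interpret N: prob_space N by (rule N)
  have claim: "(\<integral>\<omega>. (\<Prod>j\<in>J. indicator (A j) (U j \<omega>)) * cos (\<theta> + (\<Sum>j\<in>I-J. t j * U j \<omega>)) \<partial>M) =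
        (\<integral>\<omega>. (\<Prod>j\<in>J. indicator (A j) (V j \<omega>)) * cos (\<theta> + (\<Sum>j\<in>I-J. t j * V j \<omega>)) \<partial>N)"
    if "J \<subseteq> I" "\<And>j. A j \<in> sets borel" for J \<theta> t and A :: "'i \<Rightarrow> real set"
  proof -
    have "finite J" using that fin finite_subset by auto
    then show ?thesis using that(1)
    proof (induction J arbitrary: \<theta> t rule: finite_induct)
      case empty
      then show ?case using eq by simp
    next
      case (insert x J)
      have x: "x \<in> I" "x \<notin> J" and J: "J \<subseteq> I" using insert by auto
      note [measurable] = that(2) mU[OF x(1)] mV[OF x(1)]
      have dec: "I - J = insert x (I - insert x J)" "x \<notin> I - insert x J" "finite (I - insert x J)"
        using x fin by auto
      define WU where "WU = (\<lambda>\<omega>. \<Prod>j\<in>J. indicator (A j) (U j \<omega>) :: real)"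
      define WV where "WV = (\<lambda>\<omega>. \<Prod>j\<in>J. indicator (A j) (V j \<omega>) :: real)"
      define SU where "SU = (\<lambda>\<omega>. \<Sum>j\<in>I - insert x J. t j * U j \<omega>)"
      define SV where "SV = (\<lambda>\<omega>. \<Sum>j\<in>I - insert x J. t j * V j \<omega>)"
      have mWU [measurable]: "WU \<in> borel_measurable M" unfolding WU_def
      proof (rule borel_measurable_prod)
        fix i assume "i \<in> J"
        then have [measurable]: "U i \<in> borel_measurable M" using J mU by auto
        show "(\<lambda>x. indicat_real (A i) (U i x)) \<in> borel_measurable M" by measurable
      qed
      have mWV [measurable]: "WV \<in> borel_measurable N" unfolding WV_def
      proof (rule borel_measurable_prod)
        fix i assume "i \<in> J"
        then have [measurable]: "V i \<in> borel_measurable N" using J mV by auto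
        show "(\<lambda>x. indicat_real (A i) (V i x)) \<in> borel_measurable N" by measurable
      qed
      have [measurable]: "SU \<in> borel_measurable M" "SV \<in> borel_measurable N"
        unfolding SU_def SV_def using mU mV by (auto intro!: borel_measurable_sum borel_measurable_times)
      have W01: "0 \<le> WU \<omega>" "WU \<omega> \<le> 1" "0 \<le> WV \<omega>'" "WV \<omega>' \<le> 1" for \<omega> \<omega>'
        unfolding WU_def WV_def by (auto intro!: prod_nonneg prod_le_1)
      have sumU: "(\<Sum>j\<in>I-J. (r(x := s)) j * U j \<omega>) = s * U x \<omega> + (\<Sum>j\<in>I - insert x J. r j * U j \<omega>)" for r s \<omega>
        unfolding dec(1) by (subst sum.insert) (use dec(2,3) in \<open>auto intro!: sum.cong\<close>)
      have sumV: "(\<Sum>j\<in>I-J. (r(x := s)) j * V j \<omega>) = s * V x \<omega> + (\<Sum>j\<in>I - insert x J. r j * V j \<omega>)" for r s \<omega>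
        unfolding dec(1) by (subst sum.insert) (use dec(2,3) in \<open>auto intro!: sum.cong\<close>)
      have IH0: "(\<integral>\<omega>. WU \<omega> * cos (\<alpha> + s * U x \<omega>) \<partial>M) = (\<integral>\<omega>. WV \<omega> * cos (\<alpha> + s * V x \<omega>) \<partial>N)" for \<alpha> s
        using insert.IH[OF J, of \<alpha> "(\<lambda>_. 0)(x := s)"] unfolding sumU sumV WU_def WV_def by simp
      have IH1: "(\<integral>\<omega>. WU \<omega> * cos (\<alpha> + (s * U x \<omega> + SU \<omega>)) \<partial>M) = (\<integral>\<omega>. WV \<omega> * cos (\<alpha> + (s * V x \<omega> + SV \<omega>)) \<partial>N)" for \<alpha> s
        using insert.IH[OF J, of \<alpha> "t(x := s)"] unfolding sumU sumV WU_def WV_def SU_def SV_def by simp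
      have intU: "integrable M (\<lambda>\<omega>. WU \<omega> * g \<omega>)" if [measurable]: "g \<in> borel_measurable M" and "\<And>x. \<bar>g x\<bar> \<le> 1" for g
      proof (rule M.integrable_const_bound[where B=1])
        show "AE x in M. norm (WU x * g x) \<le> 1"
          using W01 that(2) by (auto simp: abs_mult intro!: mult_le_one)
      qed measurable
      have intV: "integrable N (\<lambda>\<omega>. WV \<omega> * g \<omega>)" if [measurable]: "g \<in> borel_measurable N" and "\<And>x. \<bar>g x\<bar> \<le> 1" for g
      proof (rule N.integrable_const_bound[where B=1])
        show "AE x in N. norm (WV x * g x) \<le> 1"
          using W01 that(2) by (auto simp: abs_mult intro!: mult_le_one)
      qed measurable
      have key: "(\<integral>\<omega>. (WU \<omega> * (1 + cos (\<theta> + SU \<omega>))) * indicator (A x) (U x \<omega>) \<partial>M) =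
          (\<integral>\<omega>. (WV \<omega> * (1 + cos (\<theta> + SV \<omega>))) * indicator (A x) (V x \<omega>) \<partial>N)"
      proof (rule weighted_law_unique[OF M _ _ N, where B=2])
        show "(\<integral>\<omega>. WU \<omega> * (1 + cos (\<theta> + SU \<omega>)) * cos (\<alpha> + s * U x \<omega>) \<partial>M) =
            (\<integral>\<omega>. WV \<omega> * (1 + cos (\<theta> + SV \<omega>)) * cos (\<alpha> + s * V x \<omega>) \<partial>N)" for \<alpha> s
          by (subst integral_tilted_cos[OF M], (measurable; fail)+, (rule W01)+,
              subst integral_tilted_cos[OF N], (measurable; fail)+, (rule W01)+)
             (simp only: IH0 IH1)
      qed (use that(2) tilted_weight_bounds W01 in \<open>measurable\<close>)
      have key0: "(\<integral>\<omega>. WU \<omega> * indicator (A x) (U x \<omega>) \<partial>M) = (\<integral>\<omega>. WV \<omega> * indicator (A x) (V x \<omega>) \<partial>N)"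
        by (rule weighted_law_unique[OF M _ _ N, where B=1]) (use W01 IH0 that(2) in \<open>auto\<close>)
      have dU: "(\<Prod>j\<in>insert x J. indicator (A j) (U j \<omega>)) * cos (\<theta> + SU \<omega>) =
          (WU \<omega> * (1 + cos (\<theta> + SU \<omega>))) * indicator (A x) (U x \<omega>) - WU \<omega> * indicator (A x) (U x \<omega>)" for \<omega>
        using insert.hyps by (simp add: WU_def algebra_simps)
      have dV: "(\<Prod>j\<in>insert x J. indicator (A j) (V j \<omega>)) * cos (\<theta> + SV \<omega>) =
          (WV \<omega> * (1 + cos (\<theta> + SV \<omega>))) * indicator (A x) (V x \<omega>) - WV \<omega> * indicator (A x) (V x \<omega>)" for \<omega>
        using insert.hyps by (simp add: WV_def algebra_simps)
      have iU: "integrable M (\<lambda>\<omega>. (WU \<omega> * (1 + cos (\<theta> + SU \<omega>))) * indicator (A x) (U x \<omega>))"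
      proof -
        have "(\<lambda>\<omega>. (WU \<omega> * (1 + cos (\<theta> + SU \<omega>))) * indicator (A x) (U x \<omega>)) =
          (\<lambda>\<omega>. WU \<omega> * indicator (A x) (U x \<omega>) + WU \<omega> * (cos (\<theta> + SU \<omega>) * indicator (A x) (U x \<omega>)))"
          by (simp add: algebra_simps)
        then show ?thesis by (auto intro!: Bochner_Integration.integrable_add intU simp: indicator_def)
      qed
      have iV: "integrable N (\<lambda>\<omega>. (WV \<omega> * (1 + cos (\<theta> + SV \<omega>))) * indicator (A x) (V x \<omega>))"
      proof -
        have "(\<lambda>\<omega>. (WV \<omega> * (1 + cos (\<theta> + SV \<omega>))) * indicator (A x) (V x \<omega>)) =
          (\<lambda>\<omega>. WV \<omega> * indicator (A x) (V x \<omega>) + WV \<omega> * (cos (\<theta> + SV \<omega>) * indicator (A x) (V x \<omega>)))"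
          by (simp add: algebra_simps)
        then show ?thesis by (auto intro!: Bochner_Integration.integrable_add intV simp: indicator_def)
      qed
      have iU0: "integrable M (\<lambda>\<omega>. WU \<omega> * indicator (A x) (U x \<omega>))"
        and iV0: "integrable N (\<lambda>\<omega>. WV \<omega> * indicator (A x) (V x \<omega>))"
        by (auto intro!: intU intV simp: indicator_def)
      have "(\<integral>\<omega>. (\<Prod>j\<in>insert x J. indicator (A j) (U j \<omega>)) * cos (\<theta> + SU \<omega>) \<partial>M) =
         (\<integral>\<omega>. (\<Prod>j\<in>insert x J. indicator (A j) (V j \<omega>)) * cos (\<theta> + SV \<omega>) \<partial>N)"
        unfolding dU dV Bochner_Integration.integral_diff[OF iU iU0]
          Bochner_Integration.integral_diff[OF iV iV0] key key0 by (rule refl)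
      then show ?case unfolding SU_def SV_def .
    qed
  qed
  have emb: "indicator (Pi\<^sub>E I A) (\<lambda>j\<in>I. z j) = (\<Prod>j\<in>I. indicator (A j) (z j) :: real)" for A and z :: "'i \<Rightarrow> real"
    using fin by (auto simp: indicator_def PiE_def Pi_def prod_zero_iff)
  have mUV [measurable]: "(\<lambda>\<omega>. \<lambda>j\<in>I. U j \<omega>) \<in> measurable M (\<Pi>\<^sub>M j\<in>I. borel)"
       "(\<lambda>\<omega>. \<lambda>j\<in>I. V j \<omega>) \<in> measurable N (\<Pi>\<^sub>M j\<in>I. borel)"
    using mU mV by (auto intro!: measurable_restrict)
  interpret PM: prob_space "distr M (\<Pi>\<^sub>M j\<in>I. borel :: real measure) (\<lambda>\<omega>. \<lambda>j\<in>I. U j \<omega>)"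
    by (rule M.prob_space_distr) simp
  interpret PN: prob_space "distr N (\<Pi>\<^sub>M j\<in>I. borel :: real measure) (\<lambda>\<omega>. \<lambda>j\<in>I. V j \<omega>)"
    by (rule N.prob_space_distr) simp
  show ?thesis
  proof (rule measure_eqI_PiM_finite[OF fin])
    fix A :: "'i \<Rightarrow> real set" assume A: "\<And>i. i \<in> I \<Longrightarrow> A i \<in> sets borel"
    define A' where "A' = (\<lambda>j. if j \<in> I then A j else {})"
    have A': "A' j \<in> sets borel" for j using A by (auto simp: A'_def)
    have AA': "Pi\<^sub>E I A = Pi\<^sub>E I A'" by (auto simp: A'_def intro!: PiE_cong)
    have [measurable]: "Pi\<^sub>E I A' \<in> sets (\<Pi>\<^sub>M j\<in>I. borel)"
      using fin A' by (intro sets_PiM_I_finite) auto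
    have "measure (distr M (\<Pi>\<^sub>M j\<in>I. borel) (\<lambda>\<omega>. \<lambda>j\<in>I. U j \<omega>)) (Pi\<^sub>E I A') =
        (\<integral>\<omega>. indicator (Pi\<^sub>E I A') (\<lambda>j\<in>I. U j \<omega>) \<partial>M)"
      by (subst integral_distr[symmetric, where g="\<lambda>\<omega>. \<lambda>j\<in>I. U j \<omega>" and N="\<Pi>\<^sub>M j\<in>I. borel"]) auto
    also have "\<dots> = (\<integral>\<omega>. indicator (Pi\<^sub>E I A') (\<lambda>j\<in>I. V j \<omega>) \<partial>N)"
    proof -
      have "(\<integral>\<omega>. (\<Prod>j\<in>I. indicator (A' j) (U j \<omega>)) * cos (0 + (\<Sum>j\<in>I-I. 0 * U j \<omega>)) \<partial>M) =
        (\<integral>\<omega>. (\<Prod>j\<in>I. indicator (A' j) (V j \<omega>)) * cos (0 + (\<Sum>j\<in>I-I. 0 * V j \<omega>)) \<partial>N)"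
        by (rule claim) (auto simp: A')
      then show ?thesis by (simp add: emb)
    qed
    also have "\<dots> = measure (distr N (\<Pi>\<^sub>M j\<in>I. borel) (\<lambda>\<omega>. \<lambda>j\<in>I. V j \<omega>)) (Pi\<^sub>E I A')"
      by (subst integral_distr[symmetric, where g="\<lambda>\<omega>. \<lambda>j\<in>I. V j \<omega>" and N="\<Pi>\<^sub>M j\<in>I. borel"]) auto
    finally show "emeasure (distr M (\<Pi>\<^sub>M j\<in>I. borel) (\<lambda>\<omega>. \<lambda>j\<in>I. U j \<omega>)) (Pi\<^sub>E I A) =
        emeasure (distr N (\<Pi>\<^sub>M j\<in>I. borel) (\<lambda>\<omega>. \<lambda>j\<in>I. V j \<omega>)) (Pi\<^sub>E I A)"
      unfolding AA' PM.emeasure_eq_measure PN.emeasure_eq_measure by simp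
  next
    show "range (\<lambda>_::nat. Pi\<^sub>E I (\<lambda>_. UNIV)) \<subseteq> prod_algebra I (\<lambda>_. borel :: real measure)"
      using fin by (auto intro!: prod_algebraI_finite)
    show "(\<Union>i::nat. Pi\<^sub>E I (\<lambda>_. UNIV)) = space (\<Pi>\<^sub>M j\<in>I. borel :: real measure)"
      by (simp add: space_PiM)
  qed simp_all
qed

lemma normal_law_eq_distr:
  assumes "0 \<le> v"
  shows "normal_law \<mu> v = distr std_gaussian borel (\<lambda>x. \<mu> + sqrt v * x)"
proof (cases "v = 0")
  case True
  then show ?thesis by (simp add: normal_law_def gaussian.distr_const)
next
  case False
  have "distributed std_gaussian lborel (\<lambda>x. x) (\<lambda>x. ennreal (std_normal_density x))"
    unfolding distributed_def
    by (auto simp: std_gaussian_def distr_id2 cong: distr_cong)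
  then have "distributed std_gaussian lborel (\<lambda>x. \<mu> + sqrt v * x)
      (normal_density (\<mu> + sqrt v * 0) (\<bar>sqrt v\<bar> * 1))"
    by (rule gaussian.normal_density_affine) (use False assms in auto)
  then have "distr std_gaussian lborel (\<lambda>x. \<mu> + sqrt v * x) = density lborel (normal_density \<mu> (sqrt v))"
    using assms by (simp add: distributed_def)
  moreover have "distr std_gaussian lborel (\<lambda>x. \<mu> + sqrt v * x) = distr std_gaussian borel (\<lambda>x. \<mu> + sqrt v * x)"
    by (rule distr_cong) auto
  ultimately show ?thesis using False by (simp add: normal_law_def)
qed

lemma integral_std_gaussian_cos: "(\<integral>x. cos (\<theta> + s * x) \<partial>std_gaussian) = cos \<theta> * exp (- s\<^sup>2 / 2)"
proof -
  have i: "integrable std_gaussian (\<lambda>x. iexp (s * x))"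
    by (rule gaussian.integrable_const_bound[where B=1]) auto
  have c: "(\<integral>x. iexp (s * x) \<partial>std_gaussian) = complex_of_real (exp (- (s^2) / 2))"
    using fun_cong[OF char_std_normal_distribution, of s]
    unfolding char_def std_gaussian_def by simp
  have "(\<integral>x. cos (s * x) \<partial>std_gaussian) = Re (\<integral>x. iexp (s * x) \<partial>std_gaussian)"
    by (subst integral_Re[OF i, symmetric]) (simp add: Re_exp)
  then have 1: "(\<integral>x. cos (s * x) \<partial>std_gaussian) = exp (- s\<^sup>2 / 2)" unfolding c by simp
  have "(\<integral>x. sin (s * x) \<partial>std_gaussian) = Im (\<integral>x. iexp (s * x) \<partial>std_gaussian)"
    by (subst integral_Im[OF i, symmetric]) (simp add: Im_exp)
  then have 2: "(\<integral>x. sin (s * x) \<partial>std_gaussian) = 0" unfolding c by simp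
  have "(\<integral>x. cos (\<theta> + s * x) \<partial>std_gaussian) = (\<integral>x. cos \<theta> * cos (s * x) - sin \<theta> * sin (s * x) \<partial>std_gaussian)"
    by (simp add: cos_add)
  also have "\<dots> = cos \<theta> * (\<integral>x. cos (s * x) \<partial>std_gaussian) - sin \<theta> * (\<integral>x. sin (s * x) \<partial>std_gaussian)"
    by (subst Bochner_Integration.integral_diff)
       (auto intro!: gaussian.integrable_const_bound[where B=1] integrable_mult_right)
  finally show ?thesis by (simp add: 1 2)
qed

lemma poly_measurable [measurable]: "poly q \<in> borel_measurable (borel :: real measure)"
  by (intro borel_measurable_continuous_onI continuous_intros)

lemma integrable_std_gaussian_poly: "integrable std_gaussian (\<lambda>x. poly q x)"
proof -
  have "integrable lborel (\<lambda>x. \<Sum>i\<le>degree q. coeff q i * (std_normal_density x * x ^ i))"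
    by (intro Bochner_Integration.integrable_sum integrable_mult_right integrable_std_normal_moment)
  then show ?thesis
    by (subst integrable_std_gaussian_iff)
       (auto simp: poly_altdef sum_distrib_left mult_ac intro!: borel_measurable_continuous_onI continuous_intros)
qed

lemma square_integrable_poly: "integrable std_gaussian (\<lambda>x. (poly q x)\<^sup>2)"
  using integrable_std_gaussian_poly[of "q\<^sup>2"] by (simp add: poly_power)

lemma integral_std_gaussian_id: "(\<integral>x. x \<partial>std_gaussian) = 0"
  using std_gaussian_integration_by_parts[of "\<lambda>_. 1" "\<lambda>_. 0"] integrable_std_gaussian_poly[of "[:0,1:]"] by simp

lemma integral_std_gaussian_square: "(\<integral>x. x\<^sup>2 \<partial>std_gaussian) = 1"
  using std_gaussian_integration_by_parts[of "\<lambda>x. x" "\<lambda>_. 1"] integrable_std_gaussian_poly[of "[:0,0,1:]"]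
  by (simp add: power2_eq_square)

section \<open>Regression and integration by parts in Gaussian sequences\<close>

lemma integral_double_sum:
  fixes F :: "'i \<Rightarrow> 'j \<Rightarrow> 'a \<Rightarrow> real"
  assumes "\<And>k l. k \<in> A \<Longrightarrow> l \<in> B \<Longrightarrow> integrable M (F k l)"
  shows "integrable M (\<lambda>x. \<Sum>k\<in>A. \<Sum>l\<in>B. F k l x)"
    and "(\<integral>x. (\<Sum>k\<in>A. \<Sum>l\<in>B. F k l x) \<partial>M) = (\<Sum>k\<in>A. \<Sum>l\<in>B. \<integral>x. F k l x \<partial>M)"
  using assms by simp_all

text \<open>
  Gives integrability of products of four polynomials from moments of a single variable, without
  knowledge of the joint law.
\<close>

lemma abs_mult4_le: "\<bar>a * b * c * d\<bar> \<le> a ^ 4 + b ^ 4 + c ^ 4 + d ^ 4" for a b c d :: real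
proof -
  define m where "m = max (max \<bar>a\<bar> \<bar>b\<bar>) (max \<bar>c\<bar> \<bar>d\<bar>)"
  have m: "\<bar>a\<bar> \<le> m" "\<bar>b\<bar> \<le> m" "\<bar>c\<bar> \<le> m" "\<bar>d\<bar> \<le> m" "0 \<le> m" by (simp_all add: m_def le_max_iff_disj)
  have "\<bar>a * b * c * d\<bar> \<le> m * m * m * m"
    unfolding abs_mult using m by (intro mult_mono mult_nonneg_nonneg) auto
  also have "\<dots> = m ^ 4" by (simp add: power4_eq_xxxx)
  also have "\<dots> \<le> a ^ 4 + b ^ 4 + c ^ 4 + d ^ 4"
  proof -
    have "m \<in> {\<bar>a\<bar>, \<bar>b\<bar>, \<bar>c\<bar>, \<bar>d\<bar>}" unfolding m_def max_def by auto
    then have "m ^ 4 \<in> {a ^ 4, b ^ 4, c ^ 4, d ^ 4}" by auto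
    moreover have "0 \<le> a ^ 4" "0 \<le> b ^ 4" "0 \<le> c ^ 4" "0 \<le> d ^ 4" by auto
    ultimately show ?thesis by auto
  qed
  finally show ?thesis .
qed

lemma std_gaussian_affine_moments:
  "(\<integral>x. \<mu> + \<sigma> * x \<partial>std_gaussian) = \<mu>" "(\<integral>x. (0 + \<sigma> * x)\<^sup>2 \<partial>std_gaussian) = \<sigma>\<^sup>2"
proof -
  have i1: "integrable std_gaussian (\<lambda>x. \<sigma> * x)" using integrable_std_gaussian_poly[of "[:0,\<sigma>:]"] by (simp add: mult.commute)
  have "(\<integral>x. \<mu> + \<sigma> * x \<partial>std_gaussian) = (\<integral>x. \<mu> \<partial>std_gaussian) + (\<integral>x. \<sigma> * x \<partial>std_gaussian)"
    by (rule Bochner_Integration.integral_add[OF _ i1]) simp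
  then show "(\<integral>x. \<mu> + \<sigma> * x \<partial>std_gaussian) = \<mu>"
    by (simp add: integral_std_gaussian_id)
  show "(\<integral>x. (0 + \<sigma> * x)\<^sup>2 \<partial>std_gaussian) = \<sigma>\<^sup>2"
    unfolding add_0_left power_mult_distrib integral_mult_right_zero integral_std_gaussian_square by simp
qed

locale unit_gaussian_sequence = prob_space M for M :: "'a measure" +
  fixes X :: "nat \<Rightarrow> 'a \<Rightarrow> real"
  assumes gaussian: "gaussian_sequence M X"
    and mean_0: "1 \<le> k \<Longrightarrow> expectation (X k) = 0"
    and variance_1: "1 \<le> k \<Longrightarrow> variance (X k) = 1"
begin

definition R :: "nat \<Rightarrow> nat \<Rightarrow> real" where
  "R k l = expectation (\<lambda>\<omega>. X k \<omega> * X l \<omega>)"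

lemma rv_X [measurable (raw)]: "1 \<le> k \<Longrightarrow> X k \<in> borel_measurable M"
  using gaussian by (auto simp: gaussian_sequence_def)

lemma R_commute: "R k l = R l k"
  by (simp add: R_def mult.commute)

lemma lincomb_law:
  obtains \<mu> v where "0 \<le> v" "distr M borel (\<lambda>\<omega>. \<Sum>k=1..n. a k * X k \<omega>) = distr std_gaussian borel (\<lambda>x. \<mu> + sqrt v * x)"
  using gaussian normal_law_eq_distr unfolding gaussian_sequence_def by metis

lemma law_X:
  assumes k: "1 \<le> k"
  shows "distr M borel (X k) = std_gaussian"
proof -
  note [measurable] = rv_X[OF k]
  obtain \<mu> v where v: "0 \<le> v"
    and l: "distr M borel (\<lambda>\<omega>. \<Sum>j=1..k. (if j = k then 1 else 0) * X j \<omega>) = distr std_gaussian borel (\<lambda>x. \<mu> + sqrt v * x)"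
    by (rule lincomb_law)
  have "(\<Sum>j=1..k. (if j = k then 1 else 0) * X j \<omega>) = X k \<omega>" for \<omega>
    using k by (subst sum.remove[of _ k]) (auto intro!: sum.neutral)
  with l have law: "distr M borel (X k) = distr std_gaussian borel (\<lambda>x. \<mu> + sqrt v * x)" by simp
  have tr: "expectation (\<lambda>\<omega>. g (X k \<omega>)) = (\<integral>x. g (\<mu> + sqrt v * x) \<partial>std_gaussian)"
    if [measurable]: "g \<in> borel_measurable borel" for g :: "real \<Rightarrow> real"
  proof -
    have "expectation (\<lambda>\<omega>. g (X k \<omega>)) = (\<integral>x. g x \<partial>distr M borel (X k))"
      by (subst integral_distr) auto
    also have "\<dots> = (\<integral>x. g (\<mu> + sqrt v * x) \<partial>std_gaussian)"
      unfolding law by (subst integral_distr) auto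
    finally show ?thesis .
  qed
  have "expectation (X k) = \<mu>"
    using tr[of "\<lambda>x. x"] unfolding std_gaussian_affine_moments by simp
  then have \<mu>: "\<mu> = 0" using mean_0[OF k] by simp
  have "variance (X k) = v"
    using tr[of "\<lambda>x. x\<^sup>2"] v unfolding \<mu> std_gaussian_affine_moments mean_0[OF k] by simp
  then have v1: "v = 1" using variance_1[OF k] by simp
  have "distr std_gaussian borel (\<lambda>x. x) = std_gaussian" by (rule distr_id2) simp
  then show ?thesis unfolding law \<mu> v1 by simp
qed

lemma integrable_X_iff:
  assumes "1 \<le> k" "g \<in> borel_measurable borel"
  shows "integrable M (\<lambda>\<omega>. g (X k \<omega>)) \<longleftrightarrow> integrable std_gaussian (g :: real \<Rightarrow> real)"
  using integrable_distr_eq[of "X k" M borel g] assms rv_X law_X by simp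

lemma expectation_X:
  assumes "1 \<le> k" "g \<in> borel_measurable borel"
  shows "expectation (\<lambda>\<omega>. g (X k \<omega>)) = (\<integral>x. g x \<partial>std_gaussian :: real)"
  using integral_distr[of "X k" M borel g] assms rv_X law_X by simp

lemma integrable_poly_X: "1 \<le> k \<Longrightarrow> integrable M (\<lambda>\<omega>. poly q (X k \<omega>))"
  by (simp add: integrable_X_iff integrable_std_gaussian_poly)

lemma integrable_poly_X4:
  assumes "1 \<le> i" "1 \<le> j" "1 \<le> k" "1 \<le> l"
  shows "integrable M (\<lambda>\<omega>. poly p (X i \<omega>) * poly q (X j \<omega>) * poly r (X k \<omega>) * poly s (X l \<omega>))"
proof -
  note [measurable] = rv_X[OF assms(1)] rv_X[OF assms(2)] rv_X[OF assms(3)] rv_X[OF assms(4)]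
  have "integrable M (\<lambda>\<omega>. poly (p ^ 4) (X i \<omega>) + poly (q ^ 4) (X j \<omega>) + poly (r ^ 4) (X k \<omega>) + poly (s ^ 4) (X l \<omega>))"
    by (intro Bochner_Integration.integrable_add integrable_poly_X assms)
  then show ?thesis
    by (rule Bochner_Integration.integrable_bound)
       (auto intro!: AE_I2 order_trans[OF abs_mult4_le] simp: poly_power)
qed

lemma integrable_poly_X2:
  assumes "1 \<le> i" "1 \<le> j"
  shows "integrable M (\<lambda>\<omega>. poly p (X i \<omega>) * poly q (X j \<omega>))"
  using integrable_poly_X4[OF assms assms, of p q 1 1] by simp

lemma integrable_X_X: "1 \<le> i \<Longrightarrow> 1 \<le> j \<Longrightarrow> integrable M (\<lambda>\<omega>. X i \<omega> * X j \<omega>)"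
  using integrable_poly_X2[of i j "[:0,1:]" "[:0,1:]"] by simp

lemma integrable_X: "1 \<le> i \<Longrightarrow> integrable M (X i)"
  using integrable_poly_X[of i "[:0,1:]"] by simp

lemma R_diag: "1 \<le> k \<Longrightarrow> R k k = 1"
  using variance_1[of k] mean_0[of k] by (simp add: R_def power2_eq_square)

lemma abs_R_le_1:
  assumes "1 \<le> k" "1 \<le> l"
  shows "\<bar>R k l\<bar> \<le> 1"
proof -
  have "\<bar>R k l\<bar> \<le> expectation (\<lambda>\<omega>. \<bar>X k \<omega> * X l \<omega>\<bar>)"
    unfolding R_def by (rule integral_abs_bound)
  also have "\<dots> \<le> expectation (\<lambda>\<omega>. (X k \<omega> * X k \<omega>) / 2 + (X l \<omega> * X l \<omega>) / 2)"
  proof (intro integral_mono)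
    fix \<omega>
    have "0 \<le> (\<bar>X k \<omega>\<bar> - \<bar>X l \<omega>\<bar>)\<^sup>2" by simp
    then show "\<bar>X k \<omega> * X l \<omega>\<bar> \<le> (X k \<omega> * X k \<omega>) / 2 + (X l \<omega> * X l \<omega>) / 2"
      by (simp add: power2_diff abs_mult power2_eq_square[symmetric] field_simps)
  qed (use assms integrable_X_X in auto)
  also have "\<dots> = R k k / 2 + R l l / 2"
    using assms integrable_X_X by (simp add: R_def)
  also have "\<dots> = 1" using assms R_diag by simp
  finally show ?thesis .
qed

lemma lincomb_second_moment:
  "expectation (\<lambda>\<omega>. (\<Sum>k=1..n. a k * X k \<omega>)\<^sup>2) = (\<Sum>k=1..n. \<Sum>l=1..n. a k * a l * R k l)"
proof -
  have sq: "(\<Sum>k=1..n. a k * X k \<omega>)\<^sup>2 = (\<Sum>k=1..n. \<Sum>l=1..n. (a k * a l) * (X k \<omega> * X l \<omega>))" for \<omega>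
    unfolding power2_eq_square sum_product by (simp add: mult_ac)
  have i: "integrable M (\<lambda>\<omega>. (a k * a l) * (X k \<omega> * X l \<omega>))" if "k \<in> {1..n}" "l \<in> {1..n}" for k l
    using that by (intro integrable_mult_right integrable_X_X) auto
  show "expectation (\<lambda>\<omega>. (\<Sum>k=1..n. a k * X k \<omega>)\<^sup>2) = (\<Sum>k=1..n. \<Sum>l=1..n. a k * a l * R k l)"
    unfolding sq by (subst integral_double_sum(2), erule (1) i, simp add: R_def)
qed

text \<open>
  A linear combination of the \<open>X k\<close> is centered normal, and its variance is the quadratic form of the
  covariances.
\<close>

lemma lincomb_cos:
  "expectation (\<lambda>\<omega>. cos (\<theta> + (\<Sum>k=1..n. a k * X k \<omega>))) =
     cos \<theta> * exp (- (\<Sum>k=1..n. \<Sum>l=1..n. a k * a l * R k l) / 2)"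
proof -
  define Y where "Y = (\<lambda>\<omega>. \<Sum>k=1..n. a k * X k \<omega>)"
  have [measurable]: "Y \<in> borel_measurable M" unfolding Y_def
    by (intro borel_measurable_sum borel_measurable_times) (auto intro: rv_X)
  obtain \<mu> v where v: "0 \<le> v" and law: "distr M borel Y = distr std_gaussian borel (\<lambda>x. \<mu> + sqrt v * x)"
    unfolding Y_def by (rule lincomb_law)
  have tr: "expectation (\<lambda>\<omega>. g (Y \<omega>)) = (\<integral>x. g (\<mu> + sqrt v * x) \<partial>std_gaussian)"
    if [measurable]: "g \<in> borel_measurable borel" for g :: "real \<Rightarrow> real"
  proof -
    have "expectation (\<lambda>\<omega>. g (Y \<omega>)) = (\<integral>x. g x \<partial>distr M borel Y)"
      by (subst integral_distr) auto
    also have "\<dots> = (\<integral>x. g (\<mu> + sqrt v * x) \<partial>std_gaussian)"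
      unfolding law by (subst integral_distr) auto
    finally show ?thesis .
  qed
  have "expectation Y = \<mu>"
    using tr[of "\<lambda>x. x"] unfolding std_gaussian_affine_moments by simp
  moreover have "expectation Y = (\<Sum>k=1..n. expectation (\<lambda>\<omega>. a k * X k \<omega>))"
    unfolding Y_def by (rule Bochner_Integration.integral_sum) (auto intro!: integrable_mult_right integrable_X)
  ultimately have \<mu>: "\<mu> = 0" by (simp add: mean_0)
  have "expectation (\<lambda>\<omega>. (Y \<omega>)\<^sup>2) = v"
    using tr[of "\<lambda>x. x\<^sup>2"] v unfolding \<mu> std_gaussian_affine_moments by simp
  then have v': "v = (\<Sum>k=1..n. \<Sum>l=1..n. a k * a l * R k l)"
    unfolding Y_def lincomb_second_moment by simp
  have "expectation (\<lambda>\<omega>. cos (\<theta> + Y \<omega>)) = cos \<theta> * exp (- v / 2)"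
    using tr[of "\<lambda>x. cos (\<theta> + x)"] v by (simp add: \<mu> integral_std_gaussian_cos)
  then show ?thesis unfolding v' Y_def .
qed

text \<open>
  The residuals \<open>X l - X k * R k l\<close> are uncorrelated with \<open>X k\<close>, hence jointly independent of it, so \<open>X k\<close>
  may be replaced by an independent copy. Formally the trigonometric moments are compared: with
  \<open>b = (\<Sum>l. t l * R k l)\<close>, the residual part of \<open>(\<Sum>l. t l * X l)\<close> has variance smaller by \<open>b\<^sup>2\<close>, which is the variance
  of the independent part \<open>b * \<xi>\<close>.
\<close>

lemma joint_law_regression:
  assumes k: "k \<in> {1..n}"
  shows "distr M (\<Pi>\<^sub>M l\<in>{1..n}. borel) (\<lambda>\<omega>. \<lambda>l\<in>{1..n}. X l \<omega>) =
    distr (M \<Otimes>\<^sub>M std_gaussian) (\<Pi>\<^sub>M l\<in>{1..n}. borel) (\<lambda>p. \<lambda>l\<in>{1..n}. X l (fst p) - X k (fst p) * R k l + snd p * R k l)"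
proof (rule joint_law_eqI)
  interpret P: pair_prob_space M std_gaussian ..
  show "prob_space (M \<Otimes>\<^sub>M std_gaussian)" by (rule P.prob_space_axioms)
  have [measurable]: "X k \<in> borel_measurable M" using k rv_X by auto
  fix j assume j: "j \<in> {1..n}"
  then show mj [measurable]: "X j \<in> borel_measurable M" by (auto intro: rv_X)
  show "(\<lambda>p. X j (fst p) - X k (fst p) * R k j + snd p * R k j) \<in> borel_measurable (M \<Otimes>\<^sub>M std_gaussian)"
    by measurable
next
  interpret P: pair_prob_space M std_gaussian ..
  have [measurable]: "X j \<in> borel_measurable M" if "j \<in> {1..n}" for j using that rv_X by auto
  fix \<theta> t
  define b where "b = (\<Sum>l=1..n. t l * R k l)"
  \<comment> \<open>The coefficients of the residual part of \<open>(\<Sum>l. t l * X l)\<close> with respect to the \<open>X l\<close>.\<close>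
  define a where "a = (\<lambda>l. t l - (if l = k then b else 0))"
  have aX: "(\<Sum>l=1..n. a l * x l) = (\<Sum>l=1..n. t l * x l) - b * x k" for x :: "nat \<Rightarrow> real"
    unfolding a_def left_diff_distrib sum_subtractf using k by (simp add: if_distrib[of "\<lambda>c. c * _"] cong: if_cong)
  have Q: "(\<Sum>k=1..n. \<Sum>l=1..n. a k * a l * R k l) = (\<Sum>k=1..n. \<Sum>l=1..n. t k * t l * R k l) - b\<^sup>2"
  proof -
    have comm: "t j * (s - b * R j k) = t j * s - b * (t j * R k j)" for j s
      by (subst R_commute) (simp add: algebra_simps)
    have "(\<Sum>j=1..n. \<Sum>l=1..n. a j * a l * R j l) = (\<Sum>j=1..n. a j * (\<Sum>l=1..n. a l * R j l))"
      by (simp add: sum_distrib_left mult.assoc)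
    also have "\<dots> = (\<Sum>j=1..n. t j * ((\<Sum>l=1..n. t l * R j l) - b * R j k)) - b * ((\<Sum>l=1..n. t l * R k l) - b * R k k)"
      by (simp only: aX)
    also have "\<dots> = (\<Sum>j=1..n. t j * (\<Sum>l=1..n. t l * R j l) - b * (t j * R k j)) - b * (b - b * R k k)"
      unfolding b_def[symmetric] comm by (rule refl)
    also have "\<dots> = (\<Sum>j=1..n. t j * (\<Sum>l=1..n. t l * R j l)) - b * b - b * (b - b * R k k)"
      unfolding sum_subtractf sum_distrib_left[symmetric] b_def[symmetric] by (rule refl)
    also have "b - b * R k k = 0" using k by (simp add: R_diag)
    also have "(\<Sum>j=1..n. t j * (\<Sum>l=1..n. t l * R j l)) - b * b - b * 0 = (\<Sum>k=1..n. \<Sum>l=1..n. t k * t l * R k l) - b\<^sup>2"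
      by (simp add: power2_eq_square sum_distrib_left mult.assoc)
    finally show ?thesis .
  qed
  have lin: "(\<Sum>j=1..n. t j * (X j \<omega> - X k \<omega> * R k j + x * R k j)) = (\<Sum>j=1..n. a j * X j \<omega>) + b * x" for \<omega> x
    unfolding aX by (simp add: b_def algebra_simps sum.distrib sum_subtractf sum_distrib_left)
  have int: "integrable (M \<Otimes>\<^sub>M std_gaussian) (\<lambda>p. cos (\<theta> + ((\<Sum>j=1..n. a j * X j (fst p)) + b * snd p)))"
    by (rule P.integrable_const_bound[where B=1]) (auto, measurable)
  have "(\<integral>p. cos (\<theta> + (\<Sum>j=1..n. t j * (X j (fst p) - X k (fst p) * R k j + snd p * R k j))) \<partial>(M \<Otimes>\<^sub>M std_gaussian)) =
     (\<integral>\<omega>. (\<integral>x. cos (\<theta> + ((\<Sum>j=1..n. a j * X j \<omega>) + b * x)) \<partial>std_gaussian) \<partial>M)"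
    unfolding lin using P.integral_fst'[OF int] by simp
  also have "\<dots> = (\<integral>\<omega>. cos (\<theta> + (\<Sum>j=1..n. a j * X j \<omega>)) * exp (- b\<^sup>2 / 2) \<partial>M)"
    by (simp only: add.assoc[symmetric] integral_std_gaussian_cos)
  also have "\<dots> = cos \<theta> * exp (- ((\<Sum>k=1..n. \<Sum>l=1..n. t k * t l * R k l) - b\<^sup>2) / 2) * exp (- b\<^sup>2 / 2)"
    by (simp only: integral_mult_left_zero lincomb_cos Q)
  also have "\<dots> = cos \<theta> * exp (- (\<Sum>k=1..n. \<Sum>l=1..n. t k * t l * R k l) / 2)"
    by (simp add: exp_add[symmetric] mult.assoc field_simps)
  finally show "expectation (\<lambda>\<omega>. cos (\<theta> + (\<Sum>j=1..n. t j * X j \<omega>))) =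
     (\<integral>p. cos (\<theta> + (\<Sum>j=1..n. t j * (X j (fst p) - X k (fst p) * R k j + snd p * R k j))) \<partial>(M \<Otimes>\<^sub>M std_gaussian))"
    by (simp only: lincomb_cos)
qed (auto intro: prob_space_axioms)

text \<open>
  \<open>G'\<close> is the derivative of \<open>G\<close> in the direction \<open>R k\<close>. This one directional derivative replaces
  \<open>(\<Sum>l. R k l * \<partial>\<^sub>l G)\<close>, so that no partial derivatives appear. After regression on \<open>X k\<close>, the argument of \<open>G\<close> moves
  along this direction as the independent variable varies, and the one-dimensional formula
  applies.
\<close>

lemma gaussian_integration_by_parts:
  fixes G G' :: "(nat \<Rightarrow> real) \<Rightarrow> real"
  assumes k: "k \<in> {1..n}"
    and mG [measurable]: "G \<in> borel_measurable (\<Pi>\<^sub>M l\<in>{1..n}. borel)"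
    and mG' [measurable]: "G' \<in> borel_measurable (\<Pi>\<^sub>M l\<in>{1..n}. borel)"
    and deriv: "\<And>x t. ((\<lambda>t. G (\<lambda>l\<in>{1..n}. x l + t * R k l)) has_real_derivative G' (\<lambda>l\<in>{1..n}. x l + t * R k l)) (at t)"
    and cont: "\<And>x. continuous_on UNIV (\<lambda>t. G' (\<lambda>l\<in>{1..n}. x l + t * R k l))"
    and int_G: "integrable M (\<lambda>\<omega>. X k \<omega> * G (\<lambda>l\<in>{1..n}. X l \<omega>))"
    and int_G': "integrable M (\<lambda>\<omega>. G' (\<lambda>l\<in>{1..n}. X l \<omega>))"
  shows "expectation (\<lambda>\<omega>. X k \<omega> * G (\<lambda>l\<in>{1..n}. X l \<omega>)) = expectation (\<lambda>\<omega>. G' (\<lambda>l\<in>{1..n}. X l \<omega>))"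
proof -
  interpret P: pair_prob_space M std_gaussian ..
  let ?P = "\<Pi>\<^sub>M l\<in>{1..n}. borel :: real measure"
  let ?U = "\<lambda>\<omega>. \<lambda>l\<in>{1..n}. X l \<omega>"
  define z where "z = (\<lambda>\<omega> l. X l \<omega> - X k \<omega> * R k l)"
  define V where "V = (\<lambda>p. \<lambda>l\<in>{1..n}. z (fst p) l + snd p * R k l)"
  have mX: "X j \<in> borel_measurable M" if "j \<in> {1..n}" for j using that rv_X by auto
  note [measurable] = mX[OF k]
  have mU [measurable]: "?U \<in> measurable M ?P" using mX by (intro measurable_restrict)
  have mV [measurable]: "V \<in> measurable (M \<Otimes>\<^sub>M std_gaussian) ?P"
    unfolding V_def z_def
  proof (intro measurable_restrict)
    fix l assume "l \<in> {1..n}"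
    note [measurable] = mX[OF this]
    show "(\<lambda>p. X l (fst p) - X k (fst p) * R k l + snd p * R k l) \<in> borel_measurable (M \<Otimes>\<^sub>M std_gaussian)"
      by measurable
  qed
  have law: "distr M ?P ?U = distr (M \<Otimes>\<^sub>M std_gaussian) ?P V"
    using joint_law_regression[OF k] unfolding V_def z_def .
  have tr: "integrable M (\<lambda>\<omega>. g (?U \<omega>)) \<longleftrightarrow> integrable (M \<Otimes>\<^sub>M std_gaussian) (\<lambda>p. g (V p))"
       "expectation (\<lambda>\<omega>. g (?U \<omega>)) = (\<integral>p. g (V p) \<partial>(M \<Otimes>\<^sub>M std_gaussian))"
    if g: "g \<in> borel_measurable ?P" for g :: "(nat \<Rightarrow> real) \<Rightarrow> real"
    using integrable_distr_eq[OF mU g] integrable_distr_eq[OF mV g]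
      integral_distr[OF mU g] integral_distr[OF mV g] unfolding law by simp_all
  \<comment> \<open>At index \<open>k\<close> the regression leaves only the independent variable, since \<open>R k k = 1\<close>.\<close>
  have Vk: "V p k = snd p" for p using k R_diag[of k] by (simp add: V_def z_def)
  have m1: "(\<lambda>x. x k * G x) \<in> borel_measurable ?P"
    by (intro borel_measurable_times measurable_component_singleton k mG)
  have iG: "integrable (M \<Otimes>\<^sub>M std_gaussian) (\<lambda>p. snd p * G (V p))"
    using tr(1)[OF m1] int_G k by (simp add: Vk)
  have iG': "integrable (M \<Otimes>\<^sub>M std_gaussian) (\<lambda>p. G' (V p))"
    using tr(1)[OF mG'] int_G' by simp
  have "expectation (\<lambda>\<omega>. X k \<omega> * G (?U \<omega>)) = (\<integral>p. snd p * G (V p) \<partial>(M \<Otimes>\<^sub>M std_gaussian))"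
    using tr(2)[OF m1] k by (simp add: Vk)
  also have "\<dots> = (\<integral>\<omega>. (\<integral>x. x * G (V (\<omega>, x)) \<partial>std_gaussian) \<partial>M)"
    using P.integral_fst'[OF iG] by simp
  also have "\<dots> = (\<integral>\<omega>. (\<integral>x. G' (V (\<omega>, x)) \<partial>std_gaussian) \<partial>M)"
  proof (rule integral_cong_AE)
    have mp: "(\<lambda>p. snd p * G (V p)) \<in> borel_measurable (M \<Otimes>\<^sub>M std_gaussian)"
         "(\<lambda>p. G' (V p)) \<in> borel_measurable (M \<Otimes>\<^sub>M std_gaussian)" by measurable
    show "(\<lambda>\<omega>. \<integral>x. x * G (V (\<omega>, x)) \<partial>std_gaussian) \<in> borel_measurable M"
      using P.integrable_fst'[OF iG] by (auto dest: borel_measurable_integrable)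
    show "(\<lambda>\<omega>. \<integral>x. G' (V (\<omega>, x)) \<partial>std_gaussian) \<in> borel_measurable M"
      using P.integrable_fst'[OF iG'] by (auto dest: borel_measurable_integrable)
    show "AE \<omega> in M. (\<integral>x. x * G (V (\<omega>, x)) \<partial>std_gaussian) = (\<integral>x. G' (V (\<omega>, x)) \<partial>std_gaussian)"
      using P.AE_integrable_fst'[OF iG] P.AE_integrable_fst'[OF iG']
    proof eventually_elim
      case (elim \<omega>)
      show ?case
      proof (rule std_gaussian_integration_by_parts)
        show "((\<lambda>x. G (V (\<omega>, x))) has_real_derivative G' (V (\<omega>, x))) (at x)" for x
          using deriv[of "z \<omega>" x] by (simp add: V_def)
        show "continuous_on UNIV (\<lambda>x. G' (V (\<omega>, x)))"
          using cont[of "z \<omega>"] by (simp add: V_def)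
      qed (use elim in simp_all)
    qed
  qed
  also have "\<dots> = (\<integral>p. G' (V p) \<partial>(M \<Otimes>\<^sub>M std_gaussian))"
    using P.integral_fst'[OF iG'] by simp
  also have "\<dots> = expectation (\<lambda>\<omega>. G' (?U \<omega>))" using tr(2)[OF mG'] by simp
  finally show ?thesis .
qed

end

section \<open>Hermite polynomials\<close>

primrec hermite_poly :: "nat \<Rightarrow> real poly" where
  "hermite_poly 0 = 1"
| "hermite_poly (Suc m) = [:0, 1:] * hermite_poly m - pderiv (hermite_poly m)"

lemma hermite_eq_poly: "hermite m x = poly (hermite_poly m) x"
proof -
  have "(deriv ^^ m) (\<lambda>y::real. exp (- y\<^sup>2 / 2)) = (\<lambda>y. (-1) ^ m * poly (hermite_poly m) y * exp (- y\<^sup>2 / 2))"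
  proof (induction m)
    case (Suc m)
    have "((\<lambda>y::real. (-1) ^ m * poly (hermite_poly m) y * exp (- y\<^sup>2 / 2)) has_real_derivative
      ((-1) ^ Suc m * poly (hermite_poly (Suc m)) x * exp (- x\<^sup>2 / 2))) (at x)" for x
      by (auto intro!: derivative_eq_intros poly_DERIV simp: algebra_simps)
    then have "deriv (\<lambda>y::real. (-1) ^ m * poly (hermite_poly m) y * exp (- y\<^sup>2 / 2)) =
      (\<lambda>x. (-1) ^ Suc m * poly (hermite_poly (Suc m)) x * exp (- x\<^sup>2 / 2))"
      by (intro ext DERIV_imp_deriv)
    then show ?case using Suc by simp
  qed simp
  then have "hermite m x = ((-1) ^ m * (-1) ^ m) * (exp (x\<^sup>2 / 2) * exp (- x\<^sup>2 / 2)) * poly (hermite_poly m) x"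
    by (simp add: hermite_def mult_ac)
  also have "\<dots> = poly (hermite_poly m) x"
    by (simp only: exp_add[symmetric] power_mult_distrib[symmetric]) simp
  finally show ?thesis .
qed

lemma pderiv_hermite_poly: "pderiv (hermite_poly m) = smult (real m) (hermite_poly (m - 1))"
proof (induction m)
  case (Suc m)
  show ?case
  proof (cases m)
    case 0
    then show ?thesis by (simp add: pderiv_pCons)
  next
    case (Suc m')
    have "pderiv (hermite_poly (Suc m)) = hermite_poly m + [:0, 1:] * pderiv (hermite_poly m) - pderiv (pderiv (hermite_poly m))"
      by (simp add: pderiv_diff pderiv_mult pderiv_pCons)
    also have "\<dots> = hermite_poly m + smult (real m) ([:0, 1:] * hermite_poly m' - pderiv (hermite_poly m'))"
      using Suc.IH Suc by (simp add: pderiv_smult smult_diff_right)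
    also have "\<dots> = hermite_poly m + smult (real m) (hermite_poly m)" using Suc by simp
    also have "\<dots> = smult (real (Suc m)) (hermite_poly m)"
      by (simp add: smult_add_left)
    finally show ?thesis by simp
  qed
qed simp

lemma has_real_derivative_hermite: "(hermite m has_real_derivative real m * hermite (m - 1) x) (at x)"
proof -
  have "hermite m = poly (hermite_poly m)" by (simp add: hermite_eq_poly fun_eq_iff)
  then show ?thesis using poly_DERIV[of "hermite_poly m" x] by (simp add: pderiv_hermite_poly hermite_eq_poly)
qed

lemma hermite_0 [simp]: "hermite 0 x = 1"
  by (simp add: hermite_eq_poly)

lemma hermite_Suc: "hermite (Suc m) x = x * hermite m x - real m * hermite (m - 1) x"
  by (simp add: hermite_eq_poly pderiv_hermite_poly)

lemma continuous_on_hermite [continuous_intros]: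
  "continuous_on A f \<Longrightarrow> continuous_on A (\<lambda>x. hermite m (f x))"
  by (simp add: hermite_eq_poly continuous_on_poly)

lemma hermite_measurable [measurable]: "hermite m \<in> borel_measurable borel"
  by (intro borel_measurable_continuous_onI continuous_on_hermite continuous_on_id)

context unit_gaussian_sequence
begin

text \<open>
  The derivative of \<open>H m (x k) * G x\<close> in the direction \<open>R k\<close> is \<open>m * H (m - 1) * G + H m * G'\<close>, as \<open>R k k = 1\<close>; its first term is
  what the recursion for \<open>H (m + 1)\<close> subtracts.
\<close>

lemma hermite_integration_by_parts:
  fixes G G' :: "(nat \<Rightarrow> real) \<Rightarrow> real"
  assumes k: "k \<in> {1..n}"
    and mG [measurable]: "G \<in> borel_measurable (\<Pi>\<^sub>M l\<in>{1..n}. borel)"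
    and mG' [measurable]: "G' \<in> borel_measurable (\<Pi>\<^sub>M l\<in>{1..n}. borel)"
    and deriv: "\<And>x t. ((\<lambda>t. G (\<lambda>l\<in>{1..n}. x l + t * R k l)) has_real_derivative G' (\<lambda>l\<in>{1..n}. x l + t * R k l)) (at t)"
    and cont: "\<And>x. continuous_on UNIV (\<lambda>t. G' (\<lambda>l\<in>{1..n}. x l + t * R k l))"
    and int_G: "\<And>q. integrable M (\<lambda>\<omega>. poly q (X k \<omega>) * G (\<lambda>l\<in>{1..n}. X l \<omega>))"
    and int_G': "\<And>q. integrable M (\<lambda>\<omega>. poly q (X k \<omega>) * G' (\<lambda>l\<in>{1..n}. X l \<omega>))"
  shows "expectation (\<lambda>\<omega>. hermite (Suc m) (X k \<omega>) * G (\<lambda>l\<in>{1..n}. X l \<omega>)) =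
    expectation (\<lambda>\<omega>. hermite m (X k \<omega>) * G' (\<lambda>l\<in>{1..n}. X l \<omega>))"
proof -
  let ?U = "\<lambda>\<omega>. \<lambda>l\<in>{1..n}. X l \<omega>"
  define F where "F = (\<lambda>x. hermite m (x k) * G x)"
  define F' where "F' = (\<lambda>x. (real m * hermite (m - 1) (x k)) * G x + hermite m (x k) * G' x)"
  have Uk: "?U \<omega> k = X k \<omega>" for \<omega> using k by auto
  have mk [measurable]: "(\<lambda>x. x k) \<in> borel_measurable (\<Pi>\<^sub>M l\<in>{1..n}. borel)"
    using k by (intro measurable_component_singleton)
  have iF: "integrable M (\<lambda>\<omega>. X k \<omega> * F (?U \<omega>))"
    using int_G[of "[:0,1:] * hermite_poly m"] by (simp only: F_def Uk) (simp add: hermite_eq_poly mult.assoc)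
  have i1: "integrable M (\<lambda>\<omega>. (real m * hermite (m - 1) (X k \<omega>)) * G (?U \<omega>))"
    using int_G[of "smult (real m) (hermite_poly (m - 1))"] by (simp add: hermite_eq_poly)
  have i2: "integrable M (\<lambda>\<omega>. hermite m (X k \<omega>) * G' (?U \<omega>))"
    using int_G'[of "hermite_poly m"] by (simp add: hermite_eq_poly)
  have "expectation (\<lambda>\<omega>. X k \<omega> * F (?U \<omega>)) = expectation (\<lambda>\<omega>. F' (?U \<omega>))"
  proof (rule gaussian_integration_by_parts[OF k])
    show "F \<in> borel_measurable (\<Pi>\<^sub>M l\<in>{1..n}. borel)" "F' \<in> borel_measurable (\<Pi>\<^sub>M l\<in>{1..n}. borel)"
      unfolding F_def F'_def by measurable
    have at_k: "(\<lambda>l\<in>{1..n}. x l + t * R k l) k = x k + t" for x :: "nat \<Rightarrow> real" and t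
      using k by (auto simp: R_diag)
    show "((\<lambda>t. F (\<lambda>l\<in>{1..n}. x l + t * R k l)) has_real_derivative F' (\<lambda>l\<in>{1..n}. x l + t * R k l)) (at t)" for x t
    proof -
      have "((\<lambda>t. hermite m (x k + t)) has_real_derivative (real m * hermite (m - 1) (x k + t)) * (0 + 1)) (at t)"
        by (rule DERIV_chain2[OF has_real_derivative_hermite]) (intro derivative_intros)
      from DERIV_mult[OF this deriv[of x t]]
      show ?thesis unfolding F_def F'_def at_k by (simp add: mult_ac)
    qed
    show "continuous_on UNIV (\<lambda>t. F' (\<lambda>l\<in>{1..n}. x l + t * R k l))" for x
      unfolding F'_def at_k
      by (intro continuous_intros cont continuous_at_imp_continuous_on ballI DERIV_isCont[OF deriv])
    show "integrable M (\<lambda>\<omega>. F' (?U \<omega>))"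
      unfolding F'_def Uk using i1 i2 by (rule Bochner_Integration.integrable_add)
  qed (rule iF)
  also have "\<dots> = expectation (\<lambda>\<omega>. (real m * hermite (m - 1) (X k \<omega>)) * G (?U \<omega>)) + expectation (\<lambda>\<omega>. hermite m (X k \<omega>) * G' (?U \<omega>))"
    unfolding F'_def Uk by (rule Bochner_Integration.integral_add[OF i1 i2])
  finally have eq: "expectation (\<lambda>\<omega>. X k \<omega> * F (?U \<omega>)) - expectation (\<lambda>\<omega>. (real m * hermite (m - 1) (X k \<omega>)) * G (?U \<omega>)) =
     expectation (\<lambda>\<omega>. hermite m (X k \<omega>) * G' (?U \<omega>))" by simp
  have "expectation (\<lambda>\<omega>. hermite (Suc m) (X k \<omega>) * G (?U \<omega>)) =
     expectation (\<lambda>\<omega>. X k \<omega> * F (?U \<omega>) - (real m * hermite (m - 1) (X k \<omega>)) * G (?U \<omega>))"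
    unfolding hermite_Suc F_def Uk by (simp only: left_diff_distrib mult.assoc)
  also have "\<dots> = expectation (\<lambda>\<omega>. hermite m (X k \<omega>) * G' (?U \<omega>))"
    unfolding Bochner_Integration.integral_diff[OF iF i1] by (rule eq)
  finally show ?thesis .
qed

definition hermite_moment :: "nat \<Rightarrow> nat \<Rightarrow> nat \<Rightarrow> nat \<Rightarrow> nat \<Rightarrow> nat \<Rightarrow> nat \<Rightarrow> nat \<Rightarrow> real" where
  "hermite_moment p q r s i j k l =
     expectation (\<lambda>\<omega>. hermite p (X i \<omega>) * hermite q (X j \<omega>) * hermite r (X k \<omega>) * hermite s (X l \<omega>))"

lemma integrable_hermite4:
  "1 \<le> i \<Longrightarrow> 1 \<le> j \<Longrightarrow> 1 \<le> k \<Longrightarrow> 1 \<le> l \<Longrightarrow>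
   integrable M (\<lambda>\<omega>. hermite p (X i \<omega>) * hermite q (X j \<omega>) * hermite r (X k \<omega>) * hermite s (X l \<omega>))"
  unfolding hermite_eq_poly by (rule integrable_poly_X4)

lemma integrable_hermite2:
  "1 \<le> i \<Longrightarrow> 1 \<le> j \<Longrightarrow> integrable M (\<lambda>\<omega>. hermite p (X i \<omega>) * hermite q (X j \<omega>))"
  unfolding hermite_eq_poly by (rule integrable_poly_X2)

text \<open>
  One vertex of degree \<open>p + 1\<close> is joined to one of the other three vertices; iterating this generates
  the diagram formula.
\<close>

lemma hermite_moment_Suc:
  assumes ij: "1 \<le> i" "1 \<le> j" "1 \<le> k" "1 \<le> l"
  shows "hermite_moment (Suc p) q r s i j k l =
     R i j * (real q * hermite_moment p (q - 1) r s i j k l) +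
     R i k * (real r * hermite_moment p q (r - 1) s i j k l) +
     R i l * (real s * hermite_moment p q r (s - 1) i j k l)"
proof -
  define n where "n = i + j + k + l"
  have I: "i \<in> {1..n}" "j \<in> {1..n}" "k \<in> {1..n}" "l \<in> {1..n}" using ij by (auto simp: n_def)
  define G where "G = (\<lambda>x::nat \<Rightarrow> real. hermite q (x j) * hermite r (x k) * hermite s (x l))"
  define G' where "G' = (\<lambda>x::nat \<Rightarrow> real.
     R i j * (real q * (hermite (q - 1) (x j) * hermite r (x k) * hermite s (x l))) +
     R i k * (real r * (hermite q (x j) * hermite (r - 1) (x k) * hermite s (x l))) +
     R i l * (real s * (hermite q (x j) * hermite r (x k) * hermite (s - 1) (x l))))"
  have mc [measurable]: "(\<lambda>x. x a) \<in> borel_measurable (\<Pi>\<^sub>M l\<in>{1..n}. borel)" if "a \<in> {1..n}" for a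
    using that by (intro measurable_component_singleton)
  note [measurable] = mc[OF I(1)] mc[OF I(2)] mc[OF I(3)] mc[OF I(4)]
  have U: "(\<lambda>l\<in>{1..n}. X l \<omega>) a = X a \<omega>" if "a \<in> {1..n}" for a \<omega> using that by auto
  have V: "(\<lambda>l\<in>{1..n}. x l + t * R i l) a = x a + t * R i a" if "a \<in> {1..n}" for a t and x :: "nat \<Rightarrow> real" using that by auto
  note UU = U[OF I(2)] U[OF I(3)] U[OF I(4)]
  note VV = V[OF I(2)] V[OF I(3)] V[OF I(4)]
  have int4: "integrable M (\<lambda>\<omega>. hermite p' (X i \<omega>) * (hermite q' (X j \<omega>) * hermite r' (X k \<omega>) * hermite s' (X l \<omega>)))" for p' q' r' s'
    using integrable_hermite4[OF ij, of p' q' r' s'] by (simp add: mult.assoc)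
  have int4q: "integrable M (\<lambda>\<omega>. poly f (X i \<omega>) * (hermite q' (X j \<omega>) * hermite r' (X k \<omega>) * hermite s' (X l \<omega>)))" for f q' r' s'
    using integrable_poly_X4[OF ij, of f "hermite_poly q'" "hermite_poly r'" "hermite_poly s'"] by (simp add: mult.assoc hermite_eq_poly)
  have "expectation (\<lambda>\<omega>. hermite (Suc p) (X i \<omega>) * G (\<lambda>l\<in>{1..n}. X l \<omega>)) =
      expectation (\<lambda>\<omega>. hermite p (X i \<omega>) * G' (\<lambda>l\<in>{1..n}. X l \<omega>))"
  proof (rule hermite_integration_by_parts[OF I(1)])
    show "G \<in> borel_measurable (\<Pi>\<^sub>M l\<in>{1..n}. borel)" "G' \<in> borel_measurable (\<Pi>\<^sub>M l\<in>{1..n}. borel)"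
      unfolding G_def G'_def by measurable
    have dh: "((\<lambda>t. hermite m (c + t * b)) has_real_derivative (real m * hermite (m - 1) (c + t * b)) * (0 + 1 * b)) (at t)" for m c b t
      by (rule DERIV_chain2[OF has_real_derivative_hermite DERIV_add[OF DERIV_const DERIV_cmult_right[OF DERIV_ident]]])
    show "((\<lambda>t. G (\<lambda>l\<in>{1..n}. x l + t * R i l)) has_real_derivative G' (\<lambda>l\<in>{1..n}. x l + t * R i l)) (at t)" for x t
      unfolding G_def G'_def VV
      by (rule DERIV_cong[OF DERIV_mult[OF DERIV_mult[OF dh dh] dh]]) (simp add: algebra_simps)
    show "continuous_on UNIV (\<lambda>t. G' (\<lambda>l\<in>{1..n}. x l + t * R i l))" for x
      unfolding G'_def VV by (intro continuous_intros)
    show "integrable M (\<lambda>\<omega>. poly f (X i \<omega>) * G (\<lambda>l\<in>{1..n}. X l \<omega>))" for f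
      unfolding G_def UU by (rule int4q)
    show "integrable M (\<lambda>\<omega>. poly f (X i \<omega>) * G' (\<lambda>l\<in>{1..n}. X l \<omega>))" for f
      unfolding G'_def UU distrib_left mult.left_commute[of "poly f _" "R _ _"] mult.left_commute[of "poly f _" "real _"]
      by (intro Bochner_Integration.integrable_add integrable_mult_right int4q)
  qed
  also have "\<dots> = R i j * (real q * hermite_moment p (q - 1) r s i j k l) +
     R i k * (real r * hermite_moment p q (r - 1) s i j k l) +
     R i l * (real s * hermite_moment p q r (s - 1) i j k l)"
    unfolding G'_def UU distrib_left mult.left_commute[of "hermite p _" "R _ _"] mult.left_commute[of "hermite p _" "real _"]
    by (subst Bochner_Integration.integral_add, (intro Bochner_Integration.integrable_add integrable_mult_right int4)+)+
       (simp add: hermite_moment_def mult.assoc)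
  finally show ?thesis unfolding G_def UU hermite_moment_def by (simp add: mult.assoc)
qed

lemma hermite_moment_0 [simp]: "hermite_moment 0 0 0 0 i j k l = 1"
  by (simp add: hermite_moment_def prob_space)

lemma hermite_moment_perm:
  "hermite_moment p q r s i j k l = hermite_moment q p r s j i k l"
  "hermite_moment p q r s i j k l = hermite_moment r q p s k j i l"
  "hermite_moment p q r s i j k l = hermite_moment s q r p l j k i"
  by (simp_all add: hermite_moment_def mult_ac)

lemma hermite_orthogonality:
  assumes ij: "1 \<le> i" "1 \<le> j"
  shows "expectation (\<lambda>\<omega>. hermite p (X i \<omega>) * hermite q (X j \<omega>)) = (if p = q then fact p * R i j ^ p else 0)"
proof -
  have "hermite_moment p q 0 0 i j i j = (if p = q then fact p * R i j ^ p else 0)"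
  proof (induction p arbitrary: q)
    case 0
    show ?case
    proof (cases q)
      case (Suc q')
      then show ?thesis
        using hermite_moment_Suc[OF ij(2,1) ij, of q' 0 0 0] hermite_moment_perm(1)[of 0 q 0 0 i j i j] by simp
    qed simp
  next
    case (Suc p)
    show ?case
      using hermite_moment_Suc[OF ij ij, of p q 0 0] by (cases q) (auto simp: Suc.IH)
  qed
  then show ?thesis by (simp add: hermite_moment_def)
qed

text \<open>
  The previous formula for a function of the sum of all coordinates, which Stein's method
  requires; the derivative in the direction \<open>R k\<close> comes from the chain rule.
\<close>

lemma hermite_stein_identity:
  assumes k: "k \<in> {1..n}"
    and deriv: "\<And>x. (\<phi> has_real_derivative \<phi>' x) (at x)" and cont: "continuous_on UNIV \<phi>'"
    and bd': "\<And>x. \<bar>\<phi>' x\<bar> \<le> C" and bd: "bounded (range \<phi>)"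
  shows "expectation (\<lambda>\<omega>. hermite (Suc m) (X k \<omega>) * \<phi> (\<Sum>l=1..n. poly g (X l \<omega>))) =
    expectation (\<lambda>\<omega>. hermite m (X k \<omega>) * (\<phi>' (\<Sum>l=1..n. poly g (X l \<omega>)) * (\<Sum>l=1..n. R k l * poly (pderiv g) (X l \<omega>))))"
proof -
  define G where "G = (\<lambda>x::nat \<Rightarrow> real. \<phi> (\<Sum>l=1..n. poly g (x l)))"
  define G' where "G' = (\<lambda>x::nat \<Rightarrow> real. \<phi>' (\<Sum>l=1..n. poly g (x l)) * (\<Sum>l=1..n. R k l * poly (pderiv g) (x l)))"
  obtain B where B: "\<And>x. \<bar>\<phi> x\<bar> \<le> B" using bd by (auto simp: bounded_real)
  have cphi: "continuous_on UNIV \<phi>" using deriv by (meson DERIV_isCont continuous_at_imp_continuous_on)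
  have [measurable]: "\<phi> \<in> borel_measurable borel" "\<phi>' \<in> borel_measurable borel"
    using cphi cont by (auto intro: borel_measurable_continuous_onI)
  have mX: "X l \<in> borel_measurable M" if "l \<in> {1..n}" for l using that rv_X by auto
  note [measurable] = mX[OF k]
  have mc: "(\<lambda>x. x a) \<in> borel_measurable (\<Pi>\<^sub>M l\<in>{1..n}. borel)" if "a \<in> {1..n}" for a
    using that by (intro measurable_component_singleton)
  have msum: "(\<lambda>x. \<Sum>l=1..n. poly f (x l)) \<in> borel_measurable (\<Pi>\<^sub>M l\<in>{1..n}. borel)"
       "(\<lambda>x. \<Sum>l=1..n. R k l * poly f (x l)) \<in> borel_measurable (\<Pi>\<^sub>M l\<in>{1..n}. borel)" for f
    by (intro borel_measurable_sum borel_measurable_times measurable_const measurable_compose[OF mc poly_measurable]; simp)+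
  have msum' [measurable]: "(\<lambda>\<omega>. \<Sum>l=1..n. poly f (X l \<omega>)) \<in> borel_measurable M"
       "(\<lambda>\<omega>. \<Sum>l=1..n. R k l * poly f (X l \<omega>)) \<in> borel_measurable M" for f
    by (intro borel_measurable_sum borel_measurable_times measurable_const measurable_compose[OF mX poly_measurable]; simp)+
  have mG: "G \<in> borel_measurable (\<Pi>\<^sub>M l\<in>{1..n}. borel)"
    unfolding G_def by (rule measurable_compose[OF msum(1)]) measurable
  have mG': "G' \<in> borel_measurable (\<Pi>\<^sub>M l\<in>{1..n}. borel)"
    unfolding G'_def by (intro borel_measurable_times msum measurable_compose[OF msum(1)]) measurable
  have U: "G (\<lambda>l\<in>{1..n}. y l) = G y" "G' (\<lambda>l\<in>{1..n}. y l) = G' y" for y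
  proof -
    have e: "(\<Sum>l=1..n. F l ((\<lambda>l\<in>{1..n}. y l) l)) = (\<Sum>l=1..n. F l (y l))" for F :: "nat \<Rightarrow> real \<Rightarrow> real"
      by (rule sum.cong) auto
    show "G (\<lambda>l\<in>{1..n}. y l) = G y" "G' (\<lambda>l\<in>{1..n}. y l) = G' y"
      unfolding G_def G'_def e[of "\<lambda>_. poly g"] e[of "\<lambda>l v. R k l * poly (pderiv g) v"] by (rule refl)+
  qed
  have "expectation (\<lambda>\<omega>. hermite (Suc m) (X k \<omega>) * G (\<lambda>l\<in>{1..n}. X l \<omega>)) =
      expectation (\<lambda>\<omega>. hermite m (X k \<omega>) * G' (\<lambda>l\<in>{1..n}. X l \<omega>))"
  proof (rule hermite_integration_by_parts[OF k mG mG'])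
    show "((\<lambda>t. G (\<lambda>l\<in>{1..n}. x l + t * R k l)) has_real_derivative G' (\<lambda>l\<in>{1..n}. x l + t * R k l)) (at t)" for x t
    proof -
      have dp: "((\<lambda>t. poly g (x l + t * R k l)) has_real_derivative (R k l * poly (pderiv g) (x l + t * R k l))) (at t)" for l
        by (rule DERIV_cong[OF DERIV_chain2[OF poly_DERIV]]) (auto intro!: derivative_eq_intros)
      have "((\<lambda>t. \<Sum>l=1..n. poly g (x l + t * R k l)) has_real_derivative (\<Sum>l=1..n. R k l * poly (pderiv g) (x l + t * R k l))) (at t)"
        by (rule DERIV_sum) (rule dp)
      from DERIV_chain2[OF deriv this] show ?thesis unfolding U unfolding G_def G'_def .
    qed
    show "continuous_on UNIV (\<lambda>t. G' (\<lambda>l\<in>{1..n}. x l + t * R k l))" for x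
      unfolding U unfolding G'_def
      by (intro continuous_intros continuous_on_compose2[OF cont]) auto
    show "integrable M (\<lambda>\<omega>. poly q (X k \<omega>) * G (\<lambda>l\<in>{1..n}. X l \<omega>))" for q
    proof (rule Bochner_Integration.integrable_bound)
      show "integrable M (\<lambda>\<omega>. B * poly q (X k \<omega>))" using k by (intro integrable_mult_right integrable_poly_X) auto
      show "(\<lambda>\<omega>. poly q (X k \<omega>) * G (\<lambda>l\<in>{1..n}. X l \<omega>)) \<in> borel_measurable M"
        unfolding U unfolding G_def by measurable
      show "AE \<omega> in M. norm (poly q (X k \<omega>) * G (\<lambda>l\<in>{1..n}. X l \<omega>)) \<le> norm (B * poly q (X k \<omega>))"
      proof (rule AE_I2)
        fix \<omega>
        have "\<bar>G x\<bar> \<le> \<bar>B\<bar>" for x using order_trans[OF B abs_ge_self] by (simp add: G_def)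
        then show "norm (poly q (X k \<omega>) * G (\<lambda>l\<in>{1..n}. X l \<omega>)) \<le> norm (B * poly q (X k \<omega>))"
          by (simp add: abs_mult mult.commute[of "\<bar>B\<bar>"] mult_left_mono)
      qed
    qed
    show "integrable M (\<lambda>\<omega>. poly q (X k \<omega>) * G' (\<lambda>l\<in>{1..n}. X l \<omega>))" for q
    proof (rule Bochner_Integration.integrable_bound)
      show "integrable M (\<lambda>\<omega>. C * (\<Sum>l=1..n. R k l * (poly q (X k \<omega>) * poly (pderiv g) (X l \<omega>))))"
        using k by (intro integrable_mult_right Bochner_Integration.integrable_sum integrable_poly_X2) auto
      show "(\<lambda>\<omega>. poly q (X k \<omega>) * G' (\<lambda>l\<in>{1..n}. X l \<omega>)) \<in> borel_measurable M"
        unfolding U unfolding G'_def by measurable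
      show "AE \<omega> in M. norm (poly q (X k \<omega>) * G' (\<lambda>l\<in>{1..n}. X l \<omega>)) \<le>
          norm (C * (\<Sum>l=1..n. R k l * (poly q (X k \<omega>) * poly (pderiv g) (X l \<omega>))))"
      proof (rule AE_I2)
        fix \<omega>
        let ?S = "\<Sum>l=1..n. R k l * poly (pderiv g) (X l \<omega>)"
        have C: "\<bar>\<phi>' x\<bar> \<le> \<bar>C\<bar>" for x using order_trans[OF bd' abs_ge_self] .
        have "norm (poly q (X k \<omega>) * G' (\<lambda>l\<in>{1..n}. X l \<omega>)) = \<bar>\<phi>' (\<Sum>l=1..n. poly g (X l \<omega>))\<bar> * \<bar>poly q (X k \<omega>) * ?S\<bar>"
          unfolding U unfolding G'_def by (simp add: abs_mult)
        also have "\<dots> \<le> \<bar>C\<bar> * \<bar>poly q (X k \<omega>) * ?S\<bar>" by (rule mult_right_mono[OF C]) simp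
        also have "\<dots> = norm (C * (\<Sum>l=1..n. R k l * (poly q (X k \<omega>) * poly (pderiv g) (X l \<omega>))))"
          by (simp add: abs_mult sum_distrib_left mult_ac flip: abs_mult)
        finally show "norm (poly q (X k \<omega>) * G' (\<lambda>l\<in>{1..n}. X l \<omega>)) \<le>
          norm (C * (\<Sum>l=1..n. R k l * (poly q (X k \<omega>) * poly (pderiv g) (X l \<omega>))))" .
      qed
    qed
  qed
  then show ?thesis unfolding U unfolding G_def G'_def .
qed

end

section \<open>Diagram bounds for products of four Hermite polynomials\<close>

context unit_gaussian_sequence
begin

text \<open>
  The exponents \<open>a\<close>, ..., \<open>f\<close> are the multiplicities of the edges \<open>ij\<close>, \<open>ik\<close>, \<open>il\<close>, \<open>jk\<close>, \<open>jl\<close>, \<open>kl\<close> of a multigraph without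
  loops on the four indices, in which \<open>i\<close>, \<open>j\<close>, \<open>k\<close>, \<open>l\<close> have degrees \<open>p\<close>, \<open>q\<close>, \<open>r\<close>, \<open>s\<close>, and \<open>h\<close> is a lower bound for
  the number of edges between \<open>{i, j}\<close> and \<open>{k, l}\<close>; only \<open>h = 0\<close> and \<open>h = 1\<close> occur.
\<close>

definition diagrams_le :: "nat \<Rightarrow> real \<Rightarrow> real \<Rightarrow> nat \<Rightarrow> nat \<Rightarrow> nat \<Rightarrow> nat \<Rightarrow> nat \<Rightarrow> nat \<Rightarrow> nat \<Rightarrow> nat \<Rightarrow> bool" where
  "diagrams_le h w B p q r s i j k l \<longleftrightarrow>
     (\<forall>a b c d e f. a + b + c = p \<longrightarrow> a + d + e = q \<longrightarrow> b + d + f = r \<longrightarrow> c + e + f = s \<longrightarrow> h \<le> b + c + d + e \<longrightarrow>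
       w * (\<bar>R i j\<bar> ^ a * \<bar>R i k\<bar> ^ b * \<bar>R i l\<bar> ^ c * \<bar>R j k\<bar> ^ d * \<bar>R j l\<bar> ^ e * \<bar>R k l\<bar> ^ f) \<le> B)"

lemma diagrams_leI:
  assumes "\<And>a b c d e f. a + b + c = p \<Longrightarrow> a + d + e = q \<Longrightarrow> b + d + f = r \<Longrightarrow> c + e + f = s \<Longrightarrow> h \<le> b + c + d + e \<Longrightarrow>
       w * (\<bar>R i j\<bar> ^ a * \<bar>R i k\<bar> ^ b * \<bar>R i l\<bar> ^ c * \<bar>R j k\<bar> ^ d * \<bar>R j l\<bar> ^ e * \<bar>R k l\<bar> ^ f) \<le> B"
  shows "diagrams_le h w B p q r s i j k l"
  using assms unfolding diagrams_le_def by blast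

lemma diagrams_leD:
  assumes "diagrams_le h w B p q r s i j k l"
    and "a + b + c = p" "a + d + e = q" "b + d + f = r" "c + e + f = s" "h \<le> b + c + d + e"
  shows "w * (\<bar>R i j\<bar> ^ a * \<bar>R i k\<bar> ^ b * \<bar>R i l\<bar> ^ c * \<bar>R j k\<bar> ^ d * \<bar>R j l\<bar> ^ e * \<bar>R k l\<bar> ^ f) \<le> B"
  using assms unfolding diagrams_le_def by blast

lemma diagrams_le_perm:
  assumes D: "diagrams_le 0 w B p q r s i j k l"
  shows "diagrams_le 0 w B q p r s j i k l" "diagrams_le 0 w B r q p s k j i l" "diagrams_le 0 w B s q r p l j k i"
proof -
  have com: "R j i = R i j" "R k i = R i k" "R l i = R i l" "R k j = R j k" "R l j = R j l" "R l k = R k l"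
    by (rule R_commute)+
  show "diagrams_le 0 w B q p r s j i k l"
  proof (rule diagrams_leI, goal_cases)
    case (1 a b c d e f)
    then show ?case using diagrams_leD[OF D, of a d e b c f] by (simp add: com mult_ac add_ac)
  qed
  show "diagrams_le 0 w B r q p s k j i l"
  proof (rule diagrams_leI, goal_cases)
    case (1 a b c d e f)
    then show ?case using diagrams_leD[OF D, of d b f a e c] by (simp add: com mult_ac add_ac)
  qed
  show "diagrams_le 0 w B s q r p l j k i"
  proof (rule diagrams_leI, goal_cases)
    case (1 a b c d e f)
    then show ?case using diagrams_leD[OF D, of e f c d a b] by (simp add: com mult_ac add_ac)
  qed
qed

lemma diagrams_le_edge:
  shows "diagrams_le h w B (Suc p) (Suc q) r s i j k l \<Longrightarrow> diagrams_le h (w * \<bar>R i j\<bar>) B p q r s i j k l"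
    and "h \<le> 1 \<Longrightarrow> diagrams_le h w B (Suc p) q (Suc r) s i j k l \<Longrightarrow> diagrams_le 0 (w * \<bar>R i k\<bar>) B p q r s i j k l"
    and "h \<le> 1 \<Longrightarrow> diagrams_le h w B (Suc p) q r (Suc s) i j k l \<Longrightarrow> diagrams_le 0 (w * \<bar>R i l\<bar>) B p q r s i j k l"
proof -
  assume D: "diagrams_le h w B (Suc p) (Suc q) r s i j k l"
  show "diagrams_le h (w * \<bar>R i j\<bar>) B p q r s i j k l"
  proof (rule diagrams_leI, goal_cases)
    case (1 a b c d e f)
    then show ?case using diagrams_leD[OF D, of "Suc a" b c d e f] by (simp add: mult_ac)
  qed
next
  assume h: "h \<le> 1" and D: "diagrams_le h w B (Suc p) q (Suc r) s i j k l"
  show "diagrams_le 0 (w * \<bar>R i k\<bar>) B p q r s i j k l"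
  proof (rule diagrams_leI, goal_cases)
    case (1 a b c d e f)
    then show ?case using diagrams_leD[OF D, of a "Suc b" c d e f] h by (simp add: mult_ac)
  qed
next
  assume h: "h \<le> 1" and D: "diagrams_le h w B (Suc p) q r (Suc s) i j k l"
  show "diagrams_le 0 (w * \<bar>R i l\<bar>) B p q r s i j k l"
  proof (rule diagrams_leI, goal_cases)
    case (1 a b c d e f)
    then show ?case using diagrams_leD[OF D, of a b "Suc c" d e f] h by (simp add: mult_ac)
  qed
qed

lemma three_edges_bound:
  fixes x y z :: real
  assumes "w * \<bar>x\<bar> \<le> F * B" "w * \<bar>y\<bar> \<le> F * B" "w * \<bar>z\<bar> \<le> F * B"
    and "0 \<le> w" "0 \<le> B" "0 \<le> F" "F * real (q + r + s) \<le> F'"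
  shows "w * \<bar>real q * x + real r * y + real s * z\<bar> \<le> F' * B"
proof -
  have "w * \<bar>real q * x + real r * y + real s * z\<bar> \<le> w * (real q * \<bar>x\<bar> + real r * \<bar>y\<bar> + real s * \<bar>z\<bar>)"
    using assms by (intro mult_left_mono order_trans[OF abs_triangle_ineq] add_mono) (auto simp: abs_mult)
  also have "\<dots> = real q * (w * \<bar>x\<bar>) + real r * (w * \<bar>y\<bar>) + real s * (w * \<bar>z\<bar>)"
    by (simp add: algebra_simps)
  also have "\<dots> \<le> real q * (F * B) + real r * (F * B) + real s * (F * B)"
    using assms by (intro add_mono mult_left_mono) auto
  also have "\<dots> = (F * real (q + r + s)) * B" by (simp add: algebra_simps)
  also have "\<dots> \<le> F' * B" using assms by (intro mult_right_mono)
  finally show ?thesis .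
qed

lemma fact_edge_bound: "(fact (p + q + r + s - 1) :: real) * real (q + r + s) \<le> fact (Suc p + q + r + s)"
proof -
  have "(fact (p + q + r + s - 1) :: real) * real (q + r + s) \<le> fact (p + q + r + s) * real (Suc p + q + r + s)"
    by (intro mult_mono fact_mono) auto
  also have "\<dots> = fact (Suc p + q + r + s)" by (simp add: algebra_simps)
  finally show ?thesis .
qed

text \<open>
  The diagram formula as an inequality: a bound valid for each diagram bounds the moment, up to a
  factorial that exceeds the number of diagrams counted with multiplicity. The weight \<open>w\<close>
  collects the edges already drawn in the recursion, and stating the bound for arbitrary \<open>w\<close> is what makes the induction work without summing over
  diagrams.
\<close>

lemma hermite_moment_bound:
  assumes "1 \<le> i" "1 \<le> j" "1 \<le> k" "1 \<le> l" "0 \<le> w" "0 \<le> B"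
    and "diagrams_le 0 w B p q r s i j k l"
  shows "w * \<bar>hermite_moment p q r s i j k l\<bar> \<le> fact (p + q + r + s) * B"
  using assms
proof (induction "p + q + r + s" arbitrary: p q r s i j k l w rule: less_induct)
  case less
  define N where "N = p + q + r + s"
  have step: "w * \<bar>hermite_moment (Suc p') q r s i j k l\<bar> \<le> fact (Suc p' + q + r + s) * B"
    if N: "Suc p' + q + r + s = N" and ij: "1 \<le> i" "1 \<le> j" "1 \<le> k" "1 \<le> l"
      and D: "diagrams_le 0 w B (Suc p') q r s i j k l"
      and IH: "\<And>p q r s i j k l w. p + q + r + s < N \<Longrightarrow> 1 \<le> i \<Longrightarrow> 1 \<le> j \<Longrightarrow> 1 \<le> k \<Longrightarrow> 1 \<le> l \<Longrightarrow> 0 \<le> w \<Longrightarrow>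
        diagrams_le 0 w B p q r s i j k l \<Longrightarrow> w * \<bar>hermite_moment p q r s i j k l\<bar> \<le> fact (p + q + r + s) * B"
    for p' q r s i j k l
  proof -
    let ?F = "fact (p' + q + r + s - 1) :: real"
    have eq: "hermite_moment (Suc p') q r s i j k l =
        real q * (R i j * hermite_moment p' (q - 1) r s i j k l) +
        real r * (R i k * hermite_moment p' q (r - 1) s i j k l) +
        real s * (R i l * hermite_moment p' q r (s - 1) i j k l)"
      unfolding hermite_moment_Suc[OF ij] by (simp add: mult_ac)
    define x where "x = (if q = 0 then 0 else R i j * hermite_moment p' (q - 1) r s i j k l)"
    define y where "y = (if r = 0 then 0 else R i k * hermite_moment p' q (r - 1) s i j k l)"
    define z where "z = (if s = 0 then 0 else R i l * hermite_moment p' q r (s - 1) i j k l)"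
    have "w * \<bar>x\<bar> \<le> ?F * B"
    proof (cases q)
      case (Suc q')
      have "(w * \<bar>R i j\<bar>) * \<bar>hermite_moment p' q' r s i j k l\<bar> \<le> fact (p' + q' + r + s) * B"
        using N Suc D \<open>0 \<le> w\<close> by (intro IH ij diagrams_le_edge(1)) auto
      then show ?thesis using Suc by (simp add: x_def abs_mult mult.assoc)
    qed (use \<open>0 \<le> B\<close> in \<open>simp add: x_def\<close>)
    moreover have "w * \<bar>y\<bar> \<le> ?F * B"
    proof (cases r)
      case (Suc r')
      have "(w * \<bar>R i k\<bar>) * \<bar>hermite_moment p' q r' s i j k l\<bar> \<le> fact (p' + q + r' + s) * B"
        using N Suc D \<open>0 \<le> w\<close> by (intro IH ij diagrams_le_edge(2)[of 0]) auto
      then show ?thesis using Suc by (simp add: y_def abs_mult mult.assoc)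
    qed (use \<open>0 \<le> B\<close> in \<open>simp add: y_def\<close>)
    moreover have "w * \<bar>z\<bar> \<le> ?F * B"
    proof (cases s)
      case (Suc s')
      have "(w * \<bar>R i l\<bar>) * \<bar>hermite_moment p' q r s' i j k l\<bar> \<le> fact (p' + q + r + s') * B"
        using N Suc D \<open>0 \<le> w\<close> by (intro IH ij diagrams_le_edge(3)[of 0]) auto
      then show ?thesis using Suc by (simp add: z_def abs_mult mult.assoc)
    qed (use \<open>0 \<le> B\<close> in \<open>simp add: z_def\<close>)
    ultimately have "w * \<bar>real q * x + real r * y + real s * z\<bar> \<le> fact (Suc p' + q + r + s) * B"
      using \<open>0 \<le> w\<close> \<open>0 \<le> B\<close> by (intro three_edges_bound[where F="?F"] fact_edge_bound) auto
    moreover have "real q * x + real r * y + real s * z = hermite_moment (Suc p') q r s i j k l"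
      unfolding eq x_def y_def z_def by simp
    ultimately show ?thesis by simp
  qed
  note perm = diagrams_le_perm[OF \<open>diagrams_le 0 w B p q r s i j k l\<close>]
  have IH: "p' + q' + r' + s' < p + q + r + s \<Longrightarrow> 1 \<le> i \<Longrightarrow> 1 \<le> j \<Longrightarrow> 1 \<le> k \<Longrightarrow> 1 \<le> l \<Longrightarrow> 0 \<le> w \<Longrightarrow>
        diagrams_le 0 w B p' q' r' s' i j k l \<Longrightarrow> w * \<bar>hermite_moment p' q' r' s' i j k l\<bar> \<le> fact (p' + q' + r' + s') * B"
    for p' q' r' s' i j k l w
    using less.hyps[of p' q' r' s'] \<open>0 \<le> B\<close> by blast
  consider (p) p' where "p = Suc p'" | (q) q' where "q = Suc q'" | (r) r' where "r = Suc r'" | (s) s' where "s = Suc s'"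
    | (none) "p = 0" "q = 0" "r = 0" "s = 0"
    by (metis not0_implies_Suc)
  then show ?case
  proof cases
    case p
    then show ?thesis unfolding p by (intro step) (use p less.prems IH N_def in auto)
  next
    case q
    have "w * \<bar>hermite_moment (Suc q') p r s j i k l\<bar> \<le> fact (Suc q' + p + r + s) * B"
      by (rule step) (use q less.prems perm(1) IH N_def in auto)
    then show ?thesis unfolding hermite_moment_perm(1)[of p] q by (simp add: add_ac)
  next
    case r
    have "w * \<bar>hermite_moment (Suc r') q p s k j i l\<bar> \<le> fact (Suc r' + q + p + s) * B"
      by (rule step) (use r less.prems perm(2) IH N_def in auto)
    then show ?thesis unfolding hermite_moment_perm(2)[of p] r by (simp add: add_ac)
  next
    case s
    have "w * \<bar>hermite_moment (Suc s') q r p l j k i\<bar> \<le> fact (Suc s' + q + r + p) * B"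
      by (rule step) (use s less.prems perm(3) IH N_def in auto)
    then show ?thesis unfolding hermite_moment_perm(3)[of p] s by (simp add: add_ac)
  next
    case none
    then show ?thesis using diagrams_leD[OF less.prems(7), of 0 0 0 0 0 0] by simp
  qed
qed

definition hermite_cov :: "nat \<Rightarrow> nat \<Rightarrow> nat \<Rightarrow> nat \<Rightarrow> nat \<Rightarrow> nat \<Rightarrow> nat \<Rightarrow> nat \<Rightarrow> real" where
  "hermite_cov p q r s i j k l =
     expectation (\<lambda>\<omega>. (hermite p (X i \<omega>) * hermite q (X j \<omega>)) * (hermite r (X k \<omega>) * hermite s (X l \<omega>))) -
     expectation (\<lambda>\<omega>. hermite p (X i \<omega>) * hermite q (X j \<omega>)) * expectation (\<lambda>\<omega>. hermite r (X k \<omega>) * hermite s (X l \<omega>))"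

lemma hermite_cov_eq_moment:
  "hermite_cov p q r s i j k l = hermite_moment p q r s i j k l -
     hermite_moment p q 0 0 i j k l * expectation (\<lambda>\<omega>. hermite r (X k \<omega>) * hermite s (X l \<omega>))"
  by (simp add: hermite_cov_def hermite_moment_def mult.assoc)

text \<open>
  Edges inside the first pair of vertices satisfy the same recursion for the moment and for the
  product of the two expectations, so they keep the covariance structure; the first edge that
  leaves the pair reduces the difference to a plain moment. Diagrams without such an edge cancel.
\<close>

lemma hermite_cov_bound:
  assumes ij: "1 \<le> i" "1 \<le> j" "1 \<le> k" "1 \<le> l" and "0 \<le> w" "0 \<le> B"
    and "diagrams_le 1 w B p q r s i j k l"
  shows "w * \<bar>hermite_cov p q r s i j k l\<bar> \<le> fact (p + q + r + s) * B"
  using assms(5-7)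
proof (induction p arbitrary: q w)
  case 0
  show ?case
  proof (cases "q = 0")
    case True
    then show ?thesis using \<open>0 \<le> B\<close> by (simp add: hermite_cov_def prob_space)
  next
    case False
    have "diagrams_le 0 w B 0 q r s i j k l"
    proof (rule diagrams_leI, goal_cases)
      case (1 a b c d e f)
      then show ?case using diagrams_leD[OF 0(3), of a b c d e f] False by auto
    qed
    then have "w * \<bar>hermite_moment 0 q r s i j k l\<bar> \<le> fact (0 + q + r + s) * B"
      by (rule hermite_moment_bound[OF ij 0(1,2)])
    moreover have "hermite_moment 0 q 0 0 i j k l = 0"
      using hermite_orthogonality[OF ij(1,2), of 0 q] False by (simp add: hermite_moment_def)
    ultimately show ?thesis by (simp add: hermite_cov_eq_moment)
  qed
next
  case (Suc p)
  let ?F = "fact (p + q + r + s - 1) :: real"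
  have eq: "hermite_cov (Suc p) q r s i j k l =
      real q * (R i j * hermite_cov p (q - 1) r s i j k l) +
      real r * (R i k * hermite_moment p q (r - 1) s i j k l) +
      real s * (R i l * hermite_moment p q r (s - 1) i j k l)"
    unfolding hermite_cov_eq_moment hermite_moment_Suc[OF ij] by (simp add: algebra_simps)
  define x where "x = (if q = 0 then 0 else R i j * hermite_cov p (q - 1) r s i j k l)"
  define y where "y = (if r = 0 then 0 else R i k * hermite_moment p q (r - 1) s i j k l)"
  define z where "z = (if s = 0 then 0 else R i l * hermite_moment p q r (s - 1) i j k l)"
  have "w * \<bar>x\<bar> \<le> ?F * B"
  proof (cases q)
    case (Suc q')
    have "(w * \<bar>R i j\<bar>) * \<bar>hermite_cov p q' r s i j k l\<bar> \<le> fact (p + q' + r + s) * B"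
      using Suc Suc.prems by (intro Suc.IH diagrams_le_edge(1)) auto
    then show ?thesis using Suc by (simp add: x_def abs_mult mult.assoc)
  qed (use \<open>0 \<le> B\<close> in \<open>simp add: x_def\<close>)
  moreover have "w * \<bar>y\<bar> \<le> ?F * B"
  proof (cases r)
    case (Suc r')
    have "(w * \<bar>R i k\<bar>) * \<bar>hermite_moment p q r' s i j k l\<bar> \<le> fact (p + q + r' + s) * B"
      using Suc Suc.prems by (intro hermite_moment_bound ij diagrams_le_edge(2)[of 1]) auto
    then show ?thesis using Suc by (simp add: y_def abs_mult mult.assoc)
  qed (use \<open>0 \<le> B\<close> in \<open>simp add: y_def\<close>)
  moreover have "w * \<bar>z\<bar> \<le> ?F * B"
  proof (cases s)
    case (Suc s')
    have "(w * \<bar>R i l\<bar>) * \<bar>hermite_moment p q r s' i j k l\<bar> \<le> fact (p + q + r + s') * B"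
      using Suc Suc.prems by (intro hermite_moment_bound ij diagrams_le_edge(3)[of 1]) auto
    then show ?thesis using Suc by (simp add: z_def abs_mult mult.assoc)
  qed (use \<open>0 \<le> B\<close> in \<open>simp add: z_def\<close>)
  ultimately have "w * \<bar>real q * x + real r * y + real s * z\<bar> \<le> fact (Suc p + q + r + s) * B"
    using \<open>0 \<le> w\<close> \<open>0 \<le> B\<close> by (intro three_edges_bound[where F="?F"] fact_edge_bound) auto
  moreover have "real q * x + real r * y + real s * z = hermite_cov (Suc p) q r s i j k l"
    unfolding eq x_def y_def z_def by simp
  ultimately show ?case by simp
qed

end

section \<open>Sums over diagrams\<close>

text \<open>
  Interpolates between \<open>s ^ d\<close> and \<open>t ^ d\<close>, with an arbitrarily small coefficient on \<open>t ^ d\<close> as soon as the factor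
  \<open>s\<close> really occurs; one distinguishes whether \<open>K * s \<le> t\<close>.
\<close>

lemma power_product_trade:
  fixes s t K :: real
  assumes s: "0 \<le> s" "s \<le> 1" and t: "0 \<le> t" "t \<le> 1" and K: "1 \<le> K"
    and i: "1 \<le> i" and ij: "d \<le> i + j"
  shows "s ^ i * t ^ j \<le> K ^ d * s ^ d + t ^ d / K"
proof (cases "K * s \<le> t")
  case True
  have "s ^ i \<le> (t / K) ^ i" using True K s by (intro power_mono) (auto simp: field_simps)
  also have "\<dots> = t ^ i / K ^ i" by (simp add: power_divide)
  also have "\<dots> \<le> t ^ i / K"
    using K i t power_increasing[of 1 i K] by (intro divide_left_mono) (auto simp: mult_pos_pos)
  finally have "s ^ i * t ^ j \<le> t ^ i / K * t ^ j" using t by (intro mult_right_mono) auto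
  also have "\<dots> = t ^ (i + j) / K" by (simp add: power_add)
  also have "\<dots> \<le> t ^ d / K" using t ij K by (intro divide_right_mono power_decreasing) auto
  also have "\<dots> \<le> K ^ d * s ^ d + t ^ d / K" using K s by simp
  finally show ?thesis .
next
  case False
  have "s ^ i * t ^ j \<le> K ^ d * s ^ d"
  proof (cases "d \<le> i")
    case True
    have "s ^ i * t ^ j \<le> s ^ d * 1"
      using s t True by (intro mult_mono power_decreasing power_le_one) auto
    also have "\<dots> \<le> K ^ d * s ^ d" using K s by (simp add: mult_le_cancel_right1 one_le_power)
    finally show ?thesis .
  next
    case d: False
    have "t ^ j \<le> t ^ (d - i)" using t ij by (intro power_decreasing) auto
    also have "\<dots> \<le> (K * s) ^ (d - i)" using False t by (intro power_mono) auto
    also have "\<dots> = K ^ (d - i) * s ^ (d - i)" by (simp add: power_mult_distrib)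
    also have "\<dots> \<le> K ^ d * s ^ (d - i)" using K s by (intro mult_right_mono power_increasing) auto
    finally have "s ^ i * t ^ j \<le> s ^ i * (K ^ d * s ^ (d - i))" using s by (intro mult_left_mono) auto
    also have "\<dots> = K ^ d * s ^ (i + (d - i))" by (simp add: power_add)
    also have "i + (d - i) = d" using d by simp
    finally show ?thesis .
  qed
  also have "\<dots> \<le> K ^ d * s ^ d + t ^ d / K" using K t by simp
  finally show ?thesis .
qed

text \<open>
  The degree equations force \<open>f = a\<close> and \<open>d = c\<close>. So up to factors at most 1 the monomial is
  \<open>x ^ (a + 1) * y ^ (min b e) * z ^ c\<close> with \<open>x = u12 * u34\<close>, \<open>y = u13 * u24\<close>, \<open>z = u14 * u23\<close>: a combination of the
  three perfect matchings of the four vertices, of total degree at least \<open>D\<close>. The first bound is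
  useful when \<open>x\<close> is small, the second one when the edges between the two pairs are small.
\<close>

lemma diagram_monomial_bounds:
  fixes u12 u13 u14 u23 u24 u34 K :: real
  assumes u: "0 \<le> u12" "u12 \<le> 1" "0 \<le> u13" "u13 \<le> 1" "0 \<le> u14" "u14 \<le> 1"
      "0 \<le> u23" "u23 \<le> 1" "0 \<le> u24" "u24 \<le> 1" "0 \<le> u34" "u34 \<le> 1"
    and K: "1 \<le> K"
    and deg: "a + b + c = p" "a + d + e = q" "b + d + f = p" "c + e + f = q" "1 \<le> b + c + d + e"
    and rank: "D \<le> Suc p" "D \<le> Suc q"
  defines "m \<equiv> (u12 * u34) * (u12 ^ a * u13 ^ b * u14 ^ c * u23 ^ d * u24 ^ e * u34 ^ f)"
  shows "m \<le> K ^ D * (u12 * u34) ^ D + ((u13 * u24) ^ D + (u14 * u23) ^ D) / K"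
    and "m \<le> K ^ D * ((u13 * u24) ^ D + (u14 * u23) ^ D) + (1 / K + u13 + u24) * (u12 * u34) ^ D"
    and "m \<le> 1"
proof -
  have fa: "f = a" and dc: "d = c" using deg by linarith+
  define x y z where "x = u12 * u34" and "y = u13 * u24" and "z = u14 * u23"
  have x: "0 \<le> x" "x \<le> 1" and y: "0 \<le> y" "y \<le> 1" and z: "0 \<le> z" "z \<le> 1"
    using u by (auto simp: x_def y_def z_def intro!: mult_le_one)
  define M where "M = max y z"
  have M: "0 \<le> M" "M \<le> 1" "y \<le> M" "z \<le> M" using y z by (auto simp: M_def)
  have MD: "M ^ D \<le> y ^ D + z ^ D" using y z by (auto simp: M_def max_def)
  have m: "m = x ^ Suc a * (u13 ^ b * u24 ^ e) * z ^ c"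
    unfolding m_def fa dc x_def z_def by (simp add: power_mult_distrib mult_ac)
  define g where "g = min b e"
  have be: "u13 ^ b * u24 ^ e \<le> y ^ g"
  proof -
    have "u13 ^ b * u24 ^ e \<le> u13 ^ g * u24 ^ g"
      using u by (intro mult_mono power_decreasing) (auto simp: g_def)
    then show ?thesis by (simp add: y_def power_mult_distrib)
  qed
  have mM: "m \<le> x ^ Suc a * M ^ (g + c)"
  proof -
    have "m \<le> x ^ Suc a * y ^ g * z ^ c"
      unfolding m using be x z by (intro mult_right_mono mult_left_mono) auto
    also have "\<dots> \<le> x ^ Suc a * M ^ g * M ^ c"
      using M x y z by (intro mult_mono power_mono mult_nonneg_nonneg) auto
    finally show ?thesis by (simp add: power_add mult.assoc)
  qed
  have deg': "D \<le> Suc a + (g + c)" using deg rank by (auto simp: g_def fa dc)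
  have "m \<le> K ^ D * x ^ D + M ^ D / K"
    using mM power_product_trade[OF x M(1,2) K _ deg'] by simp
  also have "\<dots> \<le> K ^ D * x ^ D + (y ^ D + z ^ D) / K"
    using MD K by (intro add_left_mono divide_right_mono) auto
  finally show "m \<le> K ^ D * (u12 * u34) ^ D + ((u13 * u24) ^ D + (u14 * u23) ^ D) / K"
    unfolding x_def y_def z_def .
  have "m \<le> K ^ D * (y ^ D + z ^ D) + (1 / K + u13 + u24) * x ^ D"
  proof (cases "1 \<le> g + c")
    case True
    have "m \<le> K ^ D * M ^ D + x ^ D / K"
      using mM power_product_trade[OF M(1,2) x K True, of D "Suc a"] deg' by (simp add: mult.commute)
    also have "\<dots> \<le> K ^ D * (y ^ D + z ^ D) + (1 / K + u13 + u24) * x ^ D"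
    proof (rule add_mono)
      show "K ^ D * M ^ D \<le> K ^ D * (y ^ D + z ^ D)" using MD K by (intro mult_left_mono) auto
      have "(1 / K) * x ^ D \<le> (1 / K + u13 + u24) * x ^ D" using x u by (intro mult_right_mono) auto
      then show "x ^ D / K \<le> (1 / K + u13 + u24) * x ^ D" by simp
    qed
    finally show ?thesis .
  next
    case False
    then have c0: "c = 0" and g0: "g = 0" by auto
    have be1: "1 \<le> b + e" using deg(5) c0 dc by simp
    have "m = x ^ Suc a * (u13 ^ b * u24 ^ e)" using m c0 by simp
    also have "\<dots> \<le> x ^ D * (u13 + u24)"
    proof (rule mult_mono)
      show "x ^ Suc a \<le> x ^ D" using x deg' g0 c0 by (intro power_decreasing) auto
      consider "1 \<le> b" | "1 \<le> e" using be1 by linarith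
      then show "u13 ^ b * u24 ^ e \<le> u13 + u24"
      proof cases
        case 1
        have "u13 ^ b * u24 ^ e \<le> u13 ^ 1 * 1" using u 1 by (intro mult_mono power_decreasing power_le_one) auto
        then show ?thesis using u by simp
      next
        case 2
        have "u13 ^ b * u24 ^ e \<le> 1 * u24 ^ 1" using u 2 by (intro mult_mono power_decreasing power_le_one) auto
        then show ?thesis using u by simp
      qed
    qed (use x u in auto)
    also have "\<dots> \<le> (1 / K + u13 + u24) * x ^ D"
      using x K by (simp add: algebra_simps)
    also have "\<dots> \<le> K ^ D * (y ^ D + z ^ D) + (1 / K + u13 + u24) * x ^ D"
      using K y z by simp
    finally show ?thesis .
  qed
  then show "m \<le> K ^ D * ((u13 * u24) ^ D + (u14 * u23) ^ D) + (1 / K + u13 + u24) * (u12 * u34) ^ D"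
    unfolding x_def y_def z_def .
  show "m \<le> 1" using mM x M by (auto intro!: order_trans[OF mM] mult_le_one power_le_one simp del: power_Suc)
qed

definition lag :: "nat \<Rightarrow> nat \<Rightarrow> nat" where
  "lag k l = nat \<bar>int k - int l\<bar>"

lemma lag_commute: "lag k l = lag l k" and lag_triangle: "lag k l \<le> lag k i + lag i l"
  by (auto simp: lag_def)

lemma sum_lag_le:
  fixes g :: "nat \<Rightarrow> real"
  assumes g: "summable g" "\<And>m. 0 \<le> g m"
  shows "(\<Sum>l=1..n. g (lag k l)) \<le> 2 * suminf g"
proof -
  have "(\<Sum>l=1..n. g (lag k l)) = (\<Sum>l\<in>{1..n} \<inter> {..k}. g (lag k l)) + (\<Sum>l\<in>{1..n} \<inter> {k<..}. g (lag k l))"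
    by (subst sum.union_disjoint[symmetric]) (auto intro!: sum.cong)
  also have "(\<Sum>l\<in>{1..n} \<inter> {..k}. g (lag k l)) = (\<Sum>m\<in>lag k ` ({1..n} \<inter> {..k}). g m)"
    by (subst sum.reindex) (auto simp: inj_on_def lag_def)
  also have "\<dots> \<le> suminf g" using g by (intro sum_le_suminf) auto
  also have "(\<Sum>l\<in>{1..n} \<inter> {k<..}. g (lag k l)) = (\<Sum>m\<in>lag k ` ({1..n} \<inter> {k<..}). g m)"
    by (subst sum.reindex) (auto simp: inj_on_def lag_def)
  also have "\<dots> \<le> suminf g" using g by (intro sum_le_suminf) auto
  finally show ?thesis by simp
qed

lemma double_sum_lag_le:
  fixes g :: "nat \<Rightarrow> real"
  assumes g: "summable g" "\<And>m. 0 \<le> g m"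
  shows "(\<Sum>k=1..n. \<Sum>l=1..n. g (lag k l)) \<le> real n * (2 * suminf g)"
  using sum_mono[of "{1..n}" "\<lambda>k. \<Sum>l=1..n. g (lag k l)" "\<lambda>_. 2 * suminf g"] sum_lag_le[OF g] by simp

lemma quadruple_sum_pairs:
  fixes A B :: "nat \<Rightarrow> nat \<Rightarrow> real"
  shows "(\<Sum>k\<in>I. \<Sum>l\<in>I. \<Sum>i\<in>I. \<Sum>j\<in>I. A k l * B i j) = (\<Sum>k\<in>I. \<Sum>l\<in>I. A k l) * (\<Sum>k\<in>I. \<Sum>l\<in>I. B k l)"
    and "(\<Sum>k\<in>I. \<Sum>l\<in>I. \<Sum>i\<in>I. \<Sum>j\<in>I. A k i * B l j) = (\<Sum>k\<in>I. \<Sum>l\<in>I. A k l) * (\<Sum>k\<in>I. \<Sum>l\<in>I. B k l)"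
    and "(\<Sum>k\<in>I. \<Sum>l\<in>I. \<Sum>i\<in>I. \<Sum>j\<in>I. A k j * B l i) = (\<Sum>k\<in>I. \<Sum>l\<in>I. A k l) * (\<Sum>k\<in>I. \<Sum>l\<in>I. B k l)"
proof -
  show 1: "(\<Sum>k\<in>I. \<Sum>l\<in>I. \<Sum>i\<in>I. \<Sum>j\<in>I. A k l * B i j) = (\<Sum>k\<in>I. \<Sum>l\<in>I. A k l) * (\<Sum>k\<in>I. \<Sum>l\<in>I. B k l)" for A B :: "nat \<Rightarrow> nat \<Rightarrow> real"
  proof -
    have "(\<Sum>k\<in>I. \<Sum>l\<in>I. \<Sum>i\<in>I. \<Sum>j\<in>I. A k l * B i j) = (\<Sum>k\<in>I. \<Sum>l\<in>I. A k l * (\<Sum>i\<in>I. \<Sum>j\<in>I. B i j))"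
      by (simp only: sum_distrib_left)
    then show ?thesis by (simp only: sum_distrib_right)
  qed
  have "(\<Sum>l\<in>I. \<Sum>i\<in>I. \<Sum>j\<in>I. A k i * B l j) = (\<Sum>i\<in>I. \<Sum>l\<in>I. \<Sum>j\<in>I. A k i * B l j)" for k
    by (rule sum.swap)
  then show "(\<Sum>k\<in>I. \<Sum>l\<in>I. \<Sum>i\<in>I. \<Sum>j\<in>I. A k i * B l j) = (\<Sum>k\<in>I. \<Sum>l\<in>I. A k l) * (\<Sum>k\<in>I. \<Sum>l\<in>I. B k l)"
    using 1[of A B] by simp
  have "(\<Sum>l\<in>I. \<Sum>i\<in>I. \<Sum>j\<in>I. A k j * B l i) = (\<Sum>j\<in>I. \<Sum>l\<in>I. \<Sum>i\<in>I. A k j * B l i)" for k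
  proof -
    have "(\<Sum>l\<in>I. \<Sum>i\<in>I. \<Sum>j\<in>I. A k j * B l i) = (\<Sum>l\<in>I. \<Sum>j\<in>I. \<Sum>i\<in>I. A k j * B l i)"
      by (intro sum.cong refl sum.swap)
    also have "\<dots> = (\<Sum>j\<in>I. \<Sum>l\<in>I. \<Sum>i\<in>I. A k j * B l i)" by (rule sum.swap)
    finally show ?thesis .
  qed
  then show "(\<Sum>k\<in>I. \<Sum>l\<in>I. \<Sum>i\<in>I. \<Sum>j\<in>I. A k j * B l i) = (\<Sum>k\<in>I. \<Sum>l\<in>I. A k l) * (\<Sum>k\<in>I. \<Sum>l\<in>I. B k l)"
    using 1[of A B] by simp
qed

lemma quadruple_sum_chain:
  fixes A B C :: "nat \<Rightarrow> nat \<Rightarrow> real"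
  assumes A: "\<And>k l. 0 \<le> A k l" "\<And>k. (\<Sum>l\<in>I. A k l) \<le> a"
    and B: "\<And>k l. 0 \<le> B k l" "\<And>k. (\<Sum>l\<in>I. B k l) \<le> b"
    and C: "\<And>k l. 0 \<le> C k l" "\<And>k. (\<Sum>l\<in>I. C k l) \<le> c"
    and nn: "0 \<le> b" "0 \<le> c"
  shows "(\<Sum>k\<in>I. \<Sum>l\<in>I. \<Sum>i\<in>I. \<Sum>j\<in>I. A k l * (B k i * C i j)) \<le> real (card I) * (a * (b * c))"
proof -
  have "(\<Sum>i\<in>I. \<Sum>j\<in>I. B k i * C i j) \<le> b * c" for k
  proof -
    have "(\<Sum>i\<in>I. \<Sum>j\<in>I. B k i * C i j) = (\<Sum>i\<in>I. B k i * (\<Sum>j\<in>I. C i j))" by (simp add: sum_distrib_left)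
    also have "\<dots> \<le> (\<Sum>i\<in>I. B k i * c)" using B C by (intro sum_mono mult_left_mono) auto
    also have "\<dots> = (\<Sum>i\<in>I. B k i) * c" by (simp add: sum_distrib_right)
    also have "\<dots> \<le> b * c" using B nn by (intro mult_right_mono) auto
    finally show ?thesis .
  qed
  note bc = this
  have "(\<Sum>l\<in>I. \<Sum>i\<in>I. \<Sum>j\<in>I. A k l * (B k i * C i j)) \<le> a * (b * c)" for k
  proof -
    have "(\<Sum>l\<in>I. \<Sum>i\<in>I. \<Sum>j\<in>I. A k l * (B k i * C i j)) = (\<Sum>l\<in>I. A k l * (\<Sum>i\<in>I. \<Sum>j\<in>I. B k i * C i j))"
      by (simp only: sum_distrib_left)
    also have "\<dots> \<le> (\<Sum>l\<in>I. A k l * (b * c))" using A bc by (intro sum_mono mult_left_mono) auto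
    also have "\<dots> = (\<Sum>l\<in>I. A k l) * (b * c)" by (simp only: sum_distrib_right)
    also have "\<dots> \<le> a * (b * c)" using A nn by (intro mult_right_mono) auto
    finally show ?thesis .
  qed
  then have "(\<Sum>k\<in>I. \<Sum>l\<in>I. \<Sum>i\<in>I. \<Sum>j\<in>I. A k l * (B k i * C i j)) \<le> (\<Sum>k\<in>I. a * (b * c))"
    by (intro sum_mono) auto
  then show ?thesis by simp
qed

text \<open>
  Each of the three matchings gives a sum of order \<open>n\<^sup>2\<close>, so a gain is needed somewhere. Cut all lags at
  a level \<open>T\<close>. If the lag of one of the pairs \<open>(k, l)\<close>, \<open>(i, j)\<close> is at least \<open>T\<close>, the first bound gains from the tail
  of the series of \<open>\<bar>\<rho>\<bar> ^ d\<close>; if both are smaller than \<open>T\<close> but the pairs are far from each other, the second bound gains; and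
  the remaining quadruples have all lags of order \<open>T\<close>, so that their number is of order \<open>n\<close>.
\<close>

lemma diagram_sum_tendsto_0:
  fixes \<rho> :: "nat \<Rightarrow> real" and W :: "nat \<Rightarrow> nat \<Rightarrow> nat \<Rightarrow> nat \<Rightarrow> real"
  assumes \<rho>: "summable (\<lambda>m. \<bar>\<rho> m\<bar> ^ d)" "\<And>m. \<bar>\<rho> m\<bar> \<le> 1" and d: "1 \<le> d"
  defines "u \<equiv> \<lambda>k l. \<bar>\<rho> (lag k l)\<bar>"
  assumes W0: "\<And>k l i j. 0 \<le> W k l i j"
    and WA: "\<And>k l i j K. 1 \<le> k \<Longrightarrow> 1 \<le> l \<Longrightarrow> 1 \<le> i \<Longrightarrow> 1 \<le> j \<Longrightarrow> 1 \<le> K \<Longrightarrow>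
      W k l i j \<le> K ^ d * (u k l * u i j) ^ d + ((u k i * u l j) ^ d + (u k j * u l i) ^ d) / K"
    and WB: "\<And>k l i j K. 1 \<le> k \<Longrightarrow> 1 \<le> l \<Longrightarrow> 1 \<le> i \<Longrightarrow> 1 \<le> j \<Longrightarrow> 1 \<le> K \<Longrightarrow>
      W k l i j \<le> K ^ d * ((u k i * u l j) ^ d + (u k j * u l i) ^ d) + (1 / K + u k i + u l j) * (u k l * u i j) ^ d"
    and W1: "\<And>k l i j. 1 \<le> k \<Longrightarrow> 1 \<le> l \<Longrightarrow> 1 \<le> i \<Longrightarrow> 1 \<le> j \<Longrightarrow> W k l i j \<le> 1"
  shows "(\<lambda>n. (\<Sum>k=1..n. \<Sum>l=1..n. \<Sum>i=1..n. \<Sum>j=1..n. W k l i j) / (real n)\<^sup>2) \<longlonglongrightarrow> 0"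
proof (rule LIMSEQ_I)
  fix r :: real assume r: "0 < r"
  define v where "v = (\<lambda>m. \<bar>\<rho> m\<bar> ^ d)"
  define C where "C = 2 * suminf v"
  have v: "summable v" "\<And>m. 0 \<le> v m" using \<rho> by (auto simp: v_def)
  have C0: "0 \<le> C" using suminf_nonneg[OF v] by (simp add: C_def)
  have uv: "u k l ^ d = v (lag k l)" for k l by (simp add: u_def v_def)
  \<comment> \<open>In the final estimate the terms with \<open>1 / K\<close> add up to at most \<open>r / 4\<close>, those with \<open>\<epsilon>\<close> and with \<open>\<tau>0\<close> to \<open>r / 8\<close> each.\<close>
  define K where "K = max 1 (12 * C\<^sup>2 / r)"
  have K: "1 \<le> K" by (simp add: K_def)
  have KC: "3 * C\<^sup>2 / K \<le> r / 4"
  proof -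
    have "12 * C\<^sup>2 / r \<le> K" by (simp add: K_def)
    then show ?thesis using r K by (simp add: field_simps)
  qed
  define \<epsilon> where "\<epsilon> = r / (16 * (C\<^sup>2 + 1))"
  have \<epsilon>: "0 < \<epsilon>" "2 * \<epsilon> * C\<^sup>2 \<le> r / 8"
  proof -
    have "0 < C\<^sup>2 + 1" by (simp add: add_nonneg_pos)
    then show "0 < \<epsilon>" "2 * \<epsilon> * C\<^sup>2 \<le> r / 8" using r by (auto simp: \<epsilon>_def field_simps)
  qed
  have "\<rho> \<longlonglongrightarrow> 0"
  proof -
    have "(\<lambda>m. root d (\<bar>\<rho> m\<bar> ^ d)) \<longlonglongrightarrow> root d 0"
      using summable_LIMSEQ_zero[OF \<rho>(1)] by (intro tendsto_real_root)
    then show ?thesis using d by (simp add: real_root_power_cancel tendsto_rabs_zero_iff)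
  qed
  then obtain T1 where T1: "\<And>m. m \<ge> T1 \<Longrightarrow> \<bar>\<rho> m\<bar> < \<epsilon>"
    using LIMSEQ_D[of \<rho> 0 \<epsilon>] \<epsilon> by auto
  define \<tau>0 where "\<tau>0 = r / (64 * (K ^ d * (C + 1)))"
  have KC0: "0 < K ^ d * (C + 1)" using K C0 by (intro mult_pos_pos) auto
  have \<tau>0: "0 < \<tau>0" using r KC0 by (simp add: \<tau>0_def)
  obtain T2 where T2: "\<And>n. n \<ge> T2 \<Longrightarrow> norm (\<Sum>m. v (m + n)) < \<tau>0"
    using suminf_exist_split[OF \<tau>0 v(1)] by auto
  define T where "T = max T1 T2"
  define v' where "v' = (\<lambda>m. if m < T then 0 else v m)"
  have v': "summable v'" "\<And>m. 0 \<le> v' m" "suminf v' \<le> \<tau>0"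
  proof -
    have 1: "summable (\<lambda>m. v' (m + T))" using v(1) by (simp add: v'_def)
    then show s: "summable v'" by simp
    show "0 \<le> v' m" for m using v by (simp add: v'_def)
    have "suminf v' = (\<Sum>m. v' (m + T)) + (\<Sum>m<T. v' m)" by (rule suminf_split_initial_segment[OF s])
    also have "\<dots> = (\<Sum>m. v (m + T))" by (simp add: v'_def)
    finally show "suminf v' \<le> \<tau>0" using T2[of T] by (simp add: T_def)
  qed
  define near where "near = (\<lambda>S (m::nat). if m < S then 1 else 0 :: real)"
  have near: "summable (near S)" "0 \<le> near S m" "suminf (near S) = real S" for S m
  proof -
    have "near S sums (\<Sum>m<S. near S m)" by (rule sums_finite) (auto simp: near_def)
    then show "summable (near S)" "suminf (near S) = real S" by (auto simp: sums_iff near_def)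
  qed (simp add: near_def)
  define F where "F = (\<lambda>k l i j. K ^ d * (v' (lag k l) * v (lag i j)) + K ^ d * (v (lag k l) * v' (lag i j))
      + (1 / K) * (v (lag k i) * v (lag l j)) + (1 / K) * (v (lag k j) * v (lag l i))
      + K ^ d * (v' (lag k i) * v (lag l j)) + K ^ d * (v' (lag k j) * v (lag l i))
      + (1 / K + 2 * \<epsilon>) * (v (lag k l) * v (lag i j))
      + near T (lag k l) * (near (3 * T) (lag k i) * near T (lag i j)))"
  have WF: "W k l i j \<le> F k l i j" if ge: "1 \<le> k" "1 \<le> l" "1 \<le> i" "1 \<le> j" for k l i j
  proof -
    have nn: "0 \<le> K ^ d * (v' (lag k l) * v (lag i j))" "0 \<le> K ^ d * (v (lag k l) * v' (lag i j))"
      "0 \<le> (1 / K) * (v (lag k i) * v (lag l j))" "0 \<le> (1 / K) * (v (lag k j) * v (lag l i))"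
      "0 \<le> K ^ d * (v' (lag k i) * v (lag l j))" "0 \<le> K ^ d * (v' (lag k j) * v (lag l i))"
      "0 \<le> (1 / K + 2 * \<epsilon>) * (v (lag k l) * v (lag i j))"
      "0 \<le> near T (lag k l) * (near (3 * T) (lag k i) * near T (lag i j))"
      using K v v' \<epsilon> near(2) by (auto intro!: mult_nonneg_nonneg)
    \<comment> \<open>If both pairs have lag below \<open>T\<close> and one of the lags \<open>ki\<close>, \<open>lj\<close>, \<open>kj\<close> is below \<open>T\<close> too, the triangle inequality bounds \<open>lag k i\<close>.\<close>
    consider (far) "T \<le> lag k l \<or> T \<le> lag i j"
      | (cross) "lag k l < T" "lag i j < T" "T \<le> lag k i" "T \<le> lag l j" "T \<le> lag k j"
      | (near) "lag k l < T" "lag i j < T" "lag k i < 3 * T"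
    proof -
      have "lag k i < 3 * T" if "lag k l < T" "lag i j < T" "lag l j < T"
        using that lag_triangle[of k i l] lag_triangle[of l i j] lag_commute[of i j] by linarith
      moreover have "lag k i < 3 * T" if "lag k l < T" "lag i j < T" "lag k j < T"
        using that lag_triangle[of k i j] lag_commute[of i j] by linarith
      ultimately have "T \<le> lag k i \<and> T \<le> lag l j \<and> T \<le> lag k j" if "lag k l < T" "lag i j < T" "\<not> lag k i < 3 * T"
        using that by (intro conjI; rule_tac ccontr) (auto simp: not_le)
      then show ?thesis using that by (meson not_less)
    qed
    then show ?thesis
    proof cases
      case far
      have "v (lag k l) * v (lag i j) \<le> v' (lag k l) * v (lag i j) + v (lag k l) * v' (lag i j)"
        using far v by (auto simp: v'_def)
      then have "K ^ d * (v (lag k l) * v (lag i j)) \<le> K ^ d * (v' (lag k l) * v (lag i j)) + K ^ d * (v (lag k l) * v' (lag i j))"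
        using K by (subst distrib_left[symmetric]) (auto intro: mult_left_mono)
      then show ?thesis
        using WA[OF ge K] nn unfolding F_def power_mult_distrib uv by (simp add: add_divide_distrib)
    next
      case cross
      have "u k i \<le> \<epsilon>" "u l j \<le> \<epsilon>" using cross T1 by (auto simp: u_def T_def intro: less_imp_le)
      then have le: "(1 / K + u k i + u l j) * (v (lag k l) * v (lag i j)) \<le> (1 / K + 2 * \<epsilon>) * (v (lag k l) * v (lag i j))"
        using v by (intro mult_right_mono) auto
      have e: "v' (lag k i) = v (lag k i)" "v' (lag k j) = v (lag k j)"
        using cross by (auto simp: v'_def)
      show ?thesis
        using WB[OF ge K] le nn unfolding F_def power_mult_distrib uv distrib_left e by linarith
    next
      case near
      then have "near T (lag k l) * (near (3 * T) (lag k i) * near T (lag i j)) = 1" by (simp add: near_def)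
      then show ?thesis using W1[OF ge] nn unfolding F_def by linarith
    qed
  qed
  define R3 where "R3 = 2 * real T * (2 * real (3 * T) * (2 * real T))"
  have bound: "(\<Sum>k=1..n. \<Sum>l=1..n. \<Sum>i=1..n. \<Sum>j=1..n. W k l i j) / (real n)\<^sup>2 \<le> r / 2 + R3 / real n" if n: "n \<ge> 1" for n
  proof -
    let ?I = "{1..n}"
    let ?V = "\<Sum>k\<in>?I. \<Sum>l\<in>?I. v (lag k l)"
    let ?V' = "\<Sum>k\<in>?I. \<Sum>l\<in>?I. v' (lag k l)"
    have V: "?V \<le> real n * C" unfolding C_def by (rule double_sum_lag_le[OF v])
    have V': "?V' \<le> real n * (2 * \<tau>0)"
      by (rule order_trans[OF double_sum_lag_le[OF v'(1,2), of n] mult_left_mono]) (use v'(3) in auto)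
    have V0: "0 \<le> ?V" "0 \<le> ?V'" using v v' by (auto intro!: sum_nonneg)
    have chain: "(\<Sum>k\<in>?I. \<Sum>l\<in>?I. \<Sum>i\<in>?I. \<Sum>j\<in>?I. near T (lag k l) * (near (3 * T) (lag k i) * near T (lag i j)))
        \<le> real (card ?I) * R3"
      unfolding R3_def
    proof -
      have sl: "(\<Sum>l=1..n. near S (lag k l)) \<le> 2 * real S" for S k
        by (rule order_trans[OF sum_lag_le[OF near(1,2)]]) (simp add: near(3))
      show "(\<Sum>k\<in>?I. \<Sum>l\<in>?I. \<Sum>i\<in>?I. \<Sum>j\<in>?I. near T (lag k l) * (near (3 * T) (lag k i) * near T (lag i j)))
        \<le> real (card ?I) * (2 * real T * (2 * real (3 * T) * (2 * real T)))"
        by (rule quadruple_sum_chain; (rule near(2) | rule sl | simp))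
    qed
    have "(\<Sum>k\<in>?I. \<Sum>l\<in>?I. \<Sum>i\<in>?I. \<Sum>j\<in>?I. W k l i j) \<le> (\<Sum>k\<in>?I. \<Sum>l\<in>?I. \<Sum>i\<in>?I. \<Sum>j\<in>?I. F k l i j)"
      by (intro sum_mono WF) auto
    also have "\<dots> = K ^ d * (?V' * ?V) + K ^ d * (?V * ?V') + (1 / K) * (?V * ?V) + (1 / K) * (?V * ?V)
        + K ^ d * (?V' * ?V) + K ^ d * (?V' * ?V) + (1 / K + 2 * \<epsilon>) * (?V * ?V)
        + (\<Sum>k\<in>?I. \<Sum>l\<in>?I. \<Sum>i\<in>?I. \<Sum>j\<in>?I. near T (lag k l) * (near (3 * T) (lag k i) * near T (lag i j)))"
      unfolding F_def sum.distrib sum_distrib_left[symmetric, of "K ^ d"] sum_distrib_left[symmetric, of "1 / K"]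
        sum_distrib_left[symmetric, of "1 / K + 2 * \<epsilon>"]
        quadruple_sum_pairs(1)[of "\<lambda>k l. v' (lag k l)" "\<lambda>k l. v (lag k l)"]
        quadruple_sum_pairs(1)[of "\<lambda>k l. v (lag k l)" "\<lambda>k l. v' (lag k l)"]
        quadruple_sum_pairs(1)[of "\<lambda>k l. v (lag k l)" "\<lambda>k l. v (lag k l)"]
        quadruple_sum_pairs(2)[of "\<lambda>k l. v (lag k l)" "\<lambda>k l. v (lag k l)"]
        quadruple_sum_pairs(2)[of "\<lambda>k l. v' (lag k l)" "\<lambda>k l. v (lag k l)"]
        quadruple_sum_pairs(3)[of "\<lambda>k l. v (lag k l)" "\<lambda>k l. v (lag k l)"]
        quadruple_sum_pairs(3)[of "\<lambda>k l. v' (lag k l)" "\<lambda>k l. v (lag k l)"] by (rule refl)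
    also have "\<dots> \<le> 4 * K ^ d * (?V' * ?V) + (3 / K + 2 * \<epsilon>) * (?V * ?V) + real n * R3"
      using chain by (simp add: algebra_simps)
    also have "\<dots> \<le> 4 * K ^ d * ((real n * (2 * \<tau>0)) * (real n * C)) + (3 / K + 2 * \<epsilon>) * ((real n * C) * (real n * C)) + real n * R3"
      using V V' V0 K \<epsilon> \<tau>0 C0 by (intro add_mono mult_left_mono mult_mono order_refl) (auto intro!: mult_nonneg_nonneg add_nonneg_nonneg)
    also have "\<dots> = (real n)\<^sup>2 * (8 * \<tau>0 * (K ^ d * C) + 3 * C\<^sup>2 / K + 2 * \<epsilon> * C\<^sup>2) + real n * R3"
      by (simp add: power2_eq_square algebra_simps add_divide_distrib)
    also have "\<dots> \<le> (real n)\<^sup>2 * (r / 8 + r / 4 + r / 8) + real n * R3"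
    proof -
      have "\<tau>0 * (K ^ d * C) \<le> \<tau>0 * (K ^ d * (C + 1))" using \<tau>0 K by (intro mult_left_mono) auto
      also have "\<dots> = r / 64"
      proof -
        have "r / (64 * Q) * Q = r / 64" if "0 < Q" for Q using that by simp
        from this[OF KC0] show ?thesis unfolding \<tau>0_def .
      qed
      finally have "8 * \<tau>0 * (K ^ d * C) \<le> r / 8" by simp
      then show ?thesis using KC \<epsilon>(2) by (intro add_right_mono mult_left_mono add_mono) auto
    qed
    finally have "(\<Sum>k\<in>?I. \<Sum>l\<in>?I. \<Sum>i\<in>?I. \<Sum>j\<in>?I. W k l i j) \<le> (real n)\<^sup>2 * (r / 2) + real n * R3" by simp
    then have "(\<Sum>k\<in>?I. \<Sum>l\<in>?I. \<Sum>i\<in>?I. \<Sum>j\<in>?I. W k l i j) / (real n)\<^sup>2 \<le> ((real n)\<^sup>2 * (r / 2) + real n * R3) / (real n)\<^sup>2"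
      by (intro divide_right_mono) auto
    also have "\<dots> = r / 2 + R3 / real n" using n by (simp add: field_simps power2_eq_square)
    finally show ?thesis .
  qed
  obtain n0 :: nat where n0: "2 * R3 / r < real n0" using reals_Archimedean2 by blast
  show "\<exists>no. \<forall>n\<ge>no. norm ((\<Sum>k=1..n. \<Sum>l=1..n. \<Sum>i=1..n. \<Sum>j=1..n. W k l i j) / (real n)\<^sup>2 - 0) < r"
  proof (intro exI allI impI)
    fix n assume n: "max 1 n0 \<le> n"
    have "2 * R3 / r < real n" using n0 n by simp
    then have R3: "R3 / real n < r / 2" using r n by (simp add: field_simps)
    have "1 \<le> n" using n by simp
    then have "(\<Sum>k=1..n. \<Sum>l=1..n. \<Sum>i=1..n. \<Sum>j=1..n. W k l i j) / (real n)\<^sup>2 < r"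
      using bound[of n] R3 by linarith
    moreover have "0 \<le> (\<Sum>k=1..n. \<Sum>l=1..n. \<Sum>i=1..n. \<Sum>j=1..n. W k l i j) / (real n)\<^sup>2"
      using W0 by (intro divide_nonneg_nonneg sum_nonneg) auto
    ultimately show "norm ((\<Sum>k=1..n. \<Sum>l=1..n. \<Sum>i=1..n. \<Sum>j=1..n. W k l i j) / (real n)\<^sup>2 - 0) < r"
      by (simp only: real_norm_def diff_0_right abs_of_nonneg)
  qed
qed

section \<open>Averages over lags\<close>

lemma Cesaro_mean_tendsto:
  fixes x :: "nat \<Rightarrow> real"
  assumes x: "x \<longlonglongrightarrow> L"
  shows "(\<lambda>n. (\<Sum>j<n. x j) / real n) \<longlonglongrightarrow> L"
proof (rule LIMSEQ_I)
  fix r :: real assume r: "0 < r"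
  obtain N where N: "\<And>j. j \<ge> N \<Longrightarrow> \<bar>x j - L\<bar> < r / 2"
    using LIMSEQ_D[OF x, of "r / 2"] r by auto
  define A where "A = (\<Sum>j<N. \<bar>x j - L\<bar>)"
  obtain n0 :: nat where n0: "2 * A / r < real n0" using reals_Archimedean2 by blast
  show "\<exists>no. \<forall>n\<ge>no. norm ((\<Sum>j<n. x j) / real n - L) < r"
  proof (intro exI allI impI)
    fix n assume n: "max (Suc N) n0 \<le> n"
    then have n1: "0 < real n" by simp
    have "(\<Sum>j<n. x j) / real n - L = (\<Sum>j<n. x j - L) / real n"
      using n1 by (simp add: sum_subtractf diff_divide_distrib)
    then have "norm ((\<Sum>j<n. x j) / real n - L) \<le> (\<Sum>j<n. \<bar>x j - L\<bar>) / real n"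
      using n1 by (simp add: divide_right_mono)
    also have "(\<Sum>j<n. \<bar>x j - L\<bar>) = A + (\<Sum>j=N..<n. \<bar>x j - L\<bar>)"
      unfolding A_def using n by (simp add: sum.atLeastLessThan_concat lessThan_atLeast0)
    also have "(\<Sum>j=N..<n. \<bar>x j - L\<bar>) \<le> (\<Sum>j=N..<n. r / 2)"
      using N by (intro sum_mono) (auto intro: less_imp_le)
    also have "(\<Sum>j=N..<n. r / 2) \<le> real n * (r / 2)"
      using r by (simp add: mult_right_mono)
    finally have "norm ((\<Sum>j<n. x j) / real n - L) \<le> (A + real n * (r / 2)) / real n"
      using n1 by (simp add: divide_right_mono)
    also have "\<dots> = A / real n + r / 2" using n1 by (simp add: field_simps)
    also have "A / real n < r / 2"
    proof -
      have "2 * A / r < real n" using n0 n by simp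
      then show ?thesis using r n1 by (simp add: field_simps)
    qed
    finally show "norm ((\<Sum>j<n. x j) / real n - L) < r" by simp
  qed
qed

text \<open>
  Adding row and column \<open>n + 1\<close> increases the double sum by \<open>g 0 + 2 * s n\<close>, with \<open>s n\<close> a partial sum of the
  series of \<open>g\<close>; so the average is a Cesaro mean of these partial sums.
\<close>

lemma lag_average_tendsto:
  fixes g :: "nat \<Rightarrow> real"
  assumes g: "summable g"
  shows "(\<lambda>n. (\<Sum>k=1..n. \<Sum>l=1..n. g (lag k l)) / real n) \<longlonglongrightarrow> g 0 + 2 * (\<Sum>j. g (Suc j))"
proof -
  define s where "s = (\<lambda>n. \<Sum>j<n. g (Suc j))"
  have s: "s \<longlonglongrightarrow> (\<Sum>j. g (Suc j))"
    unfolding s_def using summable_LIMSEQ summable_Suc_iff g by blast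
  have row: "(\<Sum>l=1..n. g (lag (Suc n) l)) = s n" for n
  proof -
    have "(\<Sum>l=1..n. g (lag (Suc n) l)) = (\<Sum>j<n. g (Suc j))"
      by (rule sum.reindex_bij_witness[of _ "\<lambda>j. n - j" "\<lambda>l. n - l"]) (auto simp: lag_def intro!: arg_cong[of _ _ g])
    then show ?thesis by (simp add: s_def)
  qed
  have "(\<Sum>k=1..n. \<Sum>l=1..n. g (lag k l)) = real n * g 0 + 2 * (\<Sum>j<n. s j)" for n
  proof (induction n)
    case (Suc n)
    have "(\<Sum>k=1..Suc n. \<Sum>l=1..Suc n. g (lag k l)) =
        (\<Sum>k=1..n. (\<Sum>l=1..n. g (lag k l)) + g (lag k (Suc n))) + ((\<Sum>l=1..n. g (lag (Suc n) l)) + g (lag (Suc n) (Suc n)))"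
      by simp
    also have "\<dots> = (\<Sum>k=1..n. \<Sum>l=1..n. g (lag k l)) + s n + (s n + g 0)"
    proof -
      have "(\<Sum>k=1..n. g (lag k (Suc n))) = (\<Sum>k=1..n. g (lag (Suc n) k))"
        by (intro sum.cong refl arg_cong[of _ _ g] lag_commute)
      then show ?thesis unfolding sum.distrib row by (simp add: lag_def)
    qed
    finally show ?case unfolding Suc.IH by (simp add: algebra_simps)
  qed simp
  then have eq: "(\<Sum>k=1..n. \<Sum>l=1..n. g (lag k l)) / real n = real n * g 0 / real n + 2 * ((\<Sum>j<n. s j) / real n)" for n
    by (simp add: add_divide_distrib)
  have "(\<lambda>n. real n * g 0 / real n) \<longlonglongrightarrow> g 0"
    by (rule tendsto_eventually) (auto simp: eventually_sequentially intro!: exI[of _ 1])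
  then show ?thesis unfolding eq
    by (intro tendsto_add tendsto_mult tendsto_const Cesaro_mean_tendsto s)
qed

lemma infsum_int_abs:
  fixes g :: "nat \<Rightarrow> real"
  assumes g: "summable (\<lambda>j. \<bar>g j\<bar>)"
  shows "(\<Sum>\<^sub>\<infinity>k\<in>(UNIV :: int set). g (nat \<bar>k\<bar>)) = g 0 + 2 * (\<Sum>j. g (Suc j))"
proof -
  let ?S = "\<Sum>j. g (Suc j)"
  have gs: "summable (\<lambda>j. \<bar>g (Suc j)\<bar>)" using g by (subst summable_Suc_iff)
  have "summable (\<lambda>j. g (Suc j))" using gs by (rule summable_rabs_cancel)
  then have hs: "((\<lambda>j. g (Suc j)) has_sum ?S) UNIV"
    using gs by (intro norm_summable_imp_has_sum) (auto simp: summable_sums)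
  define P where "P = range (\<lambda>j. int (Suc j))"
  define Q where "Q = range (\<lambda>j. - int (Suc j))"
  have P: "((\<lambda>k. g (nat \<bar>k\<bar>)) has_sum ?S) P"
    unfolding P_def using hs by (subst has_sum_reindex) (auto simp: inj_on_def o_def nat_add_distrib)
  have Q: "((\<lambda>k. g (nat \<bar>k\<bar>)) has_sum ?S) Q"
    unfolding Q_def
  proof (subst has_sum_reindex)
    have "nat \<bar>- int (Suc j)\<bar> = Suc j" for j by simp
    then show "((\<lambda>k. g (nat \<bar>k\<bar>)) \<circ> (\<lambda>j. - int (Suc j)) has_sum ?S) UNIV"
      using hs by (simp only: o_def)
  qed (auto simp: inj_on_def)
  have Z: "((\<lambda>k::int. g (nat \<bar>k\<bar>)) has_sum g 0) {0}"
    using has_sum_finite[of "{0::int}" "\<lambda>k. g (nat \<bar>k\<bar>)"] by simp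
  have UN: "UNIV = {0} \<union> P \<union> Q"
  proof -
    have "k \<in> {0} \<union> P \<union> Q" for k :: int
    proof (cases "k = 0")
      case False
      show ?thesis
      proof (cases "0 < k")
        case True
        then have "k = int (Suc (nat k - 1))" by simp
        then show ?thesis unfolding P_def by blast
      next
        case False
        then have "k = - int (Suc (nat (- k) - 1))" using \<open>k \<noteq> 0\<close> by simp
        then show ?thesis unfolding Q_def by blast
      qed
    qed simp
    then show ?thesis by blast
  qed
  have "((\<lambda>k. g (nat \<bar>k\<bar>)) has_sum ((g 0 + ?S) + ?S)) ({0} \<union> P \<union> Q)"
    by (intro has_sum_Un_disjoint Z P Q) (auto simp: P_def Q_def)
  then have "((\<lambda>k. g (nat \<bar>k\<bar>)) has_sum ((g 0 + ?S) + ?S)) UNIV" using UN by simp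
  then show ?thesis by (simp add: infsumI)
qed

lemma infsum_atLeast_tail_bound:
  fixes g a :: "nat \<Rightarrow> real"
  assumes a: "summable a" and ga: "\<And>m. d \<le> m \<Longrightarrow> \<bar>g m\<bar> \<le> a m" and a0: "\<And>m. 0 \<le> a m" and K: "d \<le> K"
  shows "\<bar>(\<Sum>\<^sub>\<infinity>m\<in>{d..}. g m) - (\<Sum>m=d..K. g m)\<bar> \<le> (\<Sum>m. a (m + Suc K))"
proof -
  define g' where "g' = (\<lambda>m. if d \<le> m then g m else 0)"
  have g'a: "\<bar>g' m\<bar> \<le> a m" for m using ga a0 by (simp add: g'_def)
  have s: "summable (\<lambda>m. \<bar>g' m\<bar>)" by (rule summable_comparison_test'[OF a, of 0]) (use g'a in auto)
  then have s': "summable g'" by (rule summable_rabs_cancel)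
  have "(g' has_sum suminf g') UNIV" using s s' by (intro norm_summable_imp_has_sum) (auto simp: summable_sums)
  then have "infsum g' UNIV = suminf g'" by (rule infsumI)
  moreover have "infsum g {d..} = infsum g' UNIV"
    by (rule infsum_cong_neutral) (auto simp: g'_def)
  ultimately have 1: "infsum g {d..} = suminf g'" by simp
  have "suminf g' = (\<Sum>m. g' (m + Suc K)) + (\<Sum>m<Suc K. g' m)"
    by (rule suminf_split_initial_segment[OF s'])
  moreover have "(\<Sum>m<Suc K. g' m) = (\<Sum>m=d..K. g m)"
    unfolding g'_def by (rule sum.mono_neutral_cong_right) auto
  ultimately have "infsum g {d..} - (\<Sum>m=d..K. g m) = (\<Sum>m. g' (m + Suc K))" using 1 by simp
  also have "\<bar>\<dots>\<bar> \<le> (\<Sum>m. \<bar>g' (m + Suc K)\<bar>)"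
    by (rule summable_rabs) (rule summable_iff_shift[THEN iffD2, OF s])
  also have "\<dots> \<le> (\<Sum>m. a (m + Suc K))"
    by (intro suminf_le g'a summable_iff_shift[THEN iffD2, OF s] summable_iff_shift[THEN iffD2, OF a])
  finally show ?thesis .
qed

section \<open>The carre du champ form\<close>

text \<open>
  The shift \<open>r\<close> is 0 for an expansion in Hermite polynomials and 1 for its derivative, up to the factors
  \<open>m\<close>, as well as for the factor \<open>h\<close> of the Stein kernel.
\<close>

definition hermite_sum :: "nat \<Rightarrow> (nat \<Rightarrow> real) \<Rightarrow> nat \<Rightarrow> nat \<Rightarrow> real poly" where
  "hermite_sum r a K N = (\<Sum>m=K..N. smult (a m) (hermite_poly (m - r)))"

lemma poly_hermite_sum: "poly (hermite_sum r a K N) x = (\<Sum>m=K..N. a m * hermite (m - r) x)"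
  by (simp add: hermite_sum_def poly_sum hermite_eq_poly)

lemma pderiv_hermite_sum: "pderiv (hermite_sum 0 a K N) = hermite_sum 1 (\<lambda>m. real m * a m) K N"
proof -
  have "pderiv (\<Sum>m\<in>A. p m) = (\<Sum>m\<in>A. pderiv (p m))" for A and p :: "nat \<Rightarrow> real poly"
    by (induction A rule: infinite_finite_induct) (auto simp: pderiv_add)
  then show ?thesis by (simp add: hermite_sum_def pderiv_smult pderiv_hermite_poly mult.commute)
qed

lemma hermite_sum_split:
  assumes "K \<le> Suc J" "J \<le> N"
  shows "hermite_sum r a K N = hermite_sum r a K J + hermite_sum r a (Suc J) N"
proof -
  have "{K..N} = {K..J} \<union> {Suc J..N}" using assms by auto
  then show ?thesis unfolding hermite_sum_def by (subst sum.union_disjoint[symmetric]) auto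
qed

lemma square_double_sum:
  fixes z :: "nat \<Rightarrow> nat \<Rightarrow> real"
  shows "(\<Sum>k\<in>A. \<Sum>l\<in>B. z k l)\<^sup>2 = (\<Sum>k\<in>A. \<Sum>l\<in>B. \<Sum>i\<in>A. \<Sum>j\<in>B. z k l * z i j)"
  unfolding power2_eq_square by (simp only: sum_distrib_left sum_distrib_right)
     (simp only: sum_distrib_left[symmetric] sum_distrib_right[symmetric])

context unit_gaussian_sequence
begin

text \<open>
  This is the carre du champ \<open>\<langle>D S(G), D S(H)\<rangle>\<close> of the normalised sums of two functions \<open>G\<close>, \<open>H\<close> with
  derivatives \<open>g\<close>, \<open>h\<close>.
\<close>

definition gamma_form :: "real poly \<Rightarrow> real poly \<Rightarrow> nat \<Rightarrow> 'a \<Rightarrow> real" where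
  "gamma_form g h n \<omega> = (\<Sum>k=1..n. \<Sum>l=1..n. R k l * (poly g (X k \<omega>) * poly h (X l \<omega>))) / real n"

definition cov_average :: "nat \<Rightarrow> nat \<Rightarrow> real" where
  "cov_average n m = (\<Sum>k=1..n. \<Sum>l=1..n. R k l ^ m) / real n"

lemma gamma_form_commute: "gamma_form g h n \<omega> = gamma_form h g n \<omega>"
proof -
  have "(\<Sum>k=1..n. \<Sum>l=1..n. R k l * (poly g (X k \<omega>) * poly h (X l \<omega>))) =
     (\<Sum>l=1..n. \<Sum>k=1..n. R k l * (poly g (X k \<omega>) * poly h (X l \<omega>)))" by (rule sum.swap)
  also have "\<dots> = (\<Sum>l=1..n. \<Sum>k=1..n. R l k * (poly h (X l \<omega>) * poly g (X k \<omega>)))"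
    by (intro sum.cong refl) (subst R_commute, simp)
  finally show ?thesis by (simp add: gamma_form_def)
qed

lemma gamma_form_add_left: "gamma_form (g + g') h n \<omega> = gamma_form g h n \<omega> + gamma_form g' h n \<omega>"
  by (simp add: gamma_form_def algebra_simps sum.distrib add_divide_distrib)

lemma gamma_form_add_right: "gamma_form g (h + h') n \<omega> = gamma_form g h n \<omega> + gamma_form g h' n \<omega>"
  by (simp add: gamma_form_def algebra_simps sum.distrib add_divide_distrib)

lemma gamma_form_smult_left: "gamma_form (smult c g) h n \<omega> = c * gamma_form g h n \<omega>"
  by (simp add: gamma_form_def sum_distrib_left mult_ac)

lemma gamma_form_smult_right: "gamma_form g (smult c h) n \<omega> = c * gamma_form g h n \<omega>"
  by (simp add: gamma_form_def sum_distrib_left mult_ac)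

lemma gamma_form_hermite_sum:
  "gamma_form (hermite_sum r a K N) (hermite_sum r b K N) n \<omega> =
    (\<Sum>m=K..N. \<Sum>m'=K..N. (a m * b m') * gamma_form (hermite_poly (m - r)) (hermite_poly (m' - r)) n \<omega>)"
proof -
  have l: "gamma_form (\<Sum>m\<in>A. smult (c m) (p m)) h n \<omega> = (\<Sum>m\<in>A. c m * gamma_form (p m) h n \<omega>)"
    if "finite A" for A :: "nat set" and c p h using that
    by (induction A rule: finite_induct)
       (simp_all add: gamma_form_add_left gamma_form_smult_left, simp add: gamma_form_def)
  have r: "gamma_form g (\<Sum>m\<in>A. smult (c m) (p m)) n \<omega> = (\<Sum>m\<in>A. c m * gamma_form g (p m) n \<omega>)"
    if "finite A" for A :: "nat set" and c p g
    unfolding gamma_form_commute[of g] by (rule l[OF that])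
  show ?thesis
    unfolding hermite_sum_def
    unfolding l[OF finite_atLeastAtMost]
    unfolding r[OF finite_atLeastAtMost]
    by (simp add: sum_distrib_left mult.assoc)
qed

text \<open>
  With \<open>\<omega>\<close> fixed, the double sum is the second moment of the linear combination of the \<open>X k\<close> with
  coefficients \<open>poly g (X k \<omega>)\<close>.
\<close>

lemma gamma_form_nonneg: "0 \<le> gamma_form g g n \<omega>"
proof -
  have "(\<Sum>k=1..n. \<Sum>l=1..n. R k l * (poly g (X k \<omega>) * poly g (X l \<omega>))) =
     expectation (\<lambda>\<eta>. (\<Sum>k=1..n. poly g (X k \<omega>) * X k \<eta>)\<^sup>2)"
    unfolding lincomb_second_moment by (simp add: mult_ac)
  also have "\<dots> \<ge> 0" by simp
  finally show ?thesis by (simp add: gamma_form_def)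
qed

text \<open>
  Cauchy--Schwarz for the positive semidefinite form, in the additive version that can be integrated
  term by term.
\<close>

lemma gamma_form_le:
  assumes t: "0 < t"
  shows "\<bar>gamma_form g h n \<omega>\<bar> \<le> (t * gamma_form g g n \<omega> + gamma_form h h n \<omega> / t) / 2"
proof -
  have "0 \<le> t\<^sup>2 * gamma_form g g n \<omega> + 2 * t * s * gamma_form g h n \<omega> + gamma_form h h n \<omega>" if "s\<^sup>2 = 1" for s
    using gamma_form_nonneg[of "smult t g + smult s h" n \<omega>] that
    by (simp add: gamma_form_add_left gamma_form_add_right gamma_form_smult_left gamma_form_smult_right
        gamma_form_commute[of h g] power2_eq_square algebra_simps flip: mult.assoc)
  from this[of 1] this[of "-1"]
  have "2 * t * \<bar>gamma_form g h n \<omega>\<bar> \<le> t\<^sup>2 * gamma_form g g n \<omega> + gamma_form h h n \<omega>"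
    using t by (auto simp: abs_if)
  then show ?thesis using t by (simp add: field_simps power2_eq_square)
qed

lemma integrable_gamma_form: "integrable M (gamma_form g h n)"
  unfolding gamma_form_def
  by (intro integrable_divide Bochner_Integration.integrable_sum integrable_mult_right integrable_poly_X2) auto

lemma expectation_gamma_form_hermite:
  "expectation (gamma_form (hermite_poly p) (hermite_poly q) n) = (if p = q then fact p * cov_average n (Suc p) else 0)"
proof -
  have "expectation (gamma_form (hermite_poly p) (hermite_poly q) n) =
     expectation (\<lambda>\<omega>. \<Sum>k=1..n. \<Sum>l=1..n. R k l * (hermite p (X k \<omega>) * hermite q (X l \<omega>))) / real n"
    unfolding gamma_form_def hermite_eq_poly[symmetric] by (rule integral_divide_zero)
  also have "expectation (\<lambda>\<omega>. \<Sum>k=1..n. \<Sum>l=1..n. R k l * (hermite p (X k \<omega>) * hermite q (X l \<omega>))) =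
     (\<Sum>k=1..n. \<Sum>l=1..n. expectation (\<lambda>\<omega>. R k l * (hermite p (X k \<omega>) * hermite q (X l \<omega>))))"
    by (intro integral_double_sum integrable_mult_right integrable_hermite2) auto
  also have "\<dots> = (\<Sum>k=1..n. \<Sum>l=1..n. R k l * (if p = q then fact p * R k l ^ p else 0))"
    by (intro sum.cong refl) (subst integral_mult_right_zero, subst hermite_orthogonality, auto)
  also have "\<dots> / real n = (if p = q then fact p * cov_average n (Suc p) else 0)"
    by (simp add: cov_average_def sum_distrib_left mult_ac)
  finally show ?thesis .
qed

text \<open>
  The factor \<open>R k l\<close> of the form turns the power \<open>m - 1\<close> given by orthogonality into the power \<open>m\<close>.
\<close>

lemma expectation_gamma_form_hermite_sum:
  assumes "1 \<le> K"
  shows "expectation (gamma_form (hermite_sum 1 a K N) (hermite_sum 1 b K N) n) =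
    (\<Sum>m=K..N. a m * b m * fact (m - 1) * cov_average n m)"
proof -
  have "expectation (gamma_form (hermite_sum 1 a K N) (hermite_sum 1 b K N) n) =
    (\<Sum>m=K..N. \<Sum>m'=K..N. (a m * b m') * expectation (gamma_form (hermite_poly (m - 1)) (hermite_poly (m' - 1)) n))"
    unfolding gamma_form_hermite_sum
    by (subst integral_double_sum(2), intro integrable_mult_right integrable_gamma_form) simp
  also have "\<dots> = (\<Sum>m=K..N. a m * b m * fact (m - 1) * cov_average n m)"
  proof (intro sum.cong refl)
    fix m assume m: "m \<in> {K..N}"
    have "(\<Sum>m'=K..N. (a m * b m') * expectation (gamma_form (hermite_poly (m - 1)) (hermite_poly (m' - 1)) n)) =
      (\<Sum>m'=K..N. if m' = m then a m * b m * (fact (m - 1) * cov_average n m) else 0)"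
      unfolding expectation_gamma_form_hermite using m assms by (intro sum.cong refl) auto
    also have "\<dots> = a m * b m * (fact (m - 1) * cov_average n m)" using m by simp
    finally show "(\<Sum>m'=K..N. (a m * b m') * expectation (gamma_form (hermite_poly (m - 1)) (hermite_poly (m' - 1)) n)) =
      a m * b m * fact (m - 1) * cov_average n m" by simp
  qed
  finally show ?thesis .
qed

lemma expectation_square_centered_gamma_form:
  "expectation (\<lambda>\<omega>. (gamma_form (hermite_poly p) (hermite_poly q) n \<omega> -
       expectation (gamma_form (hermite_poly p) (hermite_poly q) n))\<^sup>2) =
    (\<Sum>k=1..n. \<Sum>l=1..n. \<Sum>i=1..n. \<Sum>j=1..n. R k l * R i j * hermite_cov p q p q k l i j) / (real n)\<^sup>2"
proof -
  define A where "A = (\<lambda>k l \<omega>. hermite p (X k \<omega>) * hermite q (X l \<omega>))"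
  define E where "E = (\<lambda>k l. expectation (A k l))"
  have iA: "integrable M (A k l)" if "1 \<le> k" "1 \<le> l" for k l
    unfolding A_def using that by (rule integrable_hermite2)
  have iAA: "integrable M (\<lambda>\<omega>. A k l \<omega> * A i j \<omega>)" if "1 \<le> k" "1 \<le> l" "1 \<le> i" "1 \<le> j" for k l i j
    using integrable_hermite4[OF that, of p q p q] by (simp add: A_def mult.assoc)
  have eG: "expectation (gamma_form (hermite_poly p) (hermite_poly q) n) = (\<Sum>k=1..n. \<Sum>l=1..n. R k l * E k l) / real n"
  proof -
    have "expectation (gamma_form (hermite_poly p) (hermite_poly q) n) =
       expectation (\<lambda>\<omega>. \<Sum>k=1..n. \<Sum>l=1..n. R k l * A k l \<omega>) / real n"
      unfolding gamma_form_def hermite_eq_poly[symmetric] A_def by (rule integral_divide_zero)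
    also have "expectation (\<lambda>\<omega>. \<Sum>k=1..n. \<Sum>l=1..n. R k l * A k l \<omega>) =
       (\<Sum>k=1..n. \<Sum>l=1..n. expectation (\<lambda>\<omega>. R k l * A k l \<omega>))"
      by (intro integral_double_sum integrable_mult_right iA) auto
    finally show ?thesis by (simp add: E_def)
  qed
  have diff: "gamma_form (hermite_poly p) (hermite_poly q) n \<omega> - expectation (gamma_form (hermite_poly p) (hermite_poly q) n)
     = (\<Sum>k=1..n. \<Sum>l=1..n. R k l * (A k l \<omega> - E k l)) / real n" for \<omega>
    unfolding eG gamma_form_def hermite_eq_poly[symmetric] A_def
    by (simp add: right_diff_distrib sum_subtractf diff_divide_distrib)
  have icov: "integrable M (\<lambda>\<omega>. (A k l \<omega> - E k l) * (A i j \<omega> - E i j))" (is ?i)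
    and ecov: "expectation (\<lambda>\<omega>. (A k l \<omega> - E k l) * (A i j \<omega> - E i j)) = hermite_cov p q p q k l i j" (is ?e)
    if ge: "1 \<le> k" "1 \<le> l" "1 \<le> i" "1 \<le> j" for k l i j
  proof -
    note [simp] = iAA[OF ge] iA[OF ge(1,2)] iA[OF ge(3,4)]
    have eq: "(A k l \<omega> - E k l) * (A i j \<omega> - E i j) = A k l \<omega> * A i j \<omega> - E i j * A k l \<omega> - E k l * A i j \<omega> + E k l * E i j" for \<omega>
      by (simp add: algebra_simps)
    show ?i unfolding eq by simp
    have "expectation (\<lambda>\<omega>. (A k l \<omega> - E k l) * (A i j \<omega> - E i j)) =
        expectation (\<lambda>\<omega>. A k l \<omega> * A i j \<omega>) - E i j * expectation (A k l) - E k l * expectation (A i j) + E k l * E i j"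
      unfolding eq by (simp add: prob_space)
    then show ?e by (simp add: hermite_cov_def E_def A_def)
  qed
  have "expectation (\<lambda>\<omega>. (gamma_form (hermite_poly p) (hermite_poly q) n \<omega> -
       expectation (gamma_form (hermite_poly p) (hermite_poly q) n))\<^sup>2) =
     expectation (\<lambda>\<omega>. \<Sum>k=1..n. \<Sum>l=1..n. \<Sum>i=1..n. \<Sum>j=1..n. R k l * R i j * ((A k l \<omega> - E k l) * (A i j \<omega> - E i j))) / (real n)\<^sup>2"
    unfolding diff power_divide square_double_sum by (subst integral_divide_zero) (simp only: mult_ac)
  also have "expectation (\<lambda>\<omega>. \<Sum>k=1..n. \<Sum>l=1..n. \<Sum>i=1..n. \<Sum>j=1..n. R k l * R i j * ((A k l \<omega> - E k l) * (A i j \<omega> - E i j))) =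
     (\<Sum>k=1..n. \<Sum>l=1..n. expectation (\<lambda>\<omega>. \<Sum>i=1..n. \<Sum>j=1..n. R k l * R i j * ((A k l \<omega> - E k l) * (A i j \<omega> - E i j))))"
    by (intro integral_double_sum integrable_mult_right icov) auto
  also have "\<dots> = (\<Sum>k=1..n. \<Sum>l=1..n. \<Sum>i=1..n. \<Sum>j=1..n. expectation (\<lambda>\<omega>. R k l * R i j * ((A k l \<omega> - E k l) * (A i j \<omega> - E i j))))"
    by (intro sum.cong refl integral_double_sum integrable_mult_right icov) auto
  also have "\<dots> = (\<Sum>k=1..n. \<Sum>l=1..n. \<Sum>i=1..n. \<Sum>j=1..n. R k l * R i j * hermite_cov p q p q k l i j)"
    by (intro sum.cong refl) (subst integral_mult_right_zero, subst ecov, auto)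
  finally show ?thesis .
qed

lemma integrable_square_gamma_form:
  "integrable M (\<lambda>\<omega>. (gamma_form g h n \<omega> - c)\<^sup>2)"
proof -
  have i4: "integrable M (\<lambda>\<omega>. (R k l * (poly g (X k \<omega>) * poly h (X l \<omega>))) * (R i j * (poly g (X i \<omega>) * poly h (X j \<omega>))))"
    if "1 \<le> k" "1 \<le> l" "1 \<le> i" "1 \<le> j" for k l i j
    using integrable_mult_right[OF integrable_poly_X4[OF that, of g h g h], of "R k l * R i j"] by (simp add: mult_ac)
  have "integrable M (\<lambda>\<omega>. (gamma_form g h n \<omega>)\<^sup>2)"
    unfolding gamma_form_def power_divide square_double_sum
    by (intro integrable_divide Bochner_Integration.integrable_sum i4) auto
  then have "integrable M (\<lambda>\<omega>. (gamma_form g h n \<omega>)\<^sup>2 + c\<^sup>2 - 2 * c * gamma_form g h n \<omega>)"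
    using integrable_gamma_form[of g h n] by auto
  moreover have "(gamma_form g h n \<omega> - c)\<^sup>2 = (gamma_form g h n \<omega>)\<^sup>2 + c\<^sup>2 - 2 * c * gamma_form g h n \<omega>" for \<omega>
    by (simp add: power2_diff)
  ultimately show ?thesis by simp
qed

lemma expectation_abs_le_sqrt:
  fixes Y :: "'a \<Rightarrow> real"
  assumes "integrable M Y" "integrable M (\<lambda>\<omega>. (Y \<omega>)\<^sup>2)"
  shows "expectation (\<lambda>\<omega>. \<bar>Y \<omega>\<bar>) \<le> sqrt (expectation (\<lambda>\<omega>. (Y \<omega>)\<^sup>2))"
proof -
  have "0 \<le> variance (\<lambda>\<omega>. \<bar>Y \<omega>\<bar>)" by (rule variance_positive)
  also have "\<dots> = expectation (\<lambda>\<omega>. \<bar>Y \<omega>\<bar>\<^sup>2) - (expectation (\<lambda>\<omega>. \<bar>Y \<omega>\<bar>))\<^sup>2"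
    using assms by (intro variance_eq) auto
  finally have "(expectation (\<lambda>\<omega>. \<bar>Y \<omega>\<bar>))\<^sup>2 \<le> expectation (\<lambda>\<omega>. (Y \<omega>)\<^sup>2)" by simp
  then show ?thesis by (rule real_le_rsqrt)
qed

end

locale breuer_major_setting = unit_gaussian_sequence M X for M :: "'a measure" and X +
  fixes \<rho> :: "nat \<Rightarrow> real" and d :: nat
  assumes rho_R: "1 \<le> k \<Longrightarrow> 1 \<le> l \<Longrightarrow> \<rho> (lag k l) = R k l"
    and d_pos: "1 \<le> d"
    and summable_rho: "summable (\<lambda>k. \<bar>\<rho> k\<bar> ^ d)"
begin

lemma abs_rho_le_1: "\<bar>\<rho> m\<bar> \<le> 1"
proof -
  have "\<rho> m = R (Suc m) 1" using rho_R[of "Suc m" 1] by (simp add: lag_def)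
  then show ?thesis using abs_R_le_1[of "Suc m" 1] by simp
qed

text \<open>
  The two factors \<open>R k l\<close> and \<open>R i j\<close> add one edge inside each pair, so that the degrees \<open>p + 1\<close> and \<open>q + 1\<close> are at
  least \<open>d\<close> and at least one edge joins the vertices of each pair. That is the situation of the
  diagram sums.
\<close>

lemma gamma_form_hermite_L2:
  assumes "d \<le> Suc p" "d \<le> Suc q"
  shows "(\<lambda>n. expectation (\<lambda>\<omega>. (gamma_form (hermite_poly p) (hermite_poly q) n \<omega> -
       expectation (gamma_form (hermite_poly p) (hermite_poly q) n))\<^sup>2)) \<longlonglongrightarrow> 0"
proof -
  define F where "F = (fact (p + q + p + q) :: real)"
  have F: "0 < F" by (simp add: F_def)
  define W where "W = (\<lambda>k l i j. \<bar>R k l\<bar> * \<bar>R i j\<bar> * \<bar>hermite_cov p q p q k l i j\<bar> / F)"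
  have W: "W k l i j \<le> B"
    if ge: "1 \<le> k" "1 \<le> l" "1 \<le> i" "1 \<le> j" and B: "0 \<le> B"
      and D: "\<And>a b c d' e f. a + b + c = p \<Longrightarrow> a + d' + e = q \<Longrightarrow> b + d' + f = p \<Longrightarrow> c + e + f = q \<Longrightarrow> 1 \<le> b + c + d' + e \<Longrightarrow>
       (\<bar>R k l\<bar> * \<bar>R i j\<bar>) * (\<bar>R k l\<bar> ^ a * \<bar>R k i\<bar> ^ b * \<bar>R k j\<bar> ^ c * \<bar>R l i\<bar> ^ d' * \<bar>R l j\<bar> ^ e * \<bar>R i j\<bar> ^ f) \<le> B"
    for k l i j B
  proof -
    have "diagrams_le 1 (\<bar>R k l\<bar> * \<bar>R i j\<bar>) B p q p q k l i j" by (rule diagrams_leI) (rule D)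
    then have "(\<bar>R k l\<bar> * \<bar>R i j\<bar>) * \<bar>hermite_cov p q p q k l i j\<bar> \<le> F * B"
      unfolding F_def by (intro hermite_cov_bound ge B) auto
    then show ?thesis using F by (simp add: W_def field_simps)
  qed
  have u: "\<bar>\<rho> (lag k l)\<bar> = \<bar>R k l\<bar>" if "1 \<le> k" "1 \<le> l" for k l using rho_R[OF that] by simp
  have lim: "(\<lambda>n. (\<Sum>k=1..n. \<Sum>l=1..n. \<Sum>i=1..n. \<Sum>j=1..n. W k l i j) / (real n)\<^sup>2) \<longlonglongrightarrow> 0"
  proof (rule diagram_sum_tendsto_0[OF summable_rho abs_rho_le_1 d_pos])
    fix k l i j
    show "0 \<le> W k l i j" using F by (simp add: W_def)
    assume ge: "1 \<le> k" "1 \<le> l" "1 \<le> i" "1 \<le> j"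
    note u6 = u[OF ge(1,2)] u[OF ge(1,3)] u[OF ge(1,4)] u[OF ge(2,3)] u[OF ge(2,4)] u[OF ge(3,4)]
    note bounds = diagram_monomial_bounds[OF abs_ge_zero abs_R_le_1[OF ge(1,2)] abs_ge_zero abs_R_le_1[OF ge(1,3)]
        abs_ge_zero abs_R_le_1[OF ge(1,4)] abs_ge_zero abs_R_le_1[OF ge(2,3)] abs_ge_zero abs_R_le_1[OF ge(2,4)]
        abs_ge_zero abs_R_le_1[OF ge(3,4)] _ _ _ _ _ _ assms]
    show "W k l i j \<le> 1" by (rule W[OF ge]) (auto intro!: bounds(3)[of 1])
    fix K :: real assume K: "1 \<le> K"
    show "W k l i j \<le> K ^ d * (\<bar>\<rho> (lag k l)\<bar> * \<bar>\<rho> (lag i j)\<bar>) ^ d +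
       ((\<bar>\<rho> (lag k i)\<bar> * \<bar>\<rho> (lag l j)\<bar>) ^ d + (\<bar>\<rho> (lag k j)\<bar> * \<bar>\<rho> (lag l i)\<bar>) ^ d) / K"
      unfolding u6
    proof (rule W[OF ge])
      show "0 \<le> K ^ d * (\<bar>R k l\<bar> * \<bar>R i j\<bar>) ^ d + ((\<bar>R k i\<bar> * \<bar>R l j\<bar>) ^ d + (\<bar>R k j\<bar> * \<bar>R l i\<bar>) ^ d) / K"
        using K by (intro add_nonneg_nonneg divide_nonneg_nonneg mult_nonneg_nonneg zero_le_power) auto
    qed (rule bounds(1)[OF K])
    show "W k l i j \<le> K ^ d * ((\<bar>\<rho> (lag k i)\<bar> * \<bar>\<rho> (lag l j)\<bar>) ^ d + (\<bar>\<rho> (lag k j)\<bar> * \<bar>\<rho> (lag l i)\<bar>) ^ d) +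
       (1 / K + \<bar>\<rho> (lag k i)\<bar> + \<bar>\<rho> (lag l j)\<bar>) * (\<bar>\<rho> (lag k l)\<bar> * \<bar>\<rho> (lag i j)\<bar>) ^ d"
      unfolding u6
    proof (rule W[OF ge])
      show "0 \<le> K ^ d * ((\<bar>R k i\<bar> * \<bar>R l j\<bar>) ^ d + (\<bar>R k j\<bar> * \<bar>R l i\<bar>) ^ d) +
         (1 / K + \<bar>R k i\<bar> + \<bar>R l j\<bar>) * (\<bar>R k l\<bar> * \<bar>R i j\<bar>) ^ d"
        using K by (intro add_nonneg_nonneg mult_nonneg_nonneg zero_le_power divide_nonneg_nonneg) auto
    qed (rule bounds(2)[OF K])
  qed
  show ?thesis
  proof (rule Lim_null_comparison)
    show "(\<lambda>n. F * ((\<Sum>k=1..n. \<Sum>l=1..n. \<Sum>i=1..n. \<Sum>j=1..n. W k l i j) / (real n)\<^sup>2)) \<longlonglongrightarrow> 0"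
      using tendsto_mult_left[OF lim, of F] by simp
    show "\<forall>\<^sub>F n in sequentially. norm (expectation (\<lambda>\<omega>. (gamma_form (hermite_poly p) (hermite_poly q) n \<omega> -
       expectation (gamma_form (hermite_poly p) (hermite_poly q) n))\<^sup>2)) \<le>
       F * ((\<Sum>k=1..n. \<Sum>l=1..n. \<Sum>i=1..n. \<Sum>j=1..n. W k l i j) / (real n)\<^sup>2)"
    proof (intro always_eventually allI)
      fix n
      have FW: "F * W k l i j = \<bar>R k l * R i j * hermite_cov p q p q k l i j\<bar>" for k l i j
        using F by (simp add: W_def abs_mult)
      have "norm (expectation (\<lambda>\<omega>. (gamma_form (hermite_poly p) (hermite_poly q) n \<omega> -
         expectation (gamma_form (hermite_poly p) (hermite_poly q) n))\<^sup>2)) =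
         \<bar>\<Sum>k=1..n. \<Sum>l=1..n. \<Sum>i=1..n. \<Sum>j=1..n. R k l * R i j * hermite_cov p q p q k l i j\<bar> / (real n)\<^sup>2"
        unfolding expectation_square_centered_gamma_form by simp
      also have "\<dots> \<le> (\<Sum>k=1..n. \<Sum>l=1..n. \<Sum>i=1..n. \<Sum>j=1..n. \<bar>R k l * R i j * hermite_cov p q p q k l i j\<bar>) / (real n)\<^sup>2"
        by (intro divide_right_mono order_trans[OF sum_abs] sum_mono) auto
      also have "\<dots> = F * ((\<Sum>k=1..n. \<Sum>l=1..n. \<Sum>i=1..n. \<Sum>j=1..n. W k l i j) / (real n)\<^sup>2)"
        unfolding FW[symmetric] by (simp only: sum_distrib_left times_divide_eq_right)
      finally show "norm (expectation (\<lambda>\<omega>. (gamma_form (hermite_poly p) (hermite_poly q) n \<omega> -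
         expectation (gamma_form (hermite_poly p) (hermite_poly q) n))\<^sup>2)) \<le>
         F * ((\<Sum>k=1..n. \<Sum>l=1..n. \<Sum>i=1..n. \<Sum>j=1..n. W k l i j) / (real n)\<^sup>2)" .
    qed
  qed
qed

lemma gamma_form_concentration:
  "(\<lambda>n. expectation (\<lambda>\<omega>. \<bar>gamma_form (hermite_sum 1 a d K) (hermite_sum 1 b d K) n \<omega> -
       expectation (gamma_form (hermite_sum 1 a d K) (hermite_sum 1 b d K) n)\<bar>)) \<longlonglongrightarrow> 0"
proof (rule Lim_null_comparison)
  define Y where "Y = (\<lambda>p q n \<omega>. gamma_form (hermite_poly p) (hermite_poly q) n \<omega> -
       expectation (gamma_form (hermite_poly p) (hermite_poly q) n))"
  have iY: "integrable M (Y p q n)" "integrable M (\<lambda>\<omega>. (Y p q n \<omega>)\<^sup>2)" for p q n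
    unfolding Y_def using integrable_gamma_form integrable_square_gamma_form by auto
  show "(\<lambda>n. \<Sum>m=d..K. \<Sum>m'=d..K. \<bar>a m * b m'\<bar> * sqrt (expectation (\<lambda>\<omega>. (Y (m - 1) (m' - 1) n \<omega>)\<^sup>2))) \<longlonglongrightarrow> 0"
  proof (rule tendsto_null_sum, rule tendsto_null_sum)
    fix m m' assume "m \<in> {d..K}" "m' \<in> {d..K}"
    then have "(\<lambda>n. expectation (\<lambda>\<omega>. (Y (m - 1) (m' - 1) n \<omega>)\<^sup>2)) \<longlonglongrightarrow> 0"
      unfolding Y_def using d_pos by (intro gamma_form_hermite_L2) auto
    from tendsto_mult_left[OF tendsto_real_sqrt[OF this]]
    show "(\<lambda>n. \<bar>a m * b m'\<bar> * sqrt (expectation (\<lambda>\<omega>. (Y (m - 1) (m' - 1) n \<omega>)\<^sup>2))) \<longlonglongrightarrow> 0" by simp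
  qed
  show "\<forall>\<^sub>F n in sequentially. norm (expectation (\<lambda>\<omega>. \<bar>gamma_form (hermite_sum 1 a d K) (hermite_sum 1 b d K) n \<omega> -
       expectation (gamma_form (hermite_sum 1 a d K) (hermite_sum 1 b d K) n)\<bar>)) \<le>
     (\<Sum>m=d..K. \<Sum>m'=d..K. \<bar>a m * b m'\<bar> * sqrt (expectation (\<lambda>\<omega>. (Y (m - 1) (m' - 1) n \<omega>)\<^sup>2)))"
  proof (intro always_eventually allI)
    fix n
    have e: "expectation (gamma_form (hermite_sum 1 a d K) (hermite_sum 1 b d K) n) =
      (\<Sum>m=d..K. \<Sum>m'=d..K. (a m * b m') * expectation (gamma_form (hermite_poly (m - 1)) (hermite_poly (m' - 1)) n))"
      unfolding gamma_form_hermite_sum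
      by (subst integral_double_sum(2), intro integrable_mult_right integrable_gamma_form) simp
    have diff: "gamma_form (hermite_sum 1 a d K) (hermite_sum 1 b d K) n \<omega> -
       expectation (gamma_form (hermite_sum 1 a d K) (hermite_sum 1 b d K) n) =
       (\<Sum>m=d..K. \<Sum>m'=d..K. (a m * b m') * Y (m - 1) (m' - 1) n \<omega>)" for \<omega>
      unfolding e unfolding gamma_form_hermite_sum Y_def by (simp add: sum_subtractf right_diff_distrib)
    have "expectation (\<lambda>\<omega>. \<bar>gamma_form (hermite_sum 1 a d K) (hermite_sum 1 b d K) n \<omega> -
       expectation (gamma_form (hermite_sum 1 a d K) (hermite_sum 1 b d K) n)\<bar>) \<le>
       expectation (\<lambda>\<omega>. \<Sum>m=d..K. \<Sum>m'=d..K. \<bar>a m * b m'\<bar> * \<bar>Y (m - 1) (m' - 1) n \<omega>\<bar>)"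
      unfolding diff
      by (intro integral_mono integrable_abs Bochner_Integration.integrable_sum integrable_mult_right iY
          order_trans[OF sum_abs] sum_mono) (simp add: abs_mult)
    also have "\<dots> = (\<Sum>m=d..K. \<Sum>m'=d..K. \<bar>a m * b m'\<bar> * expectation (\<lambda>\<omega>. \<bar>Y (m - 1) (m' - 1) n \<omega>\<bar>))"
      by (subst integral_double_sum(2), intro integrable_mult_right integrable_abs iY) simp
    also have "\<dots> \<le> (\<Sum>m=d..K. \<Sum>m'=d..K. \<bar>a m * b m'\<bar> * sqrt (expectation (\<lambda>\<omega>. (Y (m - 1) (m' - 1) n \<omega>)\<^sup>2)))"
      by (intro sum_mono mult_left_mono expectation_abs_le_sqrt iY) auto
    finally show "norm (expectation (\<lambda>\<omega>. \<bar>gamma_form (hermite_sum 1 a d K) (hermite_sum 1 b d K) n \<omega> -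
       expectation (gamma_form (hermite_sum 1 a d K) (hermite_sum 1 b d K) n)\<bar>)) \<le>
       (\<Sum>m=d..K. \<Sum>m'=d..K. \<bar>a m * b m'\<bar> * sqrt (expectation (\<lambda>\<omega>. (Y (m - 1) (m' - 1) n \<omega>)\<^sup>2)))"
      by simp
  qed
qed

end

section \<open>Hermite coefficients in the Malliavin--Sobolev space\<close>

lemma integrable_hermite_poly_std: "integrable std_gaussian (\<lambda>x. hermite m x * poly q x)"
  using integrable_std_gaussian_poly[of "hermite_poly m * q"] by (simp add: hermite_eq_poly)

lemma integral_hermite_Suc_poly:
  "(\<integral>x. hermite (Suc m) x * poly q x \<partial>std_gaussian) = (\<integral>x. hermite m x * poly (pderiv q) x \<partial>std_gaussian)"
proof -
  let ?p = "hermite_poly m * q"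
  have "(\<integral>x. x * poly ?p x \<partial>std_gaussian) = (\<integral>x. poly (pderiv ?p) x \<partial>std_gaussian)"
  proof (rule std_gaussian_integration_by_parts)
    show "(poly ?p has_real_derivative poly (pderiv ?p) x) (at x)" for x by (rule poly_DERIV)
    show "continuous_on UNIV (poly (pderiv ?p))" by (intro continuous_intros)
    show "integrable std_gaussian (\<lambda>x. x * poly ?p x)"
      using integrable_std_gaussian_poly[of "[:0,1:] * ?p"] by simp
  qed (rule integrable_std_gaussian_poly)
  also have "\<dots> = (\<integral>x. poly (pderiv (hermite_poly m) * q) x + poly (hermite_poly m * pderiv q) x \<partial>std_gaussian)"
    by (simp add: pderiv_mult algebra_simps)
  also have "\<dots> = (\<integral>x. poly (pderiv (hermite_poly m) * q) x \<partial>std_gaussian) + (\<integral>x. poly (hermite_poly m * pderiv q) x \<partial>std_gaussian)"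
    by (intro Bochner_Integration.integral_add integrable_std_gaussian_poly)
  finally have "(\<integral>x. x * poly ?p x \<partial>std_gaussian) - (\<integral>x. poly (pderiv (hermite_poly m) * q) x \<partial>std_gaussian) =
     (\<integral>x. poly (hermite_poly m * pderiv q) x \<partial>std_gaussian)" by simp
  also have "(\<integral>x. x * poly ?p x \<partial>std_gaussian) - (\<integral>x. poly (pderiv (hermite_poly m) * q) x \<partial>std_gaussian) =
     (\<integral>x. poly ([:0,1:] * ?p) x - poly (pderiv (hermite_poly m) * q) x \<partial>std_gaussian)"
  proof -
    have e: "(\<lambda>x. x * poly ?p x) = (\<lambda>x. poly ([:0,1:] * ?p) x)" by (auto simp: fun_eq_iff)
    show ?thesis unfolding e
      by (rule Bochner_Integration.integral_diff[symmetric]) (rule integrable_std_gaussian_poly)+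
  qed
  also have "\<dots> = (\<integral>x. hermite (Suc m) x * poly q x \<partial>std_gaussian)"
    by (simp add: hermite_eq_poly algebra_simps)
  finally show ?thesis by (simp add: hermite_eq_poly)
qed

lemma hermite_orthogonality_std:
  "(\<integral>x. hermite p x * hermite q x \<partial>std_gaussian) = (if p = q then fact p else 0)"
proof (induction p arbitrary: q)
  case 0
  show ?case
  proof (cases q)
    case (Suc q')
    then show ?thesis using integral_hermite_Suc_poly[of q' 1] by simp
  qed simp
next
  case (Suc p)
  have "(\<integral>x. hermite (Suc p) x * hermite q x \<partial>std_gaussian) = (\<integral>x. real q * (hermite p x * hermite (q - 1) x) \<partial>std_gaussian)"
    using integral_hermite_Suc_poly[of p "hermite_poly q"] by (simp add: hermite_eq_poly pderiv_hermite_poly mult_ac)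
  also have "\<dots> = real q * (if p = q - 1 then fact p else 0)" by (simp add: Suc.IH)
  finally show ?case by (cases q) auto
qed

text \<open>
  Bessel's inequality for the orthogonal system of Hermite polynomials. The index is shifted
  because it will be applied to a derivative, whose coefficient against \<open>H (m - 1)\<close> is the coefficient
  of the function itself against \<open>H m\<close>.
\<close>

lemma Bessel_hermite:
  "(\<Sum>m=1..N. (\<integral>x. hermite (m - 1) x * poly q x \<partial>std_gaussian)\<^sup>2 / fact (m - 1)) \<le> (\<integral>x. (poly q x)\<^sup>2 \<partial>std_gaussian)"
proof -
  \<comment> \<open>\<open>S\<close> is the orthogonal projection of \<open>q\<close> on the span of the first \<open>N\<close> Hermite polynomials.\<close>
  define b where "b = (\<lambda>m. (\<integral>x. hermite (m - 1) x * poly q x \<partial>std_gaussian) / fact (m - 1))"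
  define S where "S = hermite_sum 1 b 1 N"
  have S: "poly S x = (\<Sum>m=1..N. b m * hermite (m - 1) x)" for x by (simp add: S_def poly_hermite_sum)
  have iqS: "(\<integral>x. poly q x * poly S x \<partial>std_gaussian) = (\<Sum>m=1..N. b m * (b m * fact (m - 1)))"
  proof -
    have "(\<integral>x. poly q x * poly S x \<partial>std_gaussian) = (\<integral>x. (\<Sum>m=1..N. b m * (hermite (m - 1) x * poly q x)) \<partial>std_gaussian)"
      by (simp add: S sum_distrib_left mult_ac)
    also have "\<dots> = (\<Sum>m=1..N. b m * (\<integral>x. hermite (m - 1) x * poly q x \<partial>std_gaussian))"
      by (subst Bochner_Integration.integral_sum) (auto intro!: integrable_mult_right integrable_hermite_poly_std)
    finally show ?thesis by (simp add: b_def)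
  qed
  have iSS: "(\<integral>x. poly S x * poly S x \<partial>std_gaussian) = (\<Sum>m=1..N. b m * (b m * fact (m - 1)))"
  proof -
    have "(\<integral>x. poly S x * poly S x \<partial>std_gaussian) = (\<integral>x. (\<Sum>m=1..N. b m * (hermite (m - 1) x * poly S x)) \<partial>std_gaussian)"
      by (simp add: S sum_distrib_left sum_distrib_right mult_ac)
    also have "\<dots> = (\<Sum>m=1..N. b m * (\<integral>x. hermite (m - 1) x * poly S x \<partial>std_gaussian))"
      by (subst Bochner_Integration.integral_sum) (auto intro!: integrable_mult_right integrable_hermite_poly_std)
    also have "\<dots> = (\<Sum>m=1..N. b m * (b m * fact (m - 1)))"
    proof (intro sum.cong refl arg_cong[of _ _ "(*) (b _)"])
      fix m assume m: "m \<in> {1..N}"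
      have "(\<integral>x. hermite (m - 1) x * poly S x \<partial>std_gaussian) =
          (\<integral>x. (\<Sum>m'=1..N. b m' * (hermite (m - 1) x * hermite (m' - 1) x)) \<partial>std_gaussian)"
        by (simp add: S sum_distrib_left mult_ac)
      also have "\<dots> = (\<Sum>m'=1..N. b m' * (\<integral>x. hermite (m - 1) x * hermite (m' - 1) x \<partial>std_gaussian))"
        using integrable_hermite_poly_std[of "m - 1" "hermite_poly _"]
        by (subst Bochner_Integration.integral_sum) (auto intro!: integrable_mult_right simp: hermite_eq_poly)
      also have "\<dots> = (\<Sum>m'=1..N. if m' = m then b m * fact (m - 1) else 0)"
        unfolding hermite_orthogonality_std using m by (intro sum.cong refl) auto
      also have "\<dots> = b m * fact (m - 1)" using m by simp
      finally show "(\<integral>x. hermite (m - 1) x * poly S x \<partial>std_gaussian) = b m * fact (m - 1)" .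
    qed
    finally show ?thesis .
  qed
  have i2: "integrable std_gaussian (\<lambda>x. poly p x * poly p' x)" for p p'
    using integrable_std_gaussian_poly[of "p * p'"] by simp
  have "0 \<le> (\<integral>x. (poly q x - poly S x)\<^sup>2 \<partial>std_gaussian)" by simp
  also have "(\<lambda>x. (poly q x - poly S x)\<^sup>2) = (\<lambda>x. poly q x * poly q x - 2 * (poly q x * poly S x) + poly S x * poly S x)"
    by (auto simp: fun_eq_iff power2_eq_square algebra_simps)
  also have "(\<integral>x. poly q x * poly q x - 2 * (poly q x * poly S x) + poly S x * poly S x \<partial>std_gaussian) =
     (\<integral>x. poly q x * poly q x \<partial>std_gaussian) - 2 * (\<integral>x. poly q x * poly S x \<partial>std_gaussian) + (\<integral>x. poly S x * poly S x \<partial>std_gaussian)"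
    using i2 by simp
  also have "\<dots> = (\<integral>x. (poly q x)\<^sup>2 \<partial>std_gaussian) - (\<Sum>m=1..N. b m * (b m * fact (m - 1)))"
    unfolding iqS iSS by (simp add: power2_eq_square)
  finally have "(\<Sum>m=1..N. b m * (b m * fact (m - 1))) \<le> (\<integral>x. (poly q x)\<^sup>2 \<partial>std_gaussian)" by simp
  then show ?thesis by (simp add: b_def power2_eq_square)
qed

text \<open>
  Cauchy--Schwarz in additive form; optimizing over \<open>t\<close> would give the product of the norms.
\<close>

lemma abs_integral_mult_le:
  fixes f g :: "'a \<Rightarrow> real"
  assumes [measurable]: "f \<in> borel_measurable M" "g \<in> borel_measurable M"
    and f: "integrable M (\<lambda>x. (f x)\<^sup>2)" and g: "integrable M (\<lambda>x. (g x)\<^sup>2)"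
  shows "integrable M (\<lambda>x. f x * g x)"
    and "t > 0 \<Longrightarrow> \<bar>\<integral>x. f x * g x \<partial>M\<bar> \<le> (t * (\<integral>x. (f x)\<^sup>2 \<partial>M) + (\<integral>x. (g x)\<^sup>2 \<partial>M) / t) / 2"
proof -
  have le: "\<bar>f x * g x\<bar> \<le> (t * (f x)\<^sup>2 + (g x)\<^sup>2 / t) / 2" if t: "t > 0" for t x
  proof -
    have "0 \<le> (t * \<bar>f x\<bar> - \<bar>g x\<bar>)\<^sup>2" by simp
    then have "2 * t * \<bar>f x * g x\<bar> \<le> t * (t * (f x)\<^sup>2) + (g x)\<^sup>2"
      by (simp add: power2_diff abs_mult power_mult_distrib power2_eq_square algebra_simps)
    then show ?thesis using t by (simp add: field_simps)
  qed
  show i: "integrable M (\<lambda>x. f x * g x)"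
  proof (rule Bochner_Integration.integrable_bound)
    show "integrable M (\<lambda>x. (1 * (f x)\<^sup>2 + (g x)\<^sup>2 / 1) / 2)" using f g by simp
    show "AE x in M. norm (f x * g x) \<le> norm ((1 * (f x)\<^sup>2 + (g x)\<^sup>2 / 1) / 2)"
      using le[of 1] by (intro AE_I2) auto
  qed measurable
  show "\<bar>\<integral>x. f x * g x \<partial>M\<bar> \<le> (t * (\<integral>x. (f x)\<^sup>2 \<partial>M) + (\<integral>x. (g x)\<^sup>2 \<partial>M) / t) / 2" if t: "t > 0"
  proof -
    have "\<bar>\<integral>x. f x * g x \<partial>M\<bar> \<le> (\<integral>x. \<bar>f x * g x\<bar> \<partial>M)" by (rule integral_abs_bound)
    also have "\<dots> \<le> (\<integral>x. (t * (f x)\<^sup>2 + (g x)\<^sup>2 / t) / 2 \<partial>M)"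
      using i f g le[OF t] by (intro integral_mono) auto
    also have "\<dots> = (t * (\<integral>x. (f x)\<^sup>2 \<partial>M) + (\<integral>x. (g x)\<^sup>2 \<partial>M) / t) / 2" using f g by simp
    finally show ?thesis .
  qed
qed

lemma tendsto_integral_mult_L2:
  fixes f :: "'a \<Rightarrow> real" and g :: "nat \<Rightarrow> 'a \<Rightarrow> real"
  assumes [measurable]: "f \<in> borel_measurable M" "\<And>j. g j \<in> borel_measurable M"
    and f: "integrable M (\<lambda>x. (f x)\<^sup>2)" and g: "\<And>j. integrable M (\<lambda>x. (g j x)\<^sup>2)"
    and lim: "(\<lambda>j. \<integral>x. (g j x)\<^sup>2 \<partial>M) \<longlonglongrightarrow> 0"
  shows "(\<lambda>j. \<integral>x. f x * g j x \<partial>M) \<longlonglongrightarrow> 0"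
proof (rule LIMSEQ_I)
  fix r :: real assume r: "0 < r"
  define A where "A = (\<integral>x. (f x)\<^sup>2 \<partial>M)"
  have A: "0 \<le> A" by (simp add: A_def)
  define t where "t = r / (A + 1)"
  have t: "0 < t" "t * A \<le> r"
    using A r by (auto simp: t_def field_simps)
  have "0 < r * t" using r t by simp
  then obtain j0 where j0: "\<And>j. j \<ge> j0 \<Longrightarrow> \<bar>\<integral>x. (g j x)\<^sup>2 \<partial>M\<bar> < r * t"
    using LIMSEQ_D[OF lim] by auto
  show "\<exists>no. \<forall>n\<ge>no. norm ((\<integral>x. f x * g n x \<partial>M) - 0) < r"
  proof (intro exI allI impI)
    fix n assume "j0 \<le> n"
    then have "(\<integral>x. (g n x)\<^sup>2 \<partial>M) / t < r" using j0[of n] t by (simp add: field_simps abs_less_iff)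
    then have "(t * A + (\<integral>x. (g n x)\<^sup>2 \<partial>M) / t) / 2 < r" using t(2) by simp
    moreover have "\<bar>\<integral>x. f x * g n x \<partial>M\<bar> \<le> (t * A + (\<integral>x. (g n x)\<^sup>2 \<partial>M) / t) / 2"
      unfolding A_def by (rule abs_integral_mult_le(2)) (use f g t in auto)
    ultimately show "norm ((\<integral>x. f x * g n x \<partial>M) - 0) < r" by simp
  qed
qed

lemma integrable_square_diff:
  fixes f g :: "'a \<Rightarrow> real"
  assumes [measurable]: "f \<in> borel_measurable M" "g \<in> borel_measurable M"
    and f: "integrable M (\<lambda>x. (f x)\<^sup>2)" and g: "integrable M (\<lambda>x. (g x)\<^sup>2)"
  shows "integrable M (\<lambda>x. (f x - g x)\<^sup>2)"
proof -
  have "(\<lambda>x. (f x - g x)\<^sup>2) = (\<lambda>x. (f x)\<^sup>2 + (g x)\<^sup>2 - 2 * (f x * g x))"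
    by (auto simp: fun_eq_iff power2_eq_square algebra_simps)
  then show ?thesis using f g abs_integral_mult_le(1)[OF assms] by simp
qed

lemma L2_norm_gaussian_tendsto_0_iff:
  "(\<lambda>j. L2_norm_gaussian (F j)) \<longlonglongrightarrow> 0 \<longleftrightarrow> (\<lambda>j. \<integral>x. (F j x)\<^sup>2 \<partial>std_gaussian) \<longlonglongrightarrow> 0"
proof
  assume "(\<lambda>j. L2_norm_gaussian (F j)) \<longlonglongrightarrow> 0"
  from tendsto_power[OF this, of 2] show "(\<lambda>j. \<integral>x. (F j x)\<^sup>2 \<partial>std_gaussian) \<longlonglongrightarrow> 0"
    by (simp add: L2_norm_gaussian_def)
next
  assume "(\<lambda>j. \<integral>x. (F j x)\<^sup>2 \<partial>std_gaussian) \<longlonglongrightarrow> 0"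
  from tendsto_real_sqrt[OF this] show "(\<lambda>j. L2_norm_gaussian (F j)) \<longlonglongrightarrow> 0"
    by (simp add: L2_norm_gaussian_def)
qed

text \<open>
  For \<open>N \<ge> m\<close>, the truncation at \<open>N\<close> has this coefficient exactly, and the \<open>L\<^sup>2\<close> error tends to 0.
\<close>

lemma hermite_expansion_coefficient:
  assumes exp: "has_hermite_expansion_from f d c" and m: "d \<le> m"
  shows "(\<integral>x. hermite m x * f x \<partial>std_gaussian) = fact m * c m"
proof -
  have f: "f \<in> borel_measurable borel" "integrable std_gaussian (\<lambda>x. (f x)\<^sup>2)"
    and lim: "(\<lambda>N. \<integral>x. (f x - poly (hermite_sum 0 c d N) x)\<^sup>2 \<partial>std_gaussian) \<longlonglongrightarrow> 0"
    using exp by (auto simp: has_hermite_expansion_from_def L2_gaussian_def L2_norm_gaussian_tendsto_0_iff poly_hermite_sum)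
  note [measurable] = f(1)
  note i2 = square_integrable_poly
  have h2: "integrable std_gaussian (\<lambda>x. (hermite m x)\<^sup>2)"
    using i2[of "hermite_poly m"] by (simp add: hermite_eq_poly)
  have "(\<lambda>N. \<integral>x. hermite m x * (f x - poly (hermite_sum 0 c d N) x) \<partial>std_gaussian) \<longlonglongrightarrow> 0"
    by (intro tendsto_integral_mult_L2 h2 lim integrable_square_diff f(2) i2) measurable
  moreover have "\<forall>\<^sub>F N in sequentially. (\<integral>x. hermite m x * (f x - poly (hermite_sum 0 c d N) x) \<partial>std_gaussian) =
      (\<integral>x. hermite m x * f x \<partial>std_gaussian) - fact m * c m"
    unfolding eventually_sequentially
  proof (intro exI allI impI)
    fix N assume N: "m \<le> N"
    have ihf: "integrable std_gaussian (\<lambda>x. hermite m x * f x)"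
      by (rule abs_integral_mult_le(1)) (use h2 f in measurable)
    have "(\<integral>x. hermite m x * (f x - poly (hermite_sum 0 c d N) x) \<partial>std_gaussian) =
      (\<integral>x. hermite m x * f x \<partial>std_gaussian) - (\<integral>x. hermite m x * poly (hermite_sum 0 c d N) x \<partial>std_gaussian)"
      unfolding right_diff_distrib by (rule Bochner_Integration.integral_diff[OF ihf integrable_hermite_poly_std])
    also have "(\<integral>x. hermite m x * poly (hermite_sum 0 c d N) x \<partial>std_gaussian) =
      (\<integral>x. (\<Sum>m'=d..N. c m' * (hermite m x * hermite m' x)) \<partial>std_gaussian)"
      by (simp add: poly_hermite_sum sum_distrib_left mult_ac)
    also have "\<dots> = (\<Sum>m'=d..N. c m' * (\<integral>x. hermite m x * hermite m' x \<partial>std_gaussian))"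
      using integrable_hermite_poly_std[of m "hermite_poly _"]
      by (subst Bochner_Integration.integral_sum) (auto intro!: integrable_mult_right simp: hermite_eq_poly)
    also have "\<dots> = (\<Sum>m'=d..N. if m' = m then fact m * c m else 0)"
      unfolding hermite_orthogonality_std by (intro sum.cong refl) auto
    also have "\<dots> = fact m * c m" using N m by simp
    finally show "(\<integral>x. hermite m x * (f x - poly (hermite_sum 0 c d N) x) \<partial>std_gaussian) =
      (\<integral>x. hermite m x * f x \<partial>std_gaussian) - fact m * c m" .
  qed
  ultimately have "(\<lambda>N. (\<integral>x. hermite m x * f x \<partial>std_gaussian) - fact m * c m) \<longlonglongrightarrow> 0"
    by (simp cong: tendsto_cong)
  then show ?thesis by (simp add: LIMSEQ_const_iff)
qed

text \<open>
  Let \<open>q n\<close> be polynomials approximating \<open>f\<close>. Their derivatives are bounded in \<open>L\<^sup>2\<close>, and integration by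
  parts turns Bessel's inequality for \<open>(q n)'\<close> into a bound on
  \<open>(\<Sum>m. (\<integral> H m * q n)\<^sup>2 / (m - 1)!)\<close>. Only finitely many coefficients are involved at a time, so the bound passes
  to \<open>f\<close>, for which the coefficient is \<open>m! * c m\<close>.
\<close>

lemma summable_malliavin_hermite:
  assumes exp: "has_hermite_expansion_from f d c" and f: "f \<in> malliavin_sobolev" and d: "1 \<le> d"
  shows "summable (\<lambda>m. real m * fact m * (c m)\<^sup>2)"
proof -
  obtain q :: "nat \<Rightarrow> real poly" where
    cauchy: "\<And>e. e > 0 \<Longrightarrow> \<exists>N. \<forall>m\<ge>N. \<forall>n\<ge>N. norm_1_2 (q m - q n) < e"
    and lim: "(\<lambda>n. \<integral>x. (f x - poly (q n) x)\<^sup>2 \<partial>std_gaussian) \<longlonglongrightarrow> 0"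
    and fm [measurable]: "f \<in> borel_measurable borel" and f2: "integrable std_gaussian (\<lambda>x. (f x)\<^sup>2)"
    using f unfolding malliavin_sobolev_def L2_gaussian_def L2_norm_gaussian_tendsto_0_iff by blast
  note i2 = square_integrable_poly
  obtain N where N: "\<And>m n. m \<ge> N \<Longrightarrow> n \<ge> N \<Longrightarrow> norm_1_2 (q m - q n) < 1" using cauchy[of 1] by auto
  define B where "B = 2 + 2 * (\<integral>x. (poly (pderiv (q N)) x)\<^sup>2 \<partial>std_gaussian)"
  have B: "(\<integral>x. (poly (pderiv (q n)) x)\<^sup>2 \<partial>std_gaussian) \<le> B" if n: "n \<ge> N" for n
  proof -
    let ?D = "poly (pderiv (q n - q N))"
    have "(\<integral>x. (?D x)\<^sup>2 \<partial>std_gaussian) \<le> (\<integral>x. (poly (q n - q N) x)\<^sup>2 + (?D x)\<^sup>2 \<partial>std_gaussian)"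
      by (intro integral_mono i2 Bochner_Integration.integrable_add) auto
    also have "\<dots> < 1" using N[OF n order_refl] by (simp add: norm_1_2_def)
    finally have 1: "(\<integral>x. (?D x)\<^sup>2 \<partial>std_gaussian) \<le> 1" by simp
    have "(\<integral>x. (poly (pderiv (q n)) x)\<^sup>2 \<partial>std_gaussian) \<le> (\<integral>x. 2 * (?D x)\<^sup>2 + 2 * (poly (pderiv (q N)) x)\<^sup>2 \<partial>std_gaussian)"
    proof (intro integral_mono i2 Bochner_Integration.integrable_add integrable_mult_right)
      fix x
      have "(a + b)\<^sup>2 \<le> 2 * a\<^sup>2 + 2 * b\<^sup>2" for a b :: real
        using zero_le_power2[of "a - b"] by (simp add: power2_eq_square algebra_simps)
      from this[of "?D x" "poly (pderiv (q N)) x"]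
      show "(poly (pderiv (q n)) x)\<^sup>2 \<le> 2 * (?D x)\<^sup>2 + 2 * (poly (pderiv (q N)) x)\<^sup>2"
        by (simp add: pderiv_diff)
    qed
    also have "\<dots> = 2 * (\<integral>x. (?D x)\<^sup>2 \<partial>std_gaussian) + 2 * (\<integral>x. (poly (pderiv (q N)) x)\<^sup>2 \<partial>std_gaussian)"
      using i2 by simp
    finally show ?thesis using 1 by (simp add: B_def)
  qed
  have bound: "(\<Sum>m=d..J. real m * fact m * (c m)\<^sup>2) \<le> B" for J
  proof -
    have conv: "(\<lambda>n. \<integral>x. hermite m x * poly (q n) x \<partial>std_gaussian) \<longlonglongrightarrow> fact m * c m" if m: "d \<le> m" for m
    proof -
      have h2: "integrable std_gaussian (\<lambda>x. (hermite m x)\<^sup>2)"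
        using i2[of "hermite_poly m"] by (simp add: hermite_eq_poly)
      have ihf: "integrable std_gaussian (\<lambda>x. hermite m x * f x)"
        by (rule abs_integral_mult_le(1)) (use h2 f2 in measurable)
      have "(\<lambda>n. \<integral>x. hermite m x * (f x - poly (q n) x) \<partial>std_gaussian) \<longlonglongrightarrow> 0"
        by (intro tendsto_integral_mult_L2 h2 lim integrable_square_diff f2 i2) measurable
      then have "(\<lambda>n. (\<integral>x. hermite m x * f x \<partial>std_gaussian) - (\<integral>x. hermite m x * poly (q n) x \<partial>std_gaussian)) \<longlonglongrightarrow> 0"
        unfolding right_diff_distrib by (subst (asm) Bochner_Integration.integral_diff[OF ihf integrable_hermite_poly_std])
      from tendsto_diff[OF tendsto_const[of "\<integral>x. hermite m x * f x \<partial>std_gaussian"] this] show ?thesis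
        unfolding hermite_expansion_coefficient[OF exp m] by simp
    qed
    have "(\<lambda>n. \<Sum>m=d..J. (\<integral>x. hermite m x * poly (q n) x \<partial>std_gaussian)\<^sup>2 / fact (m - 1)) \<longlonglongrightarrow>
       (\<Sum>m=d..J. (fact m * c m)\<^sup>2 / fact (m - 1))"
      by (intro tendsto_sum tendsto_divide tendsto_power conv tendsto_const) auto
    moreover have "\<forall>\<^sub>F n in sequentially. (\<Sum>m=d..J. (\<integral>x. hermite m x * poly (q n) x \<partial>std_gaussian)\<^sup>2 / fact (m - 1)) \<le> B"
      unfolding eventually_sequentially
    proof (intro exI allI impI)
      fix n assume n: "N \<le> n"
      have "(\<Sum>m=d..J. (\<integral>x. hermite m x * poly (q n) x \<partial>std_gaussian)\<^sup>2 / fact (m - 1)) =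
         (\<Sum>m=d..J. (\<integral>x. hermite (m - 1) x * poly (pderiv (q n)) x \<partial>std_gaussian)\<^sup>2 / fact (m - 1))"
      proof (intro sum.cong refl)
        fix m assume "m \<in> {d..J}"
        then have "m = Suc (m - 1)" using d by auto
        then show "(\<integral>x. hermite m x * poly (q n) x \<partial>std_gaussian)\<^sup>2 / fact (m - 1) =
          (\<integral>x. hermite (m - 1) x * poly (pderiv (q n)) x \<partial>std_gaussian)\<^sup>2 / fact (m - 1)"
          using integral_hermite_Suc_poly[of "m - 1" "q n"] by simp
      qed
      also have "\<dots> \<le> (\<Sum>m=1..J. (\<integral>x. hermite (m - 1) x * poly (pderiv (q n)) x \<partial>std_gaussian)\<^sup>2 / fact (m - 1))"
        using d by (intro sum_mono2) auto
      also have "\<dots> \<le> B" using Bessel_hermite B[OF n] by (rule order_trans)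
      finally show "(\<Sum>m=d..J. (\<integral>x. hermite m x * poly (q n) x \<partial>std_gaussian)\<^sup>2 / fact (m - 1)) \<le> B" .
    qed
    ultimately have "(\<Sum>m=d..J. (fact m * c m)\<^sup>2 / fact (m - 1)) \<le> B"
      by (rule tendsto_upperbound) simp
    moreover have "(fact m * c m)\<^sup>2 / fact (m - 1) = real m * fact m * (c m)\<^sup>2" if "m \<in> {d..J}" for m
    proof -
      have "fact m = real m * fact (m - 1)" using that d by (intro fact_reduce) auto
      then show ?thesis by (simp add: power2_eq_square)
    qed
    ultimately show ?thesis by simp
  qed
  show ?thesis
  proof (rule summableI_nonneg_bounded)
    fix n
    have "(\<Sum>m<n. real m * fact m * (c m)\<^sup>2) \<le> (\<Sum>m\<in>{..<d} \<union> {d..n}. real m * fact m * (c m)\<^sup>2)"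
      by (intro sum_mono2) auto
    also have "\<dots> = (\<Sum>m<d. real m * fact m * (c m)\<^sup>2) + (\<Sum>m=d..n. real m * fact m * (c m)\<^sup>2)"
      by (intro sum.union_disjoint) auto
    also have "\<dots> \<le> (\<Sum>m<d. real m * fact m * (c m)\<^sup>2) + B" using bound by simp
    finally show "(\<Sum>m<n. real m * fact m * (c m)\<^sup>2) \<le> (\<Sum>m<d. real m * fact m * (c m)\<^sup>2) + B" .
  qed simp
qed

section \<open>The Stein bound\<close>

lemma integrable_times_bounded:
  fixes f b :: "'a \<Rightarrow> real"
  assumes f: "integrable M f" and b [measurable]: "b \<in> borel_measurable M" and B: "\<And>x. \<bar>b x\<bar> \<le> B"
  shows "integrable M (\<lambda>x. f x * b x)"
proof (rule Bochner_Integration.integrable_bound)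
  show "integrable M (\<lambda>x. B * f x)" using f by simp
  show "(\<lambda>x. f x * b x) \<in> borel_measurable M" using f by measurable
  show "AE x in M. norm (f x * b x) \<le> norm (B * f x)"
  proof (rule AE_I2)
    fix x
    have "\<bar>b x\<bar> \<le> \<bar>B\<bar>" using B[of x] by linarith
    then show "norm (f x * b x) \<le> norm (B * f x)"
      by (simp add: abs_mult mult.commute[of "\<bar>B\<bar>"] mult_left_mono)
  qed
qed

context unit_gaussian_sequence
begin

text \<open>
  Stein's equation and the integration by parts formula turn the left-hand side into
  \<open>E (\<phi>' Z * (1 - G / s\<^sup>2))\<close> with \<open>\<bar>\<phi>'\<bar> \<le> 2\<close>. The number \<open>s\<^sup>2\<close> need not be the variance of the polynomial sum; in the
  application it is the variance for \<open>f\<close> itself.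
\<close>

lemma stein_bound:
  fixes h :: "real \<Rightarrow> real" and c :: "nat \<Rightarrow> real" and s :: real and d n N :: nat
  assumes n: "1 \<le> n" and d: "1 \<le> d" and s: "0 < s"
    and h: "continuous_on UNIV h" "\<And>x. 0 \<le> h x" "\<And>x. h x \<le> 1"
  defines "G \<equiv> gamma_form (hermite_sum 1 c d N) (hermite_sum 1 (\<lambda>m. real m * c m) d N) n"
  shows "\<bar>expectation (\<lambda>\<omega>. h (partial_sum (poly (hermite_sum 0 c d N)) X n \<omega> / s)) - (\<integral>x. h x \<partial>std_gaussian)\<bar>
     \<le> 2 / s\<^sup>2 * expectation (\<lambda>\<omega>. \<bar>s\<^sup>2 - G \<omega>\<bar>)"
proof -
  obtain \<phi> \<phi>' where \<phi>: "\<And>x. (\<phi> has_real_derivative \<phi>' x) (at x)" "continuous_on UNIV \<phi>'"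
    "\<And>x. \<bar>\<phi>' x\<bar> \<le> 2" "bounded (range \<phi>)"
    and stein: "\<And>x. \<phi>' x - x * \<phi> x = h x - (\<integral>y. h y \<partial>std_gaussian)"
    by (rule stein_equation_solution[OF h]) blast
  obtain B where B: "\<And>x. \<bar>\<phi> x\<bar> \<le> B" using \<phi>(4) by (auto simp: bounded_real)
  have c\<phi>: "continuous_on UNIV \<phi>" using \<phi>(1) by (meson DERIV_isCont continuous_at_imp_continuous_on)
  have [measurable]: "\<phi> \<in> borel_measurable borel" "\<phi>' \<in> borel_measurable borel" "h \<in> borel_measurable borel"
    using c\<phi> \<phi>(2) h(1) by (auto intro: borel_measurable_continuous_onI)
  define \<alpha> where "\<alpha> = 1 / (sqrt (real n) * s)"
  define g where "g = smult \<alpha> (hermite_sum 0 c d N)"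
  define Z where "Z = (\<lambda>\<omega>. \<Sum>l=1..n. poly g (X l \<omega>))"
  have Z: "partial_sum (poly (hermite_sum 0 c d N)) X n \<omega> / s = Z \<omega>" for \<omega>
    by (simp add: Z_def g_def \<alpha>_def partial_sum_def sum_distrib_left sum_divide_distrib)
  have \<alpha>: "\<alpha>\<^sup>2 * real n = 1 / s\<^sup>2" using n s by (simp add: \<alpha>_def power_divide power_mult_distrib)
  have mX: "X l \<in> borel_measurable M" if "l \<in> {1..n}" for l using that rv_X by auto
  have [measurable]: "Z \<in> borel_measurable M"
    unfolding Z_def by (intro borel_measurable_sum measurable_compose[OF mX poly_measurable])
  have iG: "integrable M G" unfolding G_def by (rule integrable_gamma_form)
  define Q where "Q = (\<lambda>k \<omega>. \<Sum>l=1..n. R k l * poly (pderiv g) (X l \<omega>))"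
  have ih: "integrable M (\<lambda>\<omega>. hermite m (X k \<omega>) * \<phi> (Z \<omega>))" if "k \<in> {1..n}" for k m
    using that integrable_poly_X[of k "hermite_poly m"] B by (intro integrable_times_bounded[where B=B]) (auto simp: hermite_eq_poly)
  have iq: "integrable M (\<lambda>\<omega>. (hermite m (X k \<omega>) * Q k \<omega>) * \<phi>' (Z \<omega>))" if k: "k \<in> {1..n}" for k m
  proof (rule integrable_times_bounded[where B=2])
    have "integrable M (\<lambda>\<omega>. \<Sum>l=1..n. R k l * (poly (hermite_poly m) (X k \<omega>) * poly (pderiv g) (X l \<omega>)))"
      using k by (intro Bochner_Integration.integrable_sum integrable_mult_right integrable_poly_X2) auto
    then show "integrable M (\<lambda>\<omega>. hermite m (X k \<omega>) * Q k \<omega>)"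
      by (simp add: Q_def hermite_eq_poly sum_distrib_left mult_ac)
  qed (use \<phi>(3) in auto)
  have "expectation (\<lambda>\<omega>. Z \<omega> * \<phi> (Z \<omega>)) =
      expectation (\<lambda>\<omega>. \<Sum>k=1..n. \<Sum>m=d..N. (\<alpha> * c m) * (hermite m (X k \<omega>) * \<phi> (Z \<omega>)))"
    by (rule Bochner_Integration.integral_cong[OF refl], subst (1) Z_def)
       (simp add: g_def poly_hermite_sum sum_distrib_left sum_distrib_right mult_ac)
  also have "\<dots> = (\<Sum>k=1..n. \<Sum>m=d..N. expectation (\<lambda>\<omega>. (\<alpha> * c m) * (hermite m (X k \<omega>) * \<phi> (Z \<omega>))))"
    by (intro integral_double_sum integrable_mult_right ih)
  also have "\<dots> = (\<Sum>k=1..n. \<Sum>m=d..N. expectation (\<lambda>\<omega>. (\<alpha> * c m) * ((hermite (m - 1) (X k \<omega>) * Q k \<omega>) * \<phi>' (Z \<omega>))))"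
  proof (intro sum.cong refl)
    fix k m assume k: "k \<in> {1..n}" and m: "m \<in> {d..N}"
    then have m1: "m = Suc (m - 1)" using d by auto
    have "expectation (\<lambda>\<omega>. hermite m (X k \<omega>) * \<phi> (Z \<omega>)) = expectation (\<lambda>\<omega>. hermite (m - 1) (X k \<omega>) * (\<phi>' (Z \<omega>) * Q k \<omega>))"
      using hermite_stein_identity[OF k \<phi>, of "m - 1" g] m1 by (simp add: Z_def Q_def)
    also have "\<dots> = expectation (\<lambda>\<omega>. (hermite (m - 1) (X k \<omega>) * Q k \<omega>) * \<phi>' (Z \<omega>))" by (simp add: mult_ac)
    finally show "expectation (\<lambda>\<omega>. (\<alpha> * c m) * (hermite m (X k \<omega>) * \<phi> (Z \<omega>))) =
       expectation (\<lambda>\<omega>. (\<alpha> * c m) * ((hermite (m - 1) (X k \<omega>) * Q k \<omega>) * \<phi>' (Z \<omega>)))" by simp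
  qed
  also have "\<dots> = expectation (\<lambda>\<omega>. \<Sum>k=1..n. \<Sum>m=d..N. (\<alpha> * c m) * ((hermite (m - 1) (X k \<omega>) * Q k \<omega>) * \<phi>' (Z \<omega>)))"
    by (intro integral_double_sum(2)[symmetric] integrable_mult_right iq)
  also have "\<dots> = expectation (\<lambda>\<omega>. (G \<omega> / s\<^sup>2) * \<phi>' (Z \<omega>))"
  proof (rule Bochner_Integration.integral_cong[OF refl])
    fix \<omega>
    have "(\<Sum>k=1..n. \<Sum>m=d..N. (\<alpha> * c m) * ((hermite (m - 1) (X k \<omega>) * Q k \<omega>) * \<phi>' (Z \<omega>))) =
       (\<Sum>k=1..n. \<alpha> * poly (hermite_sum 1 c d N) (X k \<omega>) * Q k \<omega>) * \<phi>' (Z \<omega>)"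
      by (simp add: poly_hermite_sum sum_distrib_left sum_distrib_right mult_ac)
    also have "(\<Sum>k=1..n. \<alpha> * poly (hermite_sum 1 c d N) (X k \<omega>) * Q k \<omega>) =
       \<alpha>\<^sup>2 * (\<Sum>k=1..n. \<Sum>l=1..n. R k l * (poly (hermite_sum 1 c d N) (X k \<omega>) * poly (hermite_sum 1 (\<lambda>m. real m * c m) d N) (X l \<omega>)))"
      by (simp add: Q_def g_def pderiv_smult pderiv_hermite_sum sum_distrib_left power2_eq_square mult_ac)
    also have "\<dots> = \<alpha>\<^sup>2 * (real n * G \<omega>)" using n by (simp add: G_def gamma_form_def)
    also have "\<dots> = G \<omega> / s\<^sup>2" unfolding mult.assoc[symmetric] \<alpha> by simp
    finally show "(\<Sum>k=1..n. \<Sum>m=d..N. (\<alpha> * c m) * ((hermite (m - 1) (X k \<omega>) * Q k \<omega>) * \<phi>' (Z \<omega>))) = G \<omega> / s\<^sup>2 * \<phi>' (Z \<omega>)" .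
  qed
  finally have ibp: "expectation (\<lambda>\<omega>. Z \<omega> * \<phi> (Z \<omega>)) = expectation (\<lambda>\<omega>. (G \<omega> / s\<^sup>2) * \<phi>' (Z \<omega>))" .
  have ihZ: "integrable M (\<lambda>\<omega>. h (Z \<omega>))"
    by (rule integrable_const_bound[where B=1]) (use h in auto)
  have i1: "integrable M (\<lambda>\<omega>. \<phi>' (Z \<omega>))"
    by (rule integrable_const_bound[where B=2]) (use \<phi>(3) in auto)
  have i2: "integrable M (\<lambda>\<omega>. (G \<omega> / s\<^sup>2) * \<phi>' (Z \<omega>))"
    by (rule integrable_times_bounded[where B=2]) (use \<phi>(3) iG in auto)
  have i3: "integrable M (\<lambda>\<omega>. Z \<omega> * \<phi> (Z \<omega>))"
    by (rule integrable_times_bounded[where B=B])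
       (use B in \<open>auto simp: Z_def intro!: Bochner_Integration.integrable_sum integrable_poly_X\<close>)
  have "expectation (\<lambda>\<omega>. h (Z \<omega>)) - (\<integral>x. h x \<partial>std_gaussian) = expectation (\<lambda>\<omega>. h (Z \<omega>) - (\<integral>x. h x \<partial>std_gaussian))"
    using ihZ by (simp add: prob_space)
  also have "\<dots> = expectation (\<lambda>\<omega>. \<phi>' (Z \<omega>) - Z \<omega> * \<phi> (Z \<omega>))" by (simp add: stein)
  also have "\<dots> = expectation (\<lambda>\<omega>. \<phi>' (Z \<omega>)) - expectation (\<lambda>\<omega>. (G \<omega> / s\<^sup>2) * \<phi>' (Z \<omega>))"
    unfolding ibp[symmetric] by (rule Bochner_Integration.integral_diff[OF i1 i3])
  also have "\<dots> = expectation (\<lambda>\<omega>. \<phi>' (Z \<omega>) - (G \<omega> / s\<^sup>2) * \<phi>' (Z \<omega>))"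
    by (rule Bochner_Integration.integral_diff[OF i1 i2, symmetric])
  finally have "\<bar>expectation (\<lambda>\<omega>. h (Z \<omega>)) - (\<integral>x. h x \<partial>std_gaussian)\<bar> =
     \<bar>expectation (\<lambda>\<omega>. \<phi>' (Z \<omega>) - (G \<omega> / s\<^sup>2) * \<phi>' (Z \<omega>))\<bar>" by simp
  also have "\<dots> \<le> expectation (\<lambda>\<omega>. \<bar>\<phi>' (Z \<omega>) - (G \<omega> / s\<^sup>2) * \<phi>' (Z \<omega>)\<bar>)" by (rule integral_abs_bound)
  also have "\<dots> \<le> expectation (\<lambda>\<omega>. 2 / s\<^sup>2 * \<bar>s\<^sup>2 - G \<omega>\<bar>)"
  proof (intro integral_mono integrable_abs Bochner_Integration.integrable_diff i1 i2)
    show "integrable M (\<lambda>\<omega>. 2 / s\<^sup>2 * \<bar>s\<^sup>2 - G \<omega>\<bar>)" using iG by simp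
    fix \<omega>
    have "\<phi>' (Z \<omega>) - (G \<omega> / s\<^sup>2) * \<phi>' (Z \<omega>) = \<phi>' (Z \<omega>) * ((s\<^sup>2 - G \<omega>) / s\<^sup>2)"
      using s by (simp add: field_simps)
    then have "\<bar>\<phi>' (Z \<omega>) - (G \<omega> / s\<^sup>2) * \<phi>' (Z \<omega>)\<bar> = \<bar>\<phi>' (Z \<omega>)\<bar> * (\<bar>s\<^sup>2 - G \<omega>\<bar> / s\<^sup>2)"
      by (simp add: abs_mult abs_divide)
    also have "\<dots> \<le> 2 * (\<bar>s\<^sup>2 - G \<omega>\<bar> / s\<^sup>2)" by (intro mult_right_mono \<phi>(3)) simp
    finally show "\<bar>\<phi>' (Z \<omega>) - (G \<omega> / s\<^sup>2) * \<phi>' (Z \<omega>)\<bar> \<le> 2 / s\<^sup>2 * \<bar>s\<^sup>2 - G \<omega>\<bar>" by simp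
  qed
  also have "\<dots> = 2 / s\<^sup>2 * expectation (\<lambda>\<omega>. \<bar>s\<^sup>2 - G \<omega>\<bar>)" by (rule integral_mult_right_zero)
  finally show ?thesis unfolding Z .
qed

lemma second_moment_partial_sum_hermite_sum:
  "expectation (\<lambda>\<omega>. (partial_sum (poly (hermite_sum 0 a K N)) X n \<omega>)\<^sup>2) =
     (\<Sum>m=K..N. fact m * (a m)\<^sup>2 * cov_average n m)"
proof -
  let ?g = "poly (hermite_sum 0 a K N)"
  have two: "expectation (\<lambda>\<omega>. ?g (X k \<omega>) * ?g (X l \<omega>)) = (\<Sum>m=K..N. fact m * (a m)\<^sup>2 * R k l ^ m)"
    if kl: "1 \<le> k" "1 \<le> l" for k l
  proof -
    have "expectation (\<lambda>\<omega>. ?g (X k \<omega>) * ?g (X l \<omega>)) =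
       expectation (\<lambda>\<omega>. \<Sum>m=K..N. \<Sum>m'=K..N. (a m * a m') * (hermite m (X k \<omega>) * hermite m' (X l \<omega>)))"
      by (simp add: poly_hermite_sum sum_product mult_ac)
    also have "\<dots> = (\<Sum>m=K..N. \<Sum>m'=K..N. expectation (\<lambda>\<omega>. (a m * a m') * (hermite m (X k \<omega>) * hermite m' (X l \<omega>))))"
      by (intro integral_double_sum integrable_mult_right integrable_hermite2 kl)
    also have "\<dots> = (\<Sum>m=K..N. \<Sum>m'=K..N. if m' = m then fact m * (a m)\<^sup>2 * R k l ^ m else 0)"
      by (intro sum.cong refl) (simp add: hermite_orthogonality[OF kl] power2_eq_square)
    also have "\<dots> = (\<Sum>m=K..N. fact m * (a m)\<^sup>2 * R k l ^ m)" by (intro sum.cong refl) simp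
    finally show ?thesis .
  qed
  have sq: "(partial_sum ?g X n \<omega>)\<^sup>2 = (\<Sum>k=1..n. \<Sum>l=1..n. ?g (X k \<omega>) * ?g (X l \<omega>)) / real n" for \<omega>
    unfolding partial_sum_def power_mult_distrib power_divide
    by (simp add: power2_eq_square sum_product)
  have "expectation (\<lambda>\<omega>. (partial_sum ?g X n \<omega>)\<^sup>2) = expectation (\<lambda>\<omega>. \<Sum>k=1..n. \<Sum>l=1..n. ?g (X k \<omega>) * ?g (X l \<omega>)) / real n"
    unfolding sq by (rule integral_divide_zero)
  also have "expectation (\<lambda>\<omega>. \<Sum>k=1..n. \<Sum>l=1..n. ?g (X k \<omega>) * ?g (X l \<omega>)) =
     (\<Sum>k=1..n. \<Sum>l=1..n. expectation (\<lambda>\<omega>. ?g (X k \<omega>) * ?g (X l \<omega>)))"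
    by (intro integral_double_sum integrable_poly_X2) auto
  also have "\<dots> = (\<Sum>k=1..n. \<Sum>l=1..n. \<Sum>m=K..N. fact m * (a m)\<^sup>2 * R k l ^ m)"
    by (intro sum.cong refl two) auto
  also have "\<dots> = (\<Sum>k=1..n. \<Sum>m=K..N. \<Sum>l=1..n. fact m * (a m)\<^sup>2 * R k l ^ m)"
    by (intro sum.cong refl sum.swap)
  also have "\<dots> = (\<Sum>m=K..N. \<Sum>k=1..n. \<Sum>l=1..n. fact m * (a m)\<^sup>2 * R k l ^ m)"
    by (rule sum.swap)
  also have "\<dots> / real n = (\<Sum>m=K..N. fact m * (a m)\<^sup>2 * cov_average n m)"
    by (simp add: cov_average_def sum_divide_distrib sum_distrib_left)
  finally show ?thesis .
qed

lemma partial_sum_measurable [measurable]: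
  assumes [measurable]: "g \<in> borel_measurable borel"
  shows "partial_sum g X n \<in> borel_measurable M"
proof -
  have "(\<lambda>\<omega>. g (X k \<omega>)) \<in> borel_measurable M" if "k \<in> {1..n}" for k
    using that by (intro measurable_compose[OF rv_X assms]) auto
  then show ?thesis unfolding partial_sum_def by (intro borel_measurable_times borel_measurable_sum) auto
qed

lemma second_moment_partial_sum_le:
  assumes g [measurable]: "g \<in> borel_measurable borel" and g2: "integrable std_gaussian (\<lambda>x. (g x)\<^sup>2)"
  shows "integrable M (\<lambda>\<omega>. (partial_sum g X n \<omega>)\<^sup>2)"
    and "expectation (\<lambda>\<omega>. (partial_sum g X n \<omega>)\<^sup>2) \<le> real n * (\<integral>x. (g x)\<^sup>2 \<partial>std_gaussian)"
proof -
  have le: "(partial_sum g X n \<omega>)\<^sup>2 \<le> (\<Sum>k=1..n. (g (X k \<omega>))\<^sup>2)" for \<omega>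
  proof (cases "n = 0")
    case False
    have "(partial_sum g X n \<omega>)\<^sup>2 = (\<Sum>k=1..n. g (X k \<omega>))\<^sup>2 / real n"
      unfolding partial_sum_def power_mult_distrib power_divide by simp
    also have "\<dots> \<le> ((\<Sum>k=1..n. (g (X k \<omega>))\<^sup>2) * real (card {1..n})) / real n"
      by (intro divide_right_mono sum_squared_le_sum_of_squares) auto
    also have "\<dots> = (\<Sum>k=1..n. (g (X k \<omega>))\<^sup>2)" using False by simp
    finally show ?thesis .
  qed (simp add: partial_sum_def)
  have i: "integrable M (\<lambda>\<omega>. (g (X k \<omega>))\<^sup>2)" if "1 \<le> k" for k
    using integrable_X_iff[OF that, of "\<lambda>x. (g x)\<^sup>2"] g2 by simp
  have isum: "integrable M (\<lambda>\<omega>. \<Sum>k=1..n. (g (X k \<omega>))\<^sup>2)"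
    by (intro Bochner_Integration.integrable_sum i) auto
  show 1: "integrable M (\<lambda>\<omega>. (partial_sum g X n \<omega>)\<^sup>2)"
    by (rule Bochner_Integration.integrable_bound[OF isum]) (auto intro!: AE_I2 order_trans[OF le])
  have "expectation (\<lambda>\<omega>. (partial_sum g X n \<omega>)\<^sup>2) \<le> expectation (\<lambda>\<omega>. \<Sum>k=1..n. (g (X k \<omega>))\<^sup>2)"
    by (intro integral_mono 1 isum le)
  also have "\<dots> = (\<Sum>k=1..n. expectation (\<lambda>\<omega>. (g (X k \<omega>))\<^sup>2))"
    by (intro Bochner_Integration.integral_sum i) auto
  also have "\<dots> = (\<Sum>k=1..n. (\<integral>x. (g x)\<^sup>2 \<partial>std_gaussian))"
    by (intro sum.cong refl, subst expectation_X[symmetric, of _ "\<lambda>x. (g x)\<^sup>2"]) auto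
  finally show "expectation (\<lambda>\<omega>. (partial_sum g X n \<omega>)\<^sup>2) \<le> real n * (\<integral>x. (g x)\<^sup>2 \<partial>std_gaussian)" by simp
qed

end

context breuer_major_setting
begin

definition cov_bound :: real where "cov_bound = 2 * (\<Sum>k. \<bar>\<rho> k\<bar> ^ d)"

lemma cov_bound_nonneg: "0 \<le> cov_bound"
  unfolding cov_bound_def using summable_rho by (simp add: suminf_nonneg)

lemma abs_rho_power_le: "d \<le> m \<Longrightarrow> \<bar>\<rho> k\<bar> ^ m \<le> \<bar>\<rho> k\<bar> ^ d"
  using abs_rho_le_1 by (intro power_decreasing) auto

lemma summable_rho_power: "d \<le> m \<Longrightarrow> summable (\<lambda>k. \<bar>\<rho> k\<bar> ^ m)"
  by (rule summable_comparison_test'[OF summable_rho, of 0]) (use abs_rho_power_le in auto)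

lemma cov_average_eq: "cov_average n m = (\<Sum>k=1..n. \<Sum>l=1..n. \<rho> (lag k l) ^ m) / real n"
  unfolding cov_average_def by (intro arg_cong2[of _ _ _ _ "(/)"] refl sum.cong) (simp add: rho_R)

lemma abs_cov_average_le:
  assumes m: "d \<le> m"
  shows "\<bar>cov_average n m\<bar> \<le> cov_bound"
proof (cases "n = 0")
  case False
  have "\<bar>cov_average n m\<bar> \<le> (\<Sum>k=1..n. \<Sum>l=1..n. \<bar>\<rho> (lag k l)\<bar> ^ d) / real n"
    unfolding cov_average_eq abs_divide abs_of_nat
    by (intro divide_right_mono order_trans[OF sum_abs] sum_mono)
       (auto simp: power_abs intro: order_trans[OF _ abs_rho_power_le[OF m]])
  also have "\<dots> \<le> (real n * (2 * (\<Sum>k. \<bar>\<rho> k\<bar> ^ d))) / real n"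
    by (intro divide_right_mono double_sum_lag_le summable_rho) auto
  also have "\<dots> = cov_bound" using False by (simp add: cov_bound_def)
  finally show ?thesis .
qed (simp add: cov_average_def cov_bound_nonneg)

definition lag_power_sum :: "nat \<Rightarrow> real" where
  "lag_power_sum m = (\<Sum>\<^sub>\<infinity>k\<in>(UNIV :: int set). \<rho> (nat \<bar>k\<bar>) ^ m)"

lemma cov_average_tendsto:
  assumes m: "d \<le> m"
  shows "(\<lambda>n. cov_average n m) \<longlonglongrightarrow> lag_power_sum m"
proof -
  have s: "summable (\<lambda>k. \<bar>\<rho> k ^ m\<bar>)" using summable_rho_power[OF m] by (simp add: power_abs)
  then have "summable (\<lambda>k. \<rho> k ^ m)" by (rule summable_rabs_cancel)
  from lag_average_tendsto[OF this] show ?thesis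
    unfolding cov_average_eq lag_power_sum_def infsum_int_abs[OF s] .
qed

lemma abs_lag_power_sum_le: "d \<le> m \<Longrightarrow> \<bar>lag_power_sum m\<bar> \<le> cov_bound"
  by (rule tendsto_upperbound[OF tendsto_rabs[OF cov_average_tendsto]])
     (auto intro!: always_eventually abs_cov_average_le)

lemma expectation_gamma_form_le:
  assumes K: "d \<le> K" and a: "\<And>m. K \<le> m \<Longrightarrow> (a m)\<^sup>2 * fact (m - 1) \<le> e m"
  shows "expectation (gamma_form (hermite_sum 1 a K N) (hermite_sum 1 a K N) n) \<le> cov_bound * (\<Sum>m=K..N. e m)"
proof -
  have "expectation (gamma_form (hermite_sum 1 a K N) (hermite_sum 1 a K N) n) =
     (\<Sum>m=K..N. (a m)\<^sup>2 * fact (m - 1) * cov_average n m)"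
    using K d_pos by (subst expectation_gamma_form_hermite_sum) (auto simp: power2_eq_square)
  also have "\<dots> \<le> (\<Sum>m=K..N. e m * cov_bound)"
  proof (rule sum_mono)
    fix m assume m: "m \<in> {K..N}"
    have "(a m)\<^sup>2 * fact (m - 1) * cov_average n m \<le> (a m)\<^sup>2 * fact (m - 1) * cov_bound"
      using abs_cov_average_le[of m n] m K by (intro mult_left_mono) auto
    also have "\<dots> \<le> e m * cov_bound" using a m cov_bound_nonneg by (intro mult_right_mono) auto
    finally show "(a m)\<^sup>2 * fact (m - 1) * cov_average n m \<le> e m * cov_bound" .
  qed
  finally show ?thesis by (simp add: sum_distrib_left mult.commute)
qed

end

section \<open>Convergence in total variation\<close>

locale breuer_major = breuer_major_setting M X \<rho> d for M :: "'a measure" and X \<rho> d +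
  fixes f :: "real \<Rightarrow> real" and c :: "nat \<Rightarrow> real"
  assumes expansion: "has_hermite_expansion_from f d c"
    and sobolev: "f \<in> malliavin_sobolev"
begin

text \<open>
  The sum of these terms is the squared \<open>L\<^sup>2\<close> norm of the derivative of \<open>f\<close>, apart from the terms with \<open>m < d\<close>.
\<close>

definition energy :: "nat \<Rightarrow> real" where "energy m = real m * fact m * (c m)\<^sup>2"

definition energy_tail :: "nat \<Rightarrow> real" where "energy_tail K = (\<Sum>m. energy (m + Suc K))"

text \<open>
  This is \<open>\<langle>D F, - D L\<^sup>-\<^sup>1 F\<rangle>\<close> for the normalised sum \<open>F\<close> of the truncated expansion: the inverse of the
  Ornstein--Uhlenbeck operator divides the coefficient of \<open>H m\<close> by \<open>- m\<close>, which cancels the factor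
  \<open>m\<close> of the derivative in the first argument.
\<close>

definition stein_kernel :: "nat \<Rightarrow> nat \<Rightarrow> 'a \<Rightarrow> real" where
  "stein_kernel N = gamma_form (hermite_sum 1 c d N) (hermite_sum 1 (\<lambda>m. real m * c m) d N)"

lemma energy_nonneg: "0 \<le> energy m"
  by (simp add: energy_def)

lemma summable_energy: "summable energy"
  unfolding energy_def using summable_malliavin_hermite[OF expansion sobolev d_pos] .

lemma summable_energy_shift: "summable (\<lambda>m. energy (m + K))"
  by (rule summable_iff_shift[THEN iffD2, OF summable_energy])

lemma sum_energy_le: "(\<Sum>m=K..N. energy m) \<le> suminf energy"
  by (intro sum_le_suminf summable_energy) (auto simp: energy_nonneg)

lemma sum_energy_le_tail: "(\<Sum>m=Suc K..N. energy m) \<le> energy_tail K"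
proof -
  have "(\<Sum>m=Suc K..N. energy m) = (\<Sum>j\<in>(\<lambda>m. m - Suc K) ` {Suc K..N}. energy (j + Suc K))"
    by (subst sum.reindex) (auto simp: inj_on_def intro!: sum.cong)
  also have "\<dots> \<le> energy_tail K" unfolding energy_tail_def
    by (intro sum_le_suminf summable_energy_shift) (auto simp: energy_nonneg)
  finally show ?thesis .
qed

lemma energy_tail_nonneg: "0 \<le> energy_tail K"
  unfolding energy_tail_def by (intro suminf_nonneg summable_energy_shift energy_nonneg)

lemma energy_tail_small:
  assumes "0 < r"
  shows "\<exists>K\<ge>d. energy_tail K < r"
proof -
  obtain N where "\<And>n. n \<ge> N \<Longrightarrow> norm (\<Sum>m. energy (m + n)) < r"
    using suminf_exist_split[OF assms summable_energy] by auto
  from this[of "Suc (max N d)"] have "energy_tail (max N d) < r" by (simp add: energy_tail_def abs_less_iff)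
  then show ?thesis by (intro exI[of _ "max N d"]) auto
qed

lemma weight_le_energy:
  assumes "1 \<le> m"
  shows "(c m)\<^sup>2 * fact (m - 1) \<le> energy m" "(real m * c m)\<^sup>2 * fact (m - 1) = energy m"
    "fact m * (c m)\<^sup>2 \<le> energy m"
proof -
  have f: "fact m = real m * fact (m - 1)" using assms by (intro fact_reduce) auto
  show "(real m * c m)\<^sup>2 * fact (m - 1) = energy m"
    unfolding energy_def f by (simp add: power2_eq_square)
  have "1 * ((c m)\<^sup>2 * fact (m - 1)) \<le> (real m * real m) * ((c m)\<^sup>2 * fact (m - 1))"
    using assms mult_mono[of 1 "real m" 1 "real m"] by (intro mult_right_mono) auto
  then show "(c m)\<^sup>2 * fact (m - 1) \<le> energy m"
    unfolding energy_def f by (simp add: mult_ac)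
  have "1 * (fact m * (c m)\<^sup>2) \<le> real m * (fact m * (c m)\<^sup>2)"
    using assms by (intro mult_right_mono) auto
  then show "fact m * (c m)\<^sup>2 \<le> energy m" by (simp add: energy_def mult_ac)
qed

lemma expectation_stein_kernel:
  "expectation (stein_kernel N n) = (\<Sum>m=d..N. fact m * (c m)\<^sup>2 * cov_average n m)"
  unfolding stein_kernel_def expectation_gamma_form_hermite_sum[OF d_pos]
proof (intro sum.cong refl)
  fix m assume "m \<in> {d..N}"
  then have "fact m = real m * fact (m - 1)" using d_pos by (intro fact_reduce) auto
  then show "c m * (real m * c m) * fact (m - 1) * cov_average n m = fact m * (c m)\<^sup>2 * cov_average n m"
    by (simp add: power2_eq_square)
qed

text \<open>
  Changing \<open>K\<close> to \<open>N\<close> adds the terms of index above \<open>K\<close> to one of the two arguments at a time. By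
  Cauchy--Schwarz the full sums are weighted with \<open>t\<close> and the tails with \<open>1 / t\<close>, so a small \<open>t\<close> and then
  a large \<open>K\<close> make the bound small, whatever \<open>n\<close> and \<open>N\<close> are.
\<close>

lemma stein_kernel_tail:
  assumes K: "d \<le> K" "K \<le> N" and t: "0 < t"
  shows "expectation (\<lambda>\<omega>. \<bar>stein_kernel N n \<omega> - stein_kernel K n \<omega>\<bar>) \<le>
    cov_bound * (t * suminf energy + energy_tail K / t)"
proof -
  let ?c = "\<lambda>m. real m * c m"
  let ?hK = "hermite_sum 1 c d K" and ?gK = "hermite_sum 1 ?c d K"
  let ?h' = "hermite_sum 1 c (Suc K) N" and ?g' = "hermite_sum 1 ?c (Suc K) N"
  let ?hN = "hermite_sum 1 c d N"
  have split: "?hN = ?hK + ?h'" "hermite_sum 1 ?c d N = ?gK + ?g'"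
    using K by (auto intro!: hermite_sum_split)
  have diff: "stein_kernel N n \<omega> - stein_kernel K n \<omega> = gamma_form ?hN ?g' n \<omega> + gamma_form ?gK ?h' n \<omega>" for \<omega>
    unfolding stein_kernel_def split gamma_form_add_left gamma_form_add_right
    using gamma_form_commute[of ?h' ?gK n \<omega>] by simp
  have "expectation (\<lambda>\<omega>. \<bar>stein_kernel N n \<omega> - stein_kernel K n \<omega>\<bar>) \<le>
     expectation (\<lambda>\<omega>. (t * gamma_form ?hN ?hN n \<omega> + gamma_form ?g' ?g' n \<omega> / t) / 2 +
        (t * gamma_form ?gK ?gK n \<omega> + gamma_form ?h' ?h' n \<omega> / t) / 2)"
    unfolding diff
    by (intro integral_mono integrable_abs Bochner_Integration.integrable_add integrable_divide
        integrable_mult_right integrable_gamma_form order_trans[OF abs_triangle_ineq] add_mono gamma_form_le t)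
  also have "\<dots> = (t * expectation (gamma_form ?hN ?hN n) + expectation (gamma_form ?g' ?g' n) / t) / 2 +
        (t * expectation (gamma_form ?gK ?gK n) + expectation (gamma_form ?h' ?h' n) / t) / 2"
    using integrable_gamma_form by simp
  also have "\<dots> \<le> (t * (cov_bound * suminf energy) + (cov_bound * energy_tail K) / t) / 2 +
      (t * (cov_bound * suminf energy) + (cov_bound * energy_tail K) / t) / 2"
  proof -
    have tot: "expectation (gamma_form (hermite_sum 1 a d J) (hermite_sum 1 a d J) n) \<le> cov_bound * suminf energy"
      if "\<And>m. d \<le> m \<Longrightarrow> (a m)\<^sup>2 * fact (m - 1) \<le> energy m" for a J
      using expectation_gamma_form_le[OF order_refl that]
      by (rule order_trans) (auto intro!: mult_left_mono sum_energy_le cov_bound_nonneg)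
    have tail: "expectation (gamma_form (hermite_sum 1 a (Suc K) N) (hermite_sum 1 a (Suc K) N) n) \<le> cov_bound * energy_tail K"
      if "\<And>m. Suc K \<le> m \<Longrightarrow> (a m)\<^sup>2 * fact (m - 1) \<le> energy m" for a
      using expectation_gamma_form_le[OF _ that, of N n] K
      by (intro order_trans[OF expectation_gamma_form_le[OF _ that]] mult_left_mono sum_energy_le_tail cov_bound_nonneg) auto
    show ?thesis
      using t d_pos K weight_le_energy
      by (intro divide_right_mono add_mono mult_left_mono tot tail) auto
  qed
  also have "\<dots> = cov_bound * (t * suminf energy + energy_tail K / t)"
    using t by (simp add: field_simps)
  finally show ?thesis .
qed

definition partial_hermite_sum :: "nat \<Rightarrow> nat \<Rightarrow> 'a \<Rightarrow> real" where
  "partial_hermite_sum N = partial_sum (poly (hermite_sum 0 c d N)) X"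

lemma f_facts:
  "f \<in> borel_measurable borel" "integrable std_gaussian (\<lambda>x. (f x)\<^sup>2)"
  "(\<lambda>N. \<integral>x. (f x - poly (hermite_sum 0 c d N) x)\<^sup>2 \<partial>std_gaussian) \<longlonglongrightarrow> 0"
  using expansion by (auto simp: has_hermite_expansion_from_def L2_gaussian_def L2_norm_gaussian_tendsto_0_iff poly_hermite_sum)

lemma partial_sum_approx:
  shows "integrable M (\<lambda>\<omega>. (partial_sum f X n \<omega> - partial_hermite_sum N n \<omega>)\<^sup>2)"
    and "(\<lambda>N. expectation (\<lambda>\<omega>. (partial_sum f X n \<omega> - partial_hermite_sum N n \<omega>)\<^sup>2)) \<longlonglongrightarrow> 0"
proof -
  note [measurable] = f_facts(1)
  define D where "D = (\<lambda>N x. f x - poly (hermite_sum 0 c d N) x)"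
  have [measurable]: "D N \<in> borel_measurable borel" for N unfolding D_def by measurable
  have D2: "integrable std_gaussian (\<lambda>x. (D N x)\<^sup>2)" for N
    unfolding D_def by (intro integrable_square_diff f_facts(2) square_integrable_poly) measurable
  have eq: "partial_sum f X n \<omega> - partial_hermite_sum N n \<omega> = partial_sum (D N) X n \<omega>" for N \<omega>
    by (simp add: partial_hermite_sum_def partial_sum_def D_def sum_subtractf right_diff_distrib diff_divide_distrib)
  show "integrable M (\<lambda>\<omega>. (partial_sum f X n \<omega> - partial_hermite_sum N n \<omega>)\<^sup>2)"
    unfolding eq by (rule second_moment_partial_sum_le(1)[OF _ D2]) measurable
  have lim: "(\<lambda>N. real n * (\<integral>x. (D N x)\<^sup>2 \<partial>std_gaussian)) \<longlonglongrightarrow> 0"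
    using tendsto_mult_left[OF f_facts(3), of "real n"] by (simp add: D_def)
  show "(\<lambda>N. expectation (\<lambda>\<omega>. (partial_sum f X n \<omega> - partial_hermite_sum N n \<omega>)\<^sup>2)) \<longlonglongrightarrow> 0"
    unfolding eq
  proof (rule Lim_null_comparison[OF always_eventually lim], rule allI)
    fix N
    show "norm (expectation (\<lambda>\<omega>. (partial_sum (D N) X n \<omega>)\<^sup>2)) \<le> real n * (\<integral>x. (D N x)\<^sup>2 \<partial>std_gaussian)"
      using second_moment_partial_sum_le(2)[OF _ D2, of N n] by simp
  qed
qed

lemma partial_hermite_sum_measurable [measurable]: "partial_hermite_sum N n \<in> borel_measurable M"
  unfolding partial_hermite_sum_def by measurable

lemma partial_sum_f_measurable [measurable]: "partial_sum f X n \<in> borel_measurable M"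
  using f_facts(1) by measurable

lemma integrable_partial_sum_square: "integrable M (\<lambda>\<omega>. (partial_sum f X n \<omega>)\<^sup>2)"
  by (rule second_moment_partial_sum_le(1)[OF f_facts(1,2)])

lemma integral_f: "(\<integral>x. f x \<partial>std_gaussian) = 0"
proof -
  note [measurable] = f_facts(1)
  have i1: "integrable std_gaussian f"
    using abs_integral_mult_le(1)[of f std_gaussian "\<lambda>_. 1"] f_facts by simp
  have "(\<lambda>N. \<integral>x. 1 * (f x - poly (hermite_sum 0 c d N) x) \<partial>std_gaussian) \<longlonglongrightarrow> 0"
    by (intro tendsto_integral_mult_L2 f_facts(3) integrable_square_diff f_facts(2) square_integrable_poly) simp_all
  moreover have "(\<integral>x. 1 * (f x - poly (hermite_sum 0 c d N) x) \<partial>std_gaussian) = (\<integral>x. f x \<partial>std_gaussian)" for N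
  proof -
    have ih: "integrable std_gaussian (\<lambda>x. hermite m x)" for m
      using integrable_std_gaussian_poly[of "hermite_poly m"] by (simp add: hermite_eq_poly)
    have "(\<integral>x. poly (hermite_sum 0 c d N) x \<partial>std_gaussian) = (\<Sum>m=d..N. c m * (\<integral>x. hermite m x \<partial>std_gaussian))"
      unfolding poly_hermite_sum using ih
      by (subst Bochner_Integration.integral_sum) (auto intro!: integrable_mult_right)
    also have "\<dots> = 0"
    proof (intro sum.neutral ballI)
      fix m assume "m \<in> {d..N}"
      then have "m \<noteq> 0" using d_pos by auto
      then show "c m * (\<integral>x. hermite m x \<partial>std_gaussian) = 0"
        using hermite_orthogonality_std[of m 0] by simp
    qed
    finally show ?thesis using i1 integrable_std_gaussian_poly by simp
  qed
  ultimately show ?thesis by (simp add: LIMSEQ_const_iff)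
qed

lemma variance_partial_sum: "variance (partial_sum f X n) = expectation (\<lambda>\<omega>. (partial_sum f X n \<omega>)\<^sup>2)"
proof -
  note [measurable] = f_facts(1)
  have i1: "integrable std_gaussian f"
    using abs_integral_mult_le(1)[of f std_gaussian "\<lambda>_. 1"] f_facts by simp
  have "expectation (partial_sum f X n) = 1 / sqrt (real n) * (\<Sum>k=1..n. expectation (\<lambda>\<omega>. f (X k \<omega>)))"
    unfolding partial_sum_def
    by (subst integral_mult_right_zero, subst Bochner_Integration.integral_sum) (auto simp: integrable_X_iff i1)
  also have "\<dots> = 0" by (simp add: expectation_X integral_f)
  finally show ?thesis by simp
qed

lemma second_moment_tendsto:
  "(\<lambda>N. expectation (\<lambda>\<omega>. (partial_hermite_sum N n \<omega>)\<^sup>2)) \<longlonglongrightarrow> variance (partial_sum f X n)"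
proof -
  define F where "F = partial_sum f X n"
  define D where "D = (\<lambda>N \<omega>. F \<omega> - partial_hermite_sum N n \<omega>)"
  have [measurable]: "F \<in> borel_measurable M" "D N \<in> borel_measurable M" for N
    unfolding D_def F_def by measurable
  have F2: "integrable M (\<lambda>\<omega>. (F \<omega>)\<^sup>2)" unfolding F_def by (rule integrable_partial_sum_square)
  have D2: "integrable M (\<lambda>\<omega>. (D N \<omega>)\<^sup>2)" for N unfolding D_def F_def by (rule partial_sum_approx)
  have FD: "integrable M (\<lambda>\<omega>. F \<omega> * D N \<omega>)" for N by (rule abs_integral_mult_le(1)) (use F2 D2 in auto)
  have D0: "(\<lambda>N. expectation (\<lambda>\<omega>. (D N \<omega>)\<^sup>2)) \<longlonglongrightarrow> 0" unfolding D_def F_def by (rule partial_sum_approx)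
  have "(\<lambda>N. expectation (\<lambda>\<omega>. F \<omega> * D N \<omega>)) \<longlonglongrightarrow> 0"
    by (intro tendsto_integral_mult_L2 F2 D2 D0) measurable
  then have "(\<lambda>N. expectation (\<lambda>\<omega>. (F \<omega>)\<^sup>2) - 2 * expectation (\<lambda>\<omega>. F \<omega> * D N \<omega>) + expectation (\<lambda>\<omega>. (D N \<omega>)\<^sup>2))
      \<longlonglongrightarrow> expectation (\<lambda>\<omega>. (F \<omega>)\<^sup>2) - 2 * 0 + 0"
    by (intro tendsto_intros D0)
  moreover have "expectation (\<lambda>\<omega>. (F \<omega>)\<^sup>2) - 2 * expectation (\<lambda>\<omega>. F \<omega> * D N \<omega>) + expectation (\<lambda>\<omega>. (D N \<omega>)\<^sup>2) =
      expectation (\<lambda>\<omega>. (partial_hermite_sum N n \<omega>)\<^sup>2)" for N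
  proof -
    have "(partial_hermite_sum N n \<omega>)\<^sup>2 = (F \<omega>)\<^sup>2 - 2 * (F \<omega> * D N \<omega>) + (D N \<omega>)\<^sup>2" for \<omega>
      by (simp add: D_def power2_eq_square algebra_simps)
    then show ?thesis using F2 D2 FD by simp
  qed
  ultimately have "(\<lambda>N. expectation (\<lambda>\<omega>. (partial_hermite_sum N n \<omega>)\<^sup>2)) \<longlonglongrightarrow> expectation (\<lambda>\<omega>. (F \<omega>)\<^sup>2)" by simp
  then show ?thesis unfolding F_def variance_partial_sum .
qed

text \<open>
  The expectation of the Stein kernel is the variance of the truncated sum; the terms of index
  above \<open>K\<close> contribute at most \<open>cov_bound\<close> times the tail of the energy.
\<close>

lemma variance_approx:
  assumes K: "d \<le> K"
  shows "\<bar>variance (partial_sum f X n) - expectation (stein_kernel K n)\<bar> \<le> cov_bound * energy_tail K"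
proof -
  have lim: "(\<lambda>N. \<bar>expectation (\<lambda>\<omega>. (partial_hermite_sum N n \<omega>)\<^sup>2) - expectation (stein_kernel K n)\<bar>) \<longlonglongrightarrow>
      \<bar>variance (partial_sum f X n) - expectation (stein_kernel K n)\<bar>"
    by (intro tendsto_intros second_moment_tendsto)
  have le: "\<bar>expectation (\<lambda>\<omega>. (partial_hermite_sum N n \<omega>)\<^sup>2) - expectation (stein_kernel K n)\<bar> \<le> cov_bound * energy_tail K"
    if N: "K \<le> N" for N
  proof -
    have "{d..N} = {d..K} \<union> {Suc K..N}" using K N by auto
    then have "expectation (\<lambda>\<omega>. (partial_hermite_sum N n \<omega>)\<^sup>2) - expectation (stein_kernel K n) =
       (\<Sum>m=Suc K..N. fact m * (c m)\<^sup>2 * cov_average n m)"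
      unfolding partial_hermite_sum_def second_moment_partial_sum_hermite_sum expectation_stein_kernel
      by (subst sum.union_disjoint[symmetric, THEN trans[rotated]]) (auto simp: sum.union_disjoint)
    also have "\<bar>\<dots>\<bar> \<le> (\<Sum>m=Suc K..N. energy m * cov_bound)"
    proof (rule order_trans[OF sum_abs sum_mono])
      fix m assume m: "m \<in> {Suc K..N}"
      then show "\<bar>fact m * (c m)\<^sup>2 * cov_average n m\<bar> \<le> energy m * cov_bound"
        unfolding abs_mult using K d_pos abs_cov_average_le[of m n] weight_le_energy(3)[of m]
        by (intro mult_mono) (auto simp: abs_mult energy_nonneg)
    qed
    also have "\<dots> \<le> cov_bound * energy_tail K"
      unfolding sum_distrib_right[symmetric]
      using mult_left_mono[OF sum_energy_le_tail cov_bound_nonneg, of K N] by (simp add: mult.commute)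
    finally show ?thesis .
  qed
  show ?thesis by (rule LIMSEQ_le_const2[OF lim]) (use le in blast)
qed

definition kernel_fluctuation :: "nat \<Rightarrow> nat \<Rightarrow> real" where
  "kernel_fluctuation K n = expectation (\<lambda>\<omega>. \<bar>stein_kernel K n \<omega> - expectation (stein_kernel K n)\<bar>)"

lemma kernel_fluctuation_tendsto: "kernel_fluctuation K \<longlonglongrightarrow> 0"
  unfolding kernel_fluctuation_def stein_kernel_def by (rule gamma_form_concentration)

text \<open>
  The bound of \<open>stein_bound\<close> is uniform in \<open>N\<close>, and for fixed \<open>n\<close> the truncated sums converge in \<open>L\<^sup>2\<close>; for
  Lipschitz test functions the limit \<open>N \<rightarrow> \<infinity>\<close> can thus be taken on the left-hand side alone.
\<close>

lemma tv_dist_bound: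
  assumes n: "1 \<le> n" and var: "0 < variance (partial_sum f X n)" and K: "d \<le> K" and t: "0 < t"
  shows "tv_dist (distr M borel (\<lambda>\<omega>. partial_sum f X n \<omega> / sqrt (variance (partial_sum f X n)))) (normal_law 0 1)
    \<le> 2 / variance (partial_sum f X n) *
       (cov_bound * energy_tail K + kernel_fluctuation K n + cov_bound * (t * suminf energy + energy_tail K / t))"
    (is "_ \<le> ?B")
proof -
  define s where "s = sqrt (variance (partial_sum f X n))"
  have s: "0 < s" "s\<^sup>2 = variance (partial_sum f X n)" using var by (auto simp: s_def)
  have isk: "integrable M (stein_kernel N n)" for N
    unfolding stein_kernel_def by (rule integrable_gamma_form)
  have kernel: "expectation (\<lambda>\<omega>. \<bar>s\<^sup>2 - stein_kernel N n \<omega>\<bar>) \<le>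
      cov_bound * energy_tail K + kernel_fluctuation K n + cov_bound * (t * suminf energy + energy_tail K / t)"
    if N: "K \<le> N" for N
  proof -
    have "expectation (\<lambda>\<omega>. \<bar>s\<^sup>2 - stein_kernel N n \<omega>\<bar>) \<le> expectation (\<lambda>\<omega>. \<bar>s\<^sup>2 - expectation (stein_kernel K n)\<bar> +
        \<bar>stein_kernel K n \<omega> - expectation (stein_kernel K n)\<bar> + \<bar>stein_kernel N n \<omega> - stein_kernel K n \<omega>\<bar>)"
      using isk by (intro integral_mono) auto
    also have "\<dots> = \<bar>s\<^sup>2 - expectation (stein_kernel K n)\<bar> + kernel_fluctuation K n +
        expectation (\<lambda>\<omega>. \<bar>stein_kernel N n \<omega> - stein_kernel K n \<omega>\<bar>)"
      using isk by (simp add: kernel_fluctuation_def prob_space)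
    also have "\<dots> \<le> cov_bound * energy_tail K + kernel_fluctuation K n + cov_bound * (t * suminf energy + energy_tail K / t)"
      using variance_approx[OF K, of n] s stein_kernel_tail[OF K N t, of n] by (intro add_mono) auto
    finally show ?thesis .
  qed
  show ?thesis unfolding normal_law_0_1 s_def[symmetric]
  proof (rule tv_dist_le_of_Lipschitz_test[OF _ real_distribution_std_gaussian])
    show "real_distribution (distr M borel (\<lambda>\<omega>. partial_sum f X n \<omega> / s))"
      by (rule real_distribution_distr) measurable
    fix L :: real and h :: "real \<Rightarrow> real"
    assume L: "0 \<le> L" "L-lipschitz_on UNIV h" and h: "\<And>x. 0 \<le> h x" "\<And>x. h x \<le> 1"
    have ch: "continuous_on UNIV h" using L(2) by (rule lipschitz_on_continuous_on)
    then have [measurable]: "h \<in> borel_measurable borel" by (rule borel_measurable_continuous_onI)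
    have ih: "integrable M (\<lambda>\<omega>. h (Y \<omega> / s))" if [measurable]: "Y \<in> borel_measurable M" for Y
      by (rule integrable_const_bound[where B=1]) (use h in auto)
    have e: "(\<integral>x. h x \<partial>distr M borel (\<lambda>\<omega>. partial_sum f X n \<omega> / s)) = expectation (\<lambda>\<omega>. h (partial_sum f X n \<omega> / s))"
      by (subst integral_distr) auto
    define D where "D = (\<lambda>N \<omega>. partial_sum f X n \<omega> - partial_hermite_sum N n \<omega>)"
    have [measurable]: "D N \<in> borel_measurable M" for N unfolding D_def by measurable
    have iD2: "integrable M (\<lambda>\<omega>. (D N \<omega>)\<^sup>2)" for N unfolding D_def by (rule partial_sum_approx)
    have iD: "integrable M (D N)" for N by (rule square_integrable_imp_integrable[OF _ iD2]) measurable
    have close: "\<bar>expectation (\<lambda>\<omega>. h (partial_hermite_sum N n \<omega> / s)) - expectation (\<lambda>\<omega>. h (partial_sum f X n \<omega> / s))\<bar>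
        \<le> L / s * sqrt (expectation (\<lambda>\<omega>. (D N \<omega>)\<^sup>2))" for N
    proof -
      have "\<bar>expectation (\<lambda>\<omega>. h (partial_hermite_sum N n \<omega> / s)) - expectation (\<lambda>\<omega>. h (partial_sum f X n \<omega> / s))\<bar> =
          \<bar>expectation (\<lambda>\<omega>. h (partial_hermite_sum N n \<omega> / s) - h (partial_sum f X n \<omega> / s))\<bar>"
        by (subst Bochner_Integration.integral_diff) (auto intro!: ih)
      also have "\<dots> \<le> expectation (\<lambda>\<omega>. \<bar>h (partial_hermite_sum N n \<omega> / s) - h (partial_sum f X n \<omega> / s)\<bar>)"
        by (rule integral_abs_bound)
      also have "\<dots> \<le> expectation (\<lambda>\<omega>. L / s * \<bar>D N \<omega>\<bar>)"
      proof (intro integral_mono)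
        fix \<omega>
        have "\<bar>h (partial_hermite_sum N n \<omega> / s) - h (partial_sum f X n \<omega> / s)\<bar> \<le>
           L * \<bar>partial_hermite_sum N n \<omega> / s - partial_sum f X n \<omega> / s\<bar>"
          using lipschitz_onD[OF L(2), of "partial_hermite_sum N n \<omega> / s" "partial_sum f X n \<omega> / s"] by (simp add: dist_real_def)
        also have "\<bar>partial_hermite_sum N n \<omega> / s - partial_sum f X n \<omega> / s\<bar> = \<bar>D N \<omega>\<bar> / s"
          unfolding diff_divide_distrib[symmetric] abs_divide using s by (simp add: D_def abs_minus_commute)
        finally show "\<bar>h (partial_hermite_sum N n \<omega> / s) - h (partial_sum f X n \<omega> / s)\<bar> \<le> L / s * \<bar>D N \<omega>\<bar>" by simp
      qed (use iD in \<open>auto intro!: integrable_abs Bochner_Integration.integrable_diff ih\<close>)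
      also have "\<dots> = L / s * expectation (\<lambda>\<omega>. \<bar>D N \<omega>\<bar>)" by (rule integral_mult_right_zero)
      also have "\<dots> \<le> L / s * sqrt (expectation (\<lambda>\<omega>. (D N \<omega>)\<^sup>2))"
        using L s by (intro mult_left_mono expectation_abs_le_sqrt iD iD2) auto
      finally show ?thesis .
    qed
    have "(\<lambda>N. L / s * sqrt (expectation (\<lambda>\<omega>. (D N \<omega>)\<^sup>2))) \<longlonglongrightarrow> L / s * sqrt 0"
      by (intro tendsto_intros) (unfold D_def, rule partial_sum_approx)
    then have bound0: "(\<lambda>N. L / s * sqrt (expectation (\<lambda>\<omega>. (D N \<omega>)\<^sup>2))) \<longlonglongrightarrow> 0" by simp
    have "(\<lambda>N. expectation (\<lambda>\<omega>. h (partial_hermite_sum N n \<omega> / s)) - expectation (\<lambda>\<omega>. h (partial_sum f X n \<omega> / s))) \<longlonglongrightarrow> 0"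
      by (rule Lim_null_comparison[OF always_eventually bound0]) (use close in \<open>simp only: real_norm_def, blast\<close>)
    then have "(\<lambda>N. expectation (\<lambda>\<omega>. h (partial_hermite_sum N n \<omega> / s))) \<longlonglongrightarrow> expectation (\<lambda>\<omega>. h (partial_sum f X n \<omega> / s))"
      by (simp add: LIM_zero_iff)
    then have lim: "(\<lambda>N. \<bar>expectation (\<lambda>\<omega>. h (partial_hermite_sum N n \<omega> / s)) - (\<integral>x. h x \<partial>std_gaussian)\<bar>) \<longlonglongrightarrow>
        \<bar>expectation (\<lambda>\<omega>. h (partial_sum f X n \<omega> / s)) - (\<integral>x. h x \<partial>std_gaussian)\<bar>"
      by (intro tendsto_intros)
    have le: "\<bar>expectation (\<lambda>\<omega>. h (partial_hermite_sum N n \<omega> / s)) - (\<integral>x. h x \<partial>std_gaussian)\<bar> \<le> ?B" if N: "K \<le> N" for N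
    proof -
      have "\<bar>expectation (\<lambda>\<omega>. h (partial_hermite_sum N n \<omega> / s)) - (\<integral>x. h x \<partial>std_gaussian)\<bar> \<le>
         2 / s\<^sup>2 * expectation (\<lambda>\<omega>. \<bar>s\<^sup>2 - stein_kernel N n \<omega>\<bar>)"
        unfolding partial_hermite_sum_def stein_kernel_def by (rule stein_bound[OF n d_pos s(1) ch h])
      also have "\<dots> \<le> 2 / s\<^sup>2 * (cov_bound * energy_tail K + kernel_fluctuation K n + cov_bound * (t * suminf energy + energy_tail K / t))"
        by (intro mult_left_mono kernel N) simp
      finally show ?thesis unfolding s(2) .
    qed
    show "\<bar>(\<integral>x. h x \<partial>distr M borel (\<lambda>\<omega>. partial_sum f X n \<omega> / s)) - (\<integral>x. h x \<partial>std_gaussian)\<bar> \<le> ?B"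
      unfolding e by (rule LIMSEQ_le_const2[OF lim]) (use le in blast)
  qed
qed

text \<open>
  For each \<open>m\<close> the average of \<open>R k l ^ m\<close> converges, and the contribution of large \<open>m\<close> is uniformly small.
\<close>

lemma variance_tendsto: "(\<lambda>n. variance (partial_sum f X n)) \<longlonglongrightarrow> limit_variance d c \<rho>"
proof (rule LIMSEQ_I)
  fix r :: real assume r: "0 < r"
  have "0 < r / (4 * (cov_bound + 1))" using r cov_bound_nonneg by (intro divide_pos_pos) auto
  from energy_tail_small[OF this] obtain K where K: "d \<le> K" "energy_tail K < r / (4 * (cov_bound + 1))" by blast
  have small: "cov_bound * energy_tail K \<le> r / 4"
  proof -
    have "cov_bound * energy_tail K \<le> (cov_bound + 1) * (r / (4 * (cov_bound + 1)))"
      using K cov_bound_nonneg energy_tail_nonneg by (intro mult_mono) auto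
    also have "\<dots> = r / 4" using cov_bound_nonneg by (simp add: field_simps add_nonneg_eq_0_iff)
    finally show ?thesis .
  qed
  define S where "S = (\<Sum>m=d..K. fact m * (c m)\<^sup>2 * lag_power_sum m)"
  have "(\<lambda>n. expectation (stein_kernel K n)) \<longlonglongrightarrow> S"
    unfolding expectation_stein_kernel S_def by (intro tendsto_intros cov_average_tendsto) auto
  from LIMSEQ_D[OF this, of "r / 4"] r obtain n0 where
    n0: "\<And>n. n \<ge> n0 \<Longrightarrow> \<bar>expectation (stein_kernel K n) - S\<bar> < r / 4" by auto
  have lim: "\<bar>limit_variance d c \<rho> - S\<bar> \<le> cov_bound * energy_tail K"
  proof -
    have "\<bar>(\<Sum>\<^sub>\<infinity>m\<in>{d..}. fact m * (c m)\<^sup>2 * lag_power_sum m) - S\<bar> \<le> (\<Sum>m. cov_bound * energy (m + Suc K))"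
      unfolding S_def
    proof (rule infsum_atLeast_tail_bound[where a="\<lambda>m. cov_bound * energy m"])
      show "\<bar>fact m * (c m)\<^sup>2 * lag_power_sum m\<bar> \<le> cov_bound * energy m" if "d \<le> m" for m
      proof -
        have "\<bar>fact m * (c m)\<^sup>2 * lag_power_sum m\<bar> = (fact m * (c m)\<^sup>2) * \<bar>lag_power_sum m\<bar>" by (simp add: abs_mult)
        also have "\<dots> \<le> energy m * cov_bound"
          using that d_pos weight_le_energy(3)[of m] abs_lag_power_sum_le[OF that] energy_nonneg by (intro mult_mono) auto
        finally show ?thesis by (simp add: mult.commute)
      qed
    qed (use K summable_energy cov_bound_nonneg energy_nonneg in \<open>auto intro: summable_mult\<close>)
    also have "\<dots> = cov_bound * energy_tail K"
      unfolding energy_tail_def by (rule suminf_mult[OF summable_energy_shift])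
    finally show ?thesis by (simp add: limit_variance_def lag_power_sum_def)
  qed
  show "\<exists>no. \<forall>n\<ge>no. norm (variance (partial_sum f X n) - limit_variance d c \<rho>) < r"
  proof (intro exI allI impI)
    fix n assume "n0 \<le> n"
    then show "norm (variance (partial_sum f X n) - limit_variance d c \<rho>) < r"
      using n0[of n] lim small variance_approx[OF K(1), of n] r unfolding real_norm_def by linarith
  qed
qed

text \<open>
  The parameters are chosen in the order \<open>t\<close>, \<open>K\<close>, \<open>n\<close>: each of the four terms in \<open>tv_dist_bound\<close> becomes at most
  \<open>q\<close>, where \<open>q\<close> is such that the prefactor \<open>2 / var\<close>, at most \<open>2 / v\<close> for large \<open>n\<close>, leaves half of \<open>r\<close>.
\<close>

theorem tv_dist_tendsto:
  assumes pos: "0 < limit_variance d c \<rho>"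
  shows "(\<lambda>n. tv_dist (distr M borel (\<lambda>\<omega>. partial_sum f X n \<omega> / sqrt (variance (partial_sum f X n)))) (normal_law 0 1)) \<longlonglongrightarrow> 0"
proof (rule LIMSEQ_I)
  fix r :: real assume r: "0 < r"
  define v where "v = limit_variance d c \<rho> / 2"
  have v: "0 < v" using pos by (simp add: v_def)
  define q where "q = r * v / 16"
  have q: "0 < q" using r v by (simp add: q_def)
  define C where "C = cov_bound + 1"
  have C: "0 < C" "cov_bound \<le> C" using cov_bound_nonneg by (auto simp: C_def)
  have E0: "0 \<le> suminf energy" by (intro suminf_nonneg summable_energy energy_nonneg)
  define t where "t = q / (C * (suminf energy + 1))"
  have t: "0 < t" using q C E0 by (simp add: t_def)
  have tE: "cov_bound * (t * suminf energy) \<le> q"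
  proof -
    have "cov_bound * (t * suminf energy) \<le> C * (t * (suminf energy + 1))"
      using C t E0 cov_bound_nonneg by (intro mult_mono mult_left_mono) auto
    also have "\<dots> = q" using C E0 by (simp add: t_def field_simps add_nonneg_eq_0_iff)
    finally show ?thesis .
  qed
  define \<eta> where "\<eta> = min (q / C) (q * t / C)"
  have "0 < \<eta>" using q C t by (simp add: \<eta>_def)
  from energy_tail_small[OF this] obtain K where K: "d \<le> K" "energy_tail K < \<eta>" by blast
  have K1: "cov_bound * energy_tail K \<le> q"
  proof -
    have "cov_bound * energy_tail K \<le> C * (q / C)"
      using C K energy_tail_nonneg by (intro mult_mono) (auto simp: \<eta>_def)
    then show ?thesis using C by simp
  qed
  have K2: "cov_bound * (energy_tail K / t) \<le> q"
  proof -
    have "energy_tail K \<le> q * t / C" using K by (simp add: \<eta>_def)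
    then have "energy_tail K / t \<le> q / C" using t C by (simp add: field_simps)
    then have "cov_bound * (energy_tail K / t) \<le> C * (q / C)"
      using C energy_tail_nonneg[of K] t by (intro mult_mono) auto
    then show ?thesis using C by simp
  qed
  obtain n1 where n1: "\<And>n. n \<ge> n1 \<Longrightarrow> \<bar>variance (partial_sum f X n) - limit_variance d c \<rho>\<bar> < v"
    using LIMSEQ_D[OF variance_tendsto v] by auto
  obtain n2 where n2: "\<And>n. n \<ge> n2 \<Longrightarrow> \<bar>kernel_fluctuation K n\<bar> < q"
    using LIMSEQ_D[OF kernel_fluctuation_tendsto q, of K] by auto
  show "\<exists>no. \<forall>n\<ge>no. norm (tv_dist (distr M borel (\<lambda>\<omega>. partial_sum f X n \<omega> / sqrt (variance (partial_sum f X n)))) (normal_law 0 1) - 0) < r"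
  proof (intro exI allI impI)
    fix n assume n: "max 1 (max n1 n2) \<le> n"
    let ?V = "variance (partial_sum f X n)"
    let ?P = "distr M borel (\<lambda>\<omega>. partial_sum f X n \<omega> / sqrt ?V)"
    have V: "v \<le> ?V"
    proof -
      have "n1 \<le> n" using n by simp
      from n1[OF this] show ?thesis unfolding v_def abs_less_iff by linarith
    qed
    interpret P: real_distribution ?P by (rule real_distribution_distr) measurable
    have "tv_dist ?P (normal_law 0 1) \<le> 2 / ?V *
       (cov_bound * energy_tail K + kernel_fluctuation K n + cov_bound * (t * suminf energy + energy_tail K / t))"
      using n V v K t by (intro tv_dist_bound) auto
    also have "\<dots> \<le> 2 / ?V * (4 * q)"
      using K1 K2 tE n2[of n] n V v by (intro mult_left_mono) (auto simp: distrib_left abs_less_iff)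
    also have "\<dots> \<le> 2 / v * (4 * q)" using V v q by (intro mult_right_mono divide_left_mono) auto
    also have "\<dots> < r" using r v by (simp add: q_def)
    finally have up: "tv_dist ?P (normal_law 0 1) < r" .
    have "\<bar>measure ?P {} - measure (normal_law 0 1) {}\<bar> \<le> tv_dist ?P (normal_law 0 1)"
      unfolding tv_dist_def
    proof (rule cSUP_upper)
      have "\<bar>measure ?P A - measure (normal_law 0 1) A\<bar> \<le> 1" for A
        using P.prob_le_1[of A] gaussian.prob_le_1[of A] measure_nonneg[of ?P A] measure_nonneg[of std_gaussian A]
        unfolding normal_law_0_1 by linarith
      then show "bdd_above ((\<lambda>A. \<bar>measure ?P A - measure (normal_law 0 1) A\<bar>) ` sets borel)"
        by (intro bdd_aboveI[of _ 1]) auto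
    qed simp
    then show "norm (tv_dist ?P (normal_law 0 1) - 0) < r" using up by simp
  qed
qed

end

theorem theorem3:
  fixes M :: "'a measure"
    and X :: "nat \<Rightarrow> 'a \<Rightarrow> real"
    and \<rho> :: "nat \<Rightarrow> real"
    and f :: "real \<Rightarrow> real"
    and d :: nat
    and c :: "nat \<Rightarrow> real"
  assumes "prob_space M"
    and "gaussian_sequence M X"
    and "stationary_sequence M X"
    and "\<And>k. 1 \<le> k \<Longrightarrow> prob_space.expectation M (X k) = 0"
    and "\<And>k. 1 \<le> k \<Longrightarrow> prob_space.variance M (X k) = 1"
    and "\<And>k l. 1 \<le> k \<Longrightarrow> 1 \<le> l \<Longrightarrow>
           \<rho> (nat \<bar>int k - int l\<bar>) = prob_space.expectation M (\<lambda>\<omega>. X k \<omega> * X l \<omega>)"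
    and "f \<in> malliavin_sobolev"
    and "1 \<le> d"
    and "has_hermite_expansion_from f d c"
    and "c d \<noteq> 0"
    and "summable (\<lambda>k. \<bar>\<rho> k\<bar> ^ d)"
    and "0 < limit_variance d c \<rho>"
  shows "(\<lambda>n. tv_dist
            (distr M borel
               (\<lambda>\<omega>. partial_sum f X n \<omega> / sqrt (prob_space.variance M (partial_sum f X n))))
            (normal_law 0 1)) \<longlonglongrightarrow> 0"
proof -
  interpret prob_space M by (rule assms(1))
  interpret unit_gaussian_sequence M X by unfold_locales (use assms in auto)
  interpret breuer_major_setting M X \<rho> d
    by unfold_locales (use assms in \<open>auto simp: R_def lag_def\<close>)
  interpret breuer_major M X \<rho> d f c by unfold_locales (use assms in auto)
  show ?thesis using tv_dist_tendsto assms(12) by blast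
qed

end
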